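(* Let $\mathcal{E}=(L|K,v)$ be a Kummer extension of valued fields of degree $p=[Lv:Kv]=\mathrm{char}\,Kv$. Then there exists a Kummer generator $\eta\in L$ such that one of the following cases holds: (i) $v\eta=0$, $Lv=Kv(\eta v)$ with $Lv|Kv$ inseparable, and $\mathcal{O}_L=\mathcal{O}_K[\eta]$; (ii) $\eta$ is a $1$-unit and, for suitable $\tilde c\in K^\times$, $v(\tilde c(\eta-1))=0$, $Lv=Kv\big((\tilde c(\eta-1))v\big)$ and $\mathcal{O}_L=\mathcal{O}_K[\tilde c(\eta-1)]$. In case (i), $$\Omega_{\mathcal{O}_L|\mathcal{O}_K}\cong\mathcal{O}_L/(p)\cong I_{\mathcal{E}}/I_{\mathcal{E}}^p$$ as $\mathcal{O}_L$-modules; consequently, $\Omega_{\mathcal{O}_L|\mathcal{O}_K}\neq0$. In case (ii), $$\Omega_{\mathcal{O}_L|\mathcal{O}_K}\cong\mathcal{O}_L/(p\tilde c^{\,p-1})\cong I_{\mathcal{E}}/I_{\mathcal{E}}^p$$ as $\mathcal{O}_L$-modules, and $\Omega_{\mathcal{O}_L|\mathcal{O}_K}=0$ if and only if $Lv|Kv$ is separable.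
   Context: Valuations are Krull valuations of arbitrary rank. $(L|K,v)$ denotes a field extension $L|K$ with a valuation $v$ on $L$, $K$ being endowed with the restriction of $v$. $\mathcal{O}_K,\mathcal{O}_L$ are the valuation rings, $Kv,Lv$ the residue fields, $vx$ the value and $xv$ the residue of an element $x$. $\Omega_{B|A}$ is the module of relative Kähler differentials. A Kummer extension of prime degree $q$ is a Galois extension $L|K$ of degree $q\ne\mathrm{char}\,K$ where $K$ contains all $q$-th roots of unity; a Kummer generator is an element $\eta$ with $L=K(\eta)$ and $\eta^q\in K$. A $1$-unit is an element $u$ of the valuation ring with $v(u-1)>0$. The extensions considered here are automatically unibranched. $I_{\mathcal{E}}$ is the ramification ideal of $\mathcal{E}$: the $\mathcal{O}_L$-ideal generated by all elements $\frac{\sigma b-b}{b}$ with $\sigma\in\mathrm{Gal}(L|K)$ and $b\in L^\times$. $(a)$ denotes the $\mathcal{O}_L$-ideal generated by $a$. *)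

theory Defs
  imports
    "HOL-Algebra.Module"
    "HOL-Algebra.Ideal_Product"
    "HOL-Algebra.Generated_Fields"
    "HOL-Algebra.Finite_Extensions"
    "HOL-Computational_Algebra.Primes"
begin

text \<open>
  Conventions. A field extension \<open>L|K\<close> is a field record \<open>L\<close> together with a subset \<open>K\<close> of its
  carrier satisfying \<open>subfield K L\<close>; likewise for ring extensions. \<open>R\<lparr>carrier := S\<rparr>\<close> is the
  subset \<open>S\<close> of \<open>R\<close> with the operations of \<open>R\<close>.
\<close>

section \<open>Modules\<close>

text \<open>In the records below, the ring-valued fields \<open>mult\<close> and \<open>one\<close> that \<open>module\<close> inherits from
  \<open>ring\<close> carry no meaning.\<close>

definition regular_module :: "('a, 'm) ring_scheme \<Rightarrow> ('a, 'a) module" where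
  "regular_module R = \<lparr>carrier = carrier R, monoid.mult = undefined, one = undefined,
     zero = \<zero>\<^bsub>R\<^esub>, add = add R, smult = monoid.mult R\<rparr>"

definition quotient_module :: "('r, 'a, 'm) module_scheme \<Rightarrow> 'a set \<Rightarrow> ('r, 'a set) module" where
  "quotient_module M N = \<lparr>carrier = a_rcosets\<^bsub>M\<^esub> N, monoid.mult = undefined, one = undefined,
     zero = N, add = set_add M, smult = (\<lambda>r C. \<Union>x\<in>C. N +>\<^bsub>M\<^esub> (r \<odot>\<^bsub>M\<^esub> x))\<rparr>"

definition module_span ::
  "('r, 's) ring_scheme \<Rightarrow> ('r, 'a, 'm) module_scheme \<Rightarrow> 'a set \<Rightarrow> 'a set" where
  "module_span R M S = \<Inter> {N. submodule N R M \<and> S \<subseteq> N}"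

definition module_isomorphic ::
  "('r, 's) ring_scheme \<Rightarrow> ('r, 'a, 'm) module_scheme \<Rightarrow> ('r, 'b, 'n) module_scheme \<Rightarrow> bool" where
  "module_isomorphic R M N \<longleftrightarrow> (\<exists>h. bij_betw h (carrier M) (carrier N)
     \<and> (\<forall>x\<in>carrier M. \<forall>y\<in>carrier M. h (x \<oplus>\<^bsub>M\<^esub> y) = h x \<oplus>\<^bsub>N\<^esub> h y)
     \<and> (\<forall>r\<in>carrier R. \<forall>x\<in>carrier M. h (r \<odot>\<^bsub>M\<^esub> x) = r \<odot>\<^bsub>N\<^esub> h x))"

definition zero_module :: "('r, 'a, 'm) module_scheme \<Rightarrow> bool" where
  "zero_module M \<longleftrightarrow> carrier M = {\<zero>\<^bsub>M\<^esub>}"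

definition free_module :: "('r, 's) ring_scheme \<Rightarrow> 'b set \<Rightarrow> ('r, 'b \<Rightarrow> 'r) module" where
  "free_module R S = \<lparr>
     carrier = {f. (\<forall>s\<in>S. f s \<in> carrier R) \<and> (\<forall>s. s \<notin> S \<longrightarrow> f s = \<zero>\<^bsub>R\<^esub>)
                   \<and> finite {s. f s \<noteq> \<zero>\<^bsub>R\<^esub>}},
     monoid.mult = undefined, one = undefined,
     zero = (\<lambda>s. \<zero>\<^bsub>R\<^esub>), add = (\<lambda>f g s. f s \<oplus>\<^bsub>R\<^esub> g s), smult = (\<lambda>r f s. r \<otimes>\<^bsub>R\<^esub> f s)\<rparr>"

section \<open>Kaehler differentials\<close>

text \<open>\<open>\<Omega>\<^bsub>B|A\<^esub>\<close> for a subring \<open>A\<close> of a commutative ring \<open>B\<close>: the \<open>B\<close>-module with generators \<open>d b\<close>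
  (\<open>b \<in> B\<close>) and relations \<open>d a = 0\<close> for \<open>a \<in> A\<close>, \<open>d (x + y) = d x + d y\<close> and
  \<open>d (x y) = x d y + y d x\<close>. The formal symbol \<open>d b\<close> is \<open>kaehler_gen B b\<close>.\<close>

definition kaehler_gen :: "('a, 'm) ring_scheme \<Rightarrow> 'a \<Rightarrow> 'a \<Rightarrow> 'a" where
  "kaehler_gen B b = (\<lambda>t. if t = b then \<one>\<^bsub>B\<^esub> else \<zero>\<^bsub>B\<^esub>)"

definition kaehler_relations :: "('a, 'm) ring_scheme \<Rightarrow> 'a set \<Rightarrow> ('a \<Rightarrow> 'a) set" where
  "kaehler_relations B A =
    (let F = free_module B (carrier B); d = kaehler_gen B in
       {d a | a. a \<in> A}
     \<union> {d (x \<oplus>\<^bsub>B\<^esub> y) \<ominus>\<^bsub>F\<^esub> (d x \<oplus>\<^bsub>F\<^esub> d y) | x y. x \<in> carrier B \<and> y \<in> carrier B}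
     \<union> {d (x \<otimes>\<^bsub>B\<^esub> y) \<ominus>\<^bsub>F\<^esub> (x \<odot>\<^bsub>F\<^esub> d y \<oplus>\<^bsub>F\<^esub> y \<odot>\<^bsub>F\<^esub> d x) | x y. x \<in> carrier B \<and> y \<in> carrier B})"

definition kaehler_module :: "('a, 'm) ring_scheme \<Rightarrow> 'a set \<Rightarrow> ('a, ('a \<Rightarrow> 'a) set) module" where
  "kaehler_module B A =
    (let F = free_module B (carrier B) in
       quotient_module F (module_span B F (kaehler_relations B A)))"

section \<open>Field extensions\<close>

definition characteristic :: "('a, 'm) ring_scheme \<Rightarrow> nat" where
  "characteristic R =
    (if \<exists>n::nat. n > 0 \<and> [n] \<cdot>\<^bsub>R\<^esub> \<one>\<^bsub>R\<^esub> = \<zero>\<^bsub>R\<^esub>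
     then LEAST n::nat. n > 0 \<and> [n] \<cdot>\<^bsub>R\<^esub> \<one>\<^bsub>R\<^esub> = \<zero>\<^bsub>R\<^esub> else 0)"

text \<open>Polynomials are lists of coefficients, the leading coefficient first.\<close>

definition poly_deriv :: "('a, 'm) ring_scheme \<Rightarrow> 'a list \<Rightarrow> 'a list" where
  "poly_deriv R f =
     ring.normalize R (map (\<lambda>i. [i] \<cdot>\<^bsub>R\<^esub> ring.coeff R f i) (rev [1..<length f]))"

text \<open>No multiple roots in an algebraic closure, i.e. \<open>f\<close> is coprime to its derivative in \<open>K[X]\<close>.\<close>

definition separable_poly :: "('a, 'm) ring_scheme \<Rightarrow> 'a set \<Rightarrow> 'a list \<Rightarrow> bool" where
  "separable_poly R K f \<longleftrightarrow>
     (\<forall>g\<in>carrier (K[X]\<^bsub>R\<^esub>). g divides\<^bsub>K[X]\<^bsub>R\<^esub>\<^esub> f \<and> g divides\<^bsub>K[X]\<^bsub>R\<^esub>\<^esub> poly_deriv R f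
        \<longrightarrow> g \<in> Units (K[X]\<^bsub>R\<^esub>))"

definition algebraic_extension :: "('a, 'm) ring_scheme \<Rightarrow> 'a set \<Rightarrow> bool" where
  "algebraic_extension L K \<longleftrightarrow> (\<forall>x\<in>carrier L. ring.algebraic L K x)"

definition separable_extension :: "('a, 'm) ring_scheme \<Rightarrow> 'a set \<Rightarrow> bool" where
  "separable_extension L K \<longleftrightarrow> algebraic_extension L K
     \<and> (\<forall>x\<in>carrier L. separable_poly L K (ring.Irr L K x))"

definition Gal :: "('a, 'm) ring_scheme \<Rightarrow> 'a set \<Rightarrow> ('a \<Rightarrow> 'a) set" where
  "Gal L K = {\<sigma> \<in> ring_iso L L \<inter> extensional (carrier L). \<forall>x\<in>K. \<sigma> x = x}"

definition galois_extension :: "('a, 'm) ring_scheme \<Rightarrow> 'a set \<Rightarrow> bool" where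
  "galois_extension L K \<longleftrightarrow> field L \<and> subfield K L \<and> algebraic_extension L K
     \<and> {x \<in> carrier L. \<forall>\<sigma>\<in>Gal L K. \<sigma> x = x} = K"

text \<open>As \<open>q \<noteq> char K\<close>, there are exactly \<open>q\<close> roots of unity of order dividing \<open>q\<close> in an algebraic
  closure of \<open>K\<close>, so the last conjunct says that all of them lie in \<open>K\<close>.\<close>

definition kummer_extension :: "('a, 'm) ring_scheme \<Rightarrow> 'a set \<Rightarrow> nat \<Rightarrow> bool" where
  "kummer_extension L K q \<longleftrightarrow> galois_extension L K \<and> Factorial_Ring.prime q
     \<and> ring.dimension L q K (carrier L)
     \<and> q \<noteq> characteristic (L\<lparr>carrier := K\<rparr>)
     \<and> card {\<zeta> \<in> K. \<zeta> [^]\<^bsub>L\<^esub> q = \<one>\<^bsub>L\<^esub>} = q"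

definition kummer_generator :: "('a, 'm) ring_scheme \<Rightarrow> 'a set \<Rightarrow> nat \<Rightarrow> 'a \<Rightarrow> bool" where
  "kummer_generator L K q \<eta> \<longleftrightarrow> \<eta> \<in> carrier L
     \<and> carrier L = generate_field L (K \<union> {\<eta>}) \<and> \<eta> [^]\<^bsub>L\<^esub> q \<in> K"

section \<open>Valuations\<close>

text \<open>Krull valuations, written additively, with values in an arbitrary linearly ordered abelian
  group \<open>'g\<close>. The convention \<open>v 0 = \<infinity>\<close> is rendered by leaving \<open>v \<zero>\<close> unspecified and treating zero
  separately wherever values are compared. The valuation of a subfield \<open>K\<close> is the restriction
  of \<open>v\<close>.\<close>

locale valued_field = field L
  for L :: "('a, 'm) ring_scheme" (structure) +
  fixes v :: "'a \<Rightarrow> 'g :: linordered_ab_group_add"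
  assumes val_mult: "\<lbrakk>x \<in> carrier L - {\<zero>}; y \<in> carrier L - {\<zero>}\<rbrakk> \<Longrightarrow> v (x \<otimes> y) = v x + v y"
    and val_add: "\<lbrakk>x \<in> carrier L - {\<zero>}; y \<in> carrier L - {\<zero>}; x \<oplus> y \<noteq> \<zero>\<rbrakk>
      \<Longrightarrow> min (v x) (v y) \<le> v (x \<oplus> y)"

definition val_ring ::
  "('a, 'm) ring_scheme \<Rightarrow> ('a \<Rightarrow> 'g :: linordered_ab_group_add) \<Rightarrow> 'a set \<Rightarrow> 'a set" where
  "val_ring L v K = {x \<in> K. x = \<zero>\<^bsub>L\<^esub> \<or> 0 \<le> v x}"

definition val_ideal ::
  "('a, 'm) ring_scheme \<Rightarrow> ('a \<Rightarrow> 'g :: linordered_ab_group_add) \<Rightarrow> 'a set" where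
  "val_ideal L v = {x \<in> carrier L. x = \<zero>\<^bsub>L\<^esub> \<or> 0 < v x}"

abbreviation val_Ring ::
  "('a, 'm) ring_scheme \<Rightarrow> ('a \<Rightarrow> 'g :: linordered_ab_group_add) \<Rightarrow> ('a, 'm) ring_scheme" where
  "val_Ring L v \<equiv> L\<lparr>carrier := val_ring L v (carrier L)\<rparr>"

definition residue_field ::
  "('a, 'm) ring_scheme \<Rightarrow> ('a \<Rightarrow> 'g :: linordered_ab_group_add) \<Rightarrow> 'a set ring" where
  "residue_field L v = val_Ring L v Quot val_ideal L v"

definition residue ::
  "('a, 'm) ring_scheme \<Rightarrow> ('a \<Rightarrow> 'g :: linordered_ab_group_add) \<Rightarrow> 'a \<Rightarrow> 'a set" where
  "residue L v x = val_ideal L v +>\<^bsub>val_Ring L v\<^esub> x"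

text \<open>\<open>Kv\<close>, canonically embedded into \<open>Lv\<close>.\<close>

definition residue_subfield ::
  "('a, 'm) ring_scheme \<Rightarrow> ('a \<Rightarrow> 'g :: linordered_ab_group_add) \<Rightarrow> 'a set \<Rightarrow> 'a set set" where
  "residue_subfield L v K = residue L v ` val_ring L v K"

definition one_unit ::
  "('a, 'm) ring_scheme \<Rightarrow> ('a \<Rightarrow> 'g :: linordered_ab_group_add) \<Rightarrow> 'a \<Rightarrow> bool" where
  "one_unit L v u \<longleftrightarrow> u \<in> val_ring L v (carrier L) \<and> u \<ominus>\<^bsub>L\<^esub> \<one>\<^bsub>L\<^esub> \<in> val_ideal L v"

text \<open>If \<open>v\<close> is the only extension of its restriction to \<open>K\<close>, then \<open>v \<circ> \<sigma> = v\<close> for all \<open>\<sigma>\<close>, so that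
  the generators below lie in the valuation ring of \<open>L\<close>, as the library's ideal closure requires.\<close>

definition ramification_ideal ::
  "('a, 'm) ring_scheme \<Rightarrow> 'a set \<Rightarrow> ('a \<Rightarrow> 'g :: linordered_ab_group_add) \<Rightarrow> 'a set" where
  "ramification_ideal L K v = Idl\<^bsub>val_Ring L v\<^esub>
     {(\<sigma> b \<ominus>\<^bsub>L\<^esub> b) \<otimes>\<^bsub>L\<^esub> inv\<^bsub>L\<^esub> b | \<sigma> b. \<sigma> \<in> Gal L K \<and> b \<in> carrier L - {\<zero>\<^bsub>L\<^esub>}}"

section \<open>The modules and the two cases of the theorem\<close>

definition Omega ::
  "('a, 'm) ring_scheme \<Rightarrow> 'a set \<Rightarrow> ('a \<Rightarrow> 'g :: linordered_ab_group_add)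
     \<Rightarrow> ('a, ('a \<Rightarrow> 'a) set) module" where
  "Omega L K v = kaehler_module (val_Ring L v) (val_ring L v K)"

definition val_ring_mod ::
  "('a, 'm) ring_scheme \<Rightarrow> ('a \<Rightarrow> 'g :: linordered_ab_group_add) \<Rightarrow> 'a
     \<Rightarrow> ('a, 'a set) module" where
  "val_ring_mod L v a = quotient_module (regular_module (val_Ring L v)) (PIdl\<^bsub>val_Ring L v\<^esub> a)"

text \<open>\<open>I/I\<^sup>n\<close> for the ramification ideal \<open>I\<close>\<close>

definition ramification_quotient ::
  "('a, 'm) ring_scheme \<Rightarrow> 'a set \<Rightarrow> ('a \<Rightarrow> 'g :: linordered_ab_group_add) \<Rightarrow> nat
     \<Rightarrow> ('a, 'a set) module" where
  "ramification_quotient L K v n =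
    (let I = ramification_ideal L K v in
       quotient_module ((regular_module (val_Ring L v))\<lparr>carrier := I\<rparr>)
         (I [^]\<^bsub>ideals_set (val_Ring L v)\<^esub> n))"

definition unit_generator ::
  "('a, 'm) ring_scheme \<Rightarrow> 'a set \<Rightarrow> ('a \<Rightarrow> 'g :: linordered_ab_group_add) \<Rightarrow> 'a \<Rightarrow> bool" where
  "unit_generator L K v x \<longleftrightarrow> x \<in> carrier L - {\<zero>\<^bsub>L\<^esub>} \<and> v x = 0
     \<and> carrier (residue_field L v)
         = generate_field (residue_field L v) (residue_subfield L v K \<union> {residue L v x})
     \<and> val_ring L v (carrier L) = generate_ring L (val_ring L v K \<union> {x})"

definition case_i ::
  "('a, 'm) ring_scheme \<Rightarrow> 'a set \<Rightarrow> ('a \<Rightarrow> 'g :: linordered_ab_group_add) \<Rightarrow> 'a \<Rightarrow> bool" where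
  "case_i L K v \<eta> \<longleftrightarrow> unit_generator L K v \<eta>
     \<and> \<not> separable_extension (residue_field L v) (residue_subfield L v K)"

definition case_ii ::
  "('a, 'm) ring_scheme \<Rightarrow> 'a set \<Rightarrow> ('a \<Rightarrow> 'g :: linordered_ab_group_add)
     \<Rightarrow> 'a \<Rightarrow> 'a \<Rightarrow> bool" where
  "case_ii L K v \<eta> c \<longleftrightarrow> one_unit L v \<eta> \<and> c \<in> K - {\<zero>\<^bsub>L\<^esub>}
     \<and> unit_generator L K v (c \<otimes>\<^bsub>L\<^esub> (\<eta> \<ominus>\<^bsub>L\<^esub> \<one>\<^bsub>L\<^esub>))"

end

theory Submission
  imports Defs
begin

text \<open>
  Write \<open>\<sigma>\<close> for a nontrivial automorphism and \<open>\<zeta>\<close> for a root of unity. If the residue of \<open>y\<close> lies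
  outside \<open>Kv\<close>, then \<open>1, y, \<dots>, y\<^bsup>p-1\<^esup>\<close> is a valuation basis: \<open>v (\<Sum> a\<^sub>i y\<^sup>i) = min v a\<^sub>i\<close>. Hence
  \<open>vL = vK\<close>, \<open>\<O>\<^sub>L = \<O>\<^sub>K[y]\<close>, and the constant coefficient of an element of \<open>L\<close> is its best approximation
  from \<open>K\<close>. For a Kummer generator \<open>\<eta>\<close> of value \<open>0\<close> with best approximation \<open>d\<close>, \<open>v (\<eta> - d) = 0\<close> gives
  case (i), and otherwise \<open>\<eta> / d\<close> is as in case (ii).

  In both cases \<open>\<O>\<^sub>L = \<O>\<^sub>K[x]\<close> with \<open>x = \<theta> - c\<close>, \<open>c \<in> K\<close> and \<open>\<theta>\<^sup>p \<in> K\<close>. The minimal polynomial \<open>f\<close> of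
  \<open>x\<close> satisfies \<open>f' x = p \<theta>\<^bsup>p-1\<^esup>\<close>, and \<open>\<Omega> \<cong> \<O>\<^sub>L / (f' x)\<close>. The ramification ideal is generated by
  \<open>\<sigma> x - x = (\<zeta> - 1) \<theta>\<close>, whose \<open>(p-1)\<close>-st power generates \<open>(f' x)\<close>, because \<open>p\<close> and \<open>(\<zeta> - 1)\<^bsup>p-1\<^esup>\<close>
  differ by a unit.

  It remains to see that \<open>Lv|Kv\<close> is separable iff \<open>\<sigma> x - x\<close> is a unit. If it is not, then the norm of \<open>x\<close>
  reduces to the \<open>p\<close>-th power of the residue of \<open>x\<close>, which therefore lies in \<open>Kv\<close>. Conversely, if
  \<open>y\<close> generates the residue extension and the \<open>p\<close>-th power of its residue lies in \<open>Kv\<close>, then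
  \<open>(\<sigma> y / y)\<^sup>p\<close> and hence \<open>\<sigma> y / y\<close> is a 1-unit, and \<open>\<sigma> x - x\<close> is a multiple of \<open>\<sigma> y - y\<close>.
\<close>

section \<open>Polynomial expressions and extensions of prime degree\<close>

text \<open>Neither the Galois correspondence nor the uniqueness of the extension of v is invoked.
  Since the degree is prime, the fixed field of a single nontrivial automorphism is K; automorphisms
  preserve the valuation ring because it is integrally closed and generated over
  \<open>\<O>\<^sub>K\<close> by one element. A best approximation from K exists in any rank because
  a value in L is a minimum over finitely many coefficients.

  That p and (\<zeta> - 1)^(p-1) are associated comes from (1 + t)^p = 1 for t = \<zeta> - 1:
  dividing by t leaves t^(p-1) = -p (1 + t h), and the bracket is a unit once t has positive value.

  The lower bound for \<Omega> needs a map that detects dx. The formal derivative with respect to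
  the power basis of x is at hand, but it respects products only modulo f'(x); this is exactly what
  the target \<open>\<O>\<^sub>L / (f' x)\<close> tolerates.

  The ideals of the theorem are read off from f'(x) = p \<theta>^(p-1): in case (i) \<theta> =
  \<eta> is a unit, which leaves p; in case (ii) \<theta> = c \<eta> with a unit \<eta>, which
  leaves p c^(p-1).\<close>

definition psum :: "('a, 'm) ring_scheme \<Rightarrow> nat \<Rightarrow> (nat \<Rightarrow> 'a) \<Rightarrow> 'a \<Rightarrow> 'a" where
  "psum R n a x = (\<Oplus>\<^bsub>R\<^esub>i\<in>{..<n}. a i \<otimes>\<^bsub>R\<^esub> x [^]\<^bsub>R\<^esub> i)"

text \<open>Rewriting modulo associativity and commutativity need not place \<open>x\<close> next to its negative, hence
  these rules for cancelling at a distance.\<close>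

lemma (in abelian_group) add_cancel:
  assumes [simp]: "x \<in> carrier G" "a \<in> carrier G" "b \<in> carrier G" "c \<in> carrier G" "d \<in> carrier G" "e \<in> carrier G" "z \<in> carrier G"
  shows "x \<oplus> (a \<oplus> \<ominus> x) = a" "x \<oplus> (a \<oplus> (\<ominus> x \<oplus> z)) = a \<oplus> z"
    "x \<oplus> (a \<oplus> (b \<oplus> \<ominus> x)) = a \<oplus> b" "x \<oplus> (a \<oplus> (b \<oplus> (\<ominus> x \<oplus> z))) = a \<oplus> (b \<oplus> z)"
    "x \<oplus> (a \<oplus> (b \<oplus> (c \<oplus> \<ominus> x))) = a \<oplus> (b \<oplus> c)"
    "x \<oplus> (a \<oplus> (b \<oplus> (c \<oplus> (\<ominus> x \<oplus> z)))) = a \<oplus> (b \<oplus> (c \<oplus> z))"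
    "x \<oplus> (a \<oplus> (b \<oplus> (c \<oplus> (d \<oplus> \<ominus> x)))) = a \<oplus> (b \<oplus> (c \<oplus> d))"
    "x \<oplus> (a \<oplus> (b \<oplus> (c \<oplus> (d \<oplus> (\<ominus> x \<oplus> z))))) = a \<oplus> (b \<oplus> (c \<oplus> (d \<oplus> z)))"
    "x \<oplus> (a \<oplus> (b \<oplus> (c \<oplus> (d \<oplus> (e \<oplus> \<ominus> x))))) = a \<oplus> (b \<oplus> (c \<oplus> (d \<oplus> e)))"
    "x \<oplus> (a \<oplus> (b \<oplus> (c \<oplus> (d \<oplus> (e \<oplus> (\<ominus> x \<oplus> z)))))) = a \<oplus> (b \<oplus> (c \<oplus> (d \<oplus> (e \<oplus> z))))"
  by (simp_all add: a_lcomm[of x] r_neg r_neg2)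

lemma (in domain) nat_pow_eq_0_iff:
  "x \<in> carrier R \<Longrightarrow> x [^] (n::nat) = \<zero> \<longleftrightarrow> x = \<zero> \<and> n \<noteq> 0"
  by (induction n) (auto simp: integral_iff)

context cring
begin

lemmas ring_cancel =
  minus_eq minus_add l_distr r_distr l_minus r_minus a_ac m_ac r_neg r_neg1 r_neg2 l_neg add_cancel

lemma psum_0 [simp]: "psum R 0 a x = \<zero>"
  by (simp add: psum_def)

text \<open>Coefficients lie in the carrier for every \<open>i\<close>, not only below
  \<open>n\<close>. This keeps the inductions free of bounds; in return, coefficient functions are
  padded with zeros later on.\<close>

lemma psum_Suc [simp]:
  assumes "\<And>i. a i \<in> carrier R" and "x \<in> carrier R"
  shows "psum R (Suc n) a x = psum R n a x \<oplus> a n \<otimes> x [^] n"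
proof -
  have "(\<lambda>i. a i \<otimes> x [^] i) \<in> {..<n} \<rightarrow> carrier R" "a n \<otimes> x [^] n \<in> carrier R"
    using assms by auto
  then show ?thesis
    using assms by (simp add: psum_def lessThan_Suc a_comm)
qed

lemma psum_closed [simp]:
  assumes "\<And>i. a i \<in> carrier R" and "x \<in> carrier R"
  shows "psum R n a x \<in> carrier R"
  using assms by (induction n) auto

text \<open>\<open>S\<close> is only closed under addition, so that the lemma applies to
  \<open>\<O>\<close>, to generated rings and to sets such as that of all t with t z^n in
  \<open>\<M>\<close>.\<close>

lemma psum_in:
  assumes "\<And>i. a i \<in> carrier R" and "x \<in> carrier R" and "\<And>i. i < n \<Longrightarrow> a i \<otimes> x [^] i \<in> S" 
    and "\<zero> \<in> S" and "\<And>s t. s \<in> S \<Longrightarrow> t \<in> S \<Longrightarrow> s \<oplus> t \<in> S"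
  shows "psum R n a x \<in> S"
  using assms(3) by (induction n) (use assms(1,2,4,5) in auto)

lemma psum_cong:
  assumes "\<And>i. i < n \<Longrightarrow> a i = b i" and "\<And>i. a i \<in> carrier R" and "\<And>i. b i \<in> carrier R" and "x \<in> carrier R"
  shows "psum R n a x = psum R n b x"
  using assms(1) by (induction n) (use assms(2-4) in auto)

lemma psum_add:
  assumes [simp]: "\<And>i. a i \<in> carrier R" "\<And>i. b i \<in> carrier R" "x \<in> carrier R"
  shows "psum R n (\<lambda>i. a i \<oplus> b i) x = psum R n a x \<oplus> psum R n b x"
  by (induction n) (simp_all add: l_distr a_ac)

lemma psum_smult:
  assumes [simp]: "\<And>i. a i \<in> carrier R" "c \<in> carrier R" "x \<in> carrier R"
  shows "psum R n (\<lambda>i. c \<otimes> a i) x = c \<otimes> psum R n a x"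
  by (induction n) (simp_all add: r_distr m_assoc)

lemma psum_minus:
  assumes [simp]: "\<And>i. a i \<in> carrier R" "\<And>i. b i \<in> carrier R" "x \<in> carrier R"
  shows "psum R n (\<lambda>i. a i \<ominus> b i) x = psum R n a x \<ominus> psum R n b x"
proof (induction n)
  case (Suc n)
  have id: "(s \<ominus> t) \<oplus> (c \<ominus> d) \<otimes> y = (s \<oplus> c \<otimes> y) \<ominus> (t \<oplus> d \<otimes> y)"
    if "s \<in> carrier R" "t \<in> carrier R" "c \<in> carrier R" "d \<in> carrier R" "y \<in> carrier R" for s t c d y
    using that by algebra
  show ?case
    using Suc by (simp add: id)
qed (simp add: minus_eq)

lemma psum_single:
  assumes [simp]: "c \<in> carrier R" "x \<in> carrier R"
  shows "psum R n (\<lambda>i. if i = j then c else \<zero>) x = (if j < n then c \<otimes> x [^] j else \<zero>)"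
  by (induction n) (auto simp: less_Suc_eq)

lemma psum_split_0:
  assumes [simp]: "\<And>i. a i \<in> carrier R" "x \<in> carrier R"
  shows "psum R (Suc n) a x = a 0 \<oplus> x \<otimes> psum R n (\<lambda>i. a (Suc i)) x"
proof (induction n)
  case (Suc n)
  have id: "(a0 \<oplus> x \<otimes> s) \<oplus> c \<otimes> (y \<otimes> x) = a0 \<oplus> x \<otimes> (s \<oplus> c \<otimes> y)"
    if "a0 \<in> carrier R" "s \<in> carrier R" "c \<in> carrier R" "y \<in> carrier R" for a0 s c y
    using that assms(2) by algebra
  have "psum R (Suc (Suc n)) a x = psum R (Suc n) a x \<oplus> a (Suc n) \<otimes> x [^] Suc n"
    by (rule psum_Suc) auto
  then show ?case
    unfolding Suc by (simp add: id)
qed simp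

text \<open>Bridge to the library's spans and evaluations; \<open>exp_base\<close> lists the powers
  in descending order, hence \<open>rev\<close>.\<close>

lemma combine_exp_base_eq_psum:
  assumes [simp]: "\<And>i. a i \<in> carrier R" "x \<in> carrier R"
  shows "combine (map a (rev [0..<n])) (exp_base x n) = psum R n a x"
  by (induction n) (simp_all add: exp_base_def a_comm)

end

section \<open>Extensions of prime degree\<close>

locale prime_degree_extension = field F for F :: "('a, 'm) ring_scheme" (structure) +
  fixes K :: "'a set" and p :: nat
  assumes subfield_K: "subfield K F" and dim_p: "dimension p K (carrier F)"
    and prime_p: "Factorial_Ring.prime p"
begin

lemma K_subset: "K \<subseteq> carrier F"
  using subfieldE(3)[OF subfield_K] .

lemma p_ge_2: "p \<ge> 2"
  using prime_p by (simp add: prime_ge_2_nat)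

lemma algebraic_over_K: "x \<in> carrier F \<Longrightarrow> (algebraic over K) x"
  using finite_dimension_imp_algebraic[OF subfield_K carrier_is_subring finite_dimensionI[OF dim_p]] .

text \<open>Degrees multiply in the tower from K over E to F, and p is prime, so one of the two
  steps has degree 1.\<close>

lemma intermediate_field:
  assumes E: "subfield E F" and "K \<subseteq> E"
  shows "E = K \<or> E = carrier F"
proof -
  note sE = subfieldE[OF E]
  have "subalgebra K E F"
    using E \<open>K \<subseteq> E\<close> subring_props[OF E] 
    by (intro subalgebra.intro) (auto simp: subalgebra_axioms_def subringE subfieldE intro: subring.axioms)
  then have fin1: "finite_dimension K E"
    using subalbegra_incl_imp_finite_dimension[OF subfield_K finite_dimensionI[OF dim_p]] sE(3) by blast
  obtain Vs where Vs: "set Vs \<subseteq> carrier F" "Span K Vs = carrier F"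
    using exists_base[OF subfield_K dim_p] by blast
  have "Span K Vs \<subseteq> Span E Vs"
    using Span_eq_combine_set[OF subfield_K Vs(1)] Span_eq_combine_set[OF E Vs(1)] \<open>K \<subseteq> E\<close> by blast
  then have "Span E Vs = carrier F"
    using Vs Span_in_carrier[OF sE(3) Vs(1)] by auto
  then have fin2: "finite_dimension E (carrier F)"
    using Span_finite_dimension[OF E Vs(1)] by simp
  \<comment> \<open>A one-dimensional space that contains the scalars is spanned by 1. Taking B once
    as the larger field and once as A itself identifies the two.\<close>
  have one: "Span A [\<one>] = B" if "subfield A F" "dimension 1 A B" "A \<subseteq> B" for A B
  proof -
    have "independent A [\<one>]"
      by (rule trivial_combine_imp_independent[OF that(1)])
        (use subfieldE(3)[OF that(1)] in \<open>auto split: list.splits simp: neq_Nil_conv subset_iff elim!: combine.elims\<close>)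
    then show ?thesis
      using independent_length_eq_dimension[OF that(1,2), of "[\<one>]"] that(1,3) subringE(3)[OF subfieldE(1)] by force
  qed
  have "p = (dim over K) E * (dim over E) (carrier F)"
    using telescopic_base_dim(2)[OF subfield_K E fin1 fin2] dimI[OF subfield_K dim_p] by simp
  then consider "(dim over K) E = 1" | "(dim over E) (carrier F) = 1"
    using prime_p by (metis nat_dvd_1_iff_1 prime_nat_iff dvd_triv_left mult_eq_self_implies_10 nat_mult_eq_1_iff mult.right_neutral mult_cancel_left not_prime_0)
  then show ?thesis
  proof cases
    case 1
    then have "dimension 1 K E"
      using finite_dimensionE[OF subfield_K fin1] by simp
    then show ?thesis
      using one[OF subfield_K _ \<open>K \<subseteq> E\<close>] one[OF subfield_K dimension_one[OF subfield_K]] by simp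
  next
    case 2
    then have "dimension 1 E (carrier F)"
      using finite_dimensionE[OF E fin2] by simp
    then show ?thesis
      using one[OF E _ sE(3)] one[OF E dimension_one[OF E]] by simp
  qed
qed

lemma generate_field_eq_carrier:
  assumes "x \<in> carrier F" "x \<notin> K"
  shows "generate_field F (K \<union> {x}) = carrier F"
proof -
  have sub: "K \<union> {x} \<subseteq> carrier F"
    using K_subset assms by auto
  have "subfield (generate_field F (K \<union> {x})) F"
    by (rule generate_field_is_subfield[OF sub])
  then show ?thesis
    using intermediate_field[of "generate_field F (K \<union> {x})"] assms(2) generate_field.incl[of _ "K \<union> {x}" F] by blast
qed

lemma K_neq_carrier: "K \<noteq> carrier F"
  using dimension_is_inj[OF subfield_K dim_p] dimension_one[OF subfield_K] p_ge_2 by fastforce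

lemma simple_extension_eq_carrier:
  assumes x: "x \<in> carrier F" "x \<notin> K"
  shows "simple_extension K x = carrier F"
  using intermediate_field simple_extension_is_subfield[OF subfield_K x(1)] algebraic_over_K[OF x(1)] 
    simple_extension_incl[OF K_subset x(1)] simple_extension_mem[OF subfieldE(1)[OF subfield_K] x(1)] x(2) by blast

lemma degree_Irr:
  assumes x: "x \<in> carrier F" "x \<notin> K"
  shows "degree (Irr K x) = p"
  using dimension_is_inj[OF subfield_K dim_p] dimension_simple_extension[OF subfield_K x(1) algebraic_over_K[OF x(1)]]
    simple_extension_eq_carrier[OF x] by simp

text \<open>A prime degree forces K(x) = F, so the minimal polynomial of x has degree p and 1, ...,
  x^(p-1) are independent; \<open>ex_psum\<close> is the spanning half.\<close>

lemma psum_eq_zeroD: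
  assumes x: "x \<in> carrier F" "x \<notin> K" and a: "\<And>i. a i \<in> K" and "psum F p a x = \<zero>" and "i < p"
  shows "a i = \<zero>"
proof -
  have "independent K (exp_base x p)"
    using exp_base_independent[OF subfield_K x(1) algebraic_over_K[OF x(1)]] degree_Irr[OF x] by simp
  moreover have "combine (map a (rev [0..<p])) (exp_base x p) = \<zero>"
    using combine_exp_base_eq_psum[of a x p] a K_subset x(1) assms(4) by auto
  ultimately have "set (take (length (exp_base x p)) (map a (rev [0..<p]))) \<subseteq> {\<zero>}"
    using a by (intro independent_imp_trivial_combine[OF subfield_K]) auto
  then show ?thesis
    using \<open>i < p\<close> by (force simp: exp_base_def)
qed

lemma ex_psum:
  assumes x: "x \<in> carrier F" "x \<notin> K" and b: "b \<in> carrier F"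
  obtains a where "\<And>i. a i \<in> K" "b = psum F p a x"
proof -
  have "b \<in> Span K (exp_base x p)"
    using Span_exp_base[OF subfield_K x(1) algebraic_over_K[OF x(1)]] degree_Irr[OF x] simple_extension_eq_carrier[OF x] b by simp
  then obtain Ks where Ks: "set Ks \<subseteq> K" "length Ks = p" "b = combine Ks (exp_base x p)"
    using Span_eq_combine_set_length_version[OF subfield_K exp_base_closed[OF x(1)]] by (auto simp: exp_base_def)
  \<comment> \<open>The list begins with the coefficient of x^(p-1), so the coefficient of x^i sits
    at position p - 1 - i.\<close>
  define a where "a = (\<lambda>i. if i < p then Ks ! (p - Suc i) else \<zero>)"
  have a: "a i \<in> K" for i
    using Ks subringE(2)[OF subfieldE(1)[OF subfield_K]] by (auto simp: a_def)
  have "Ks = map a (rev [0..<p])"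
    by (rule nth_equalityI) (auto simp: Ks a_def rev_nth)
  then show ?thesis
    using combine_exp_base_eq_psum[of a x p] a K_subset x(1) Ks(3) that[of a] by auto
qed

end

section \<open>The binomial theorem and p-th powers\<close>

context cring
begin

lemma binomial_psum:
  assumes [simp]: "b \<in> carrier R"
  shows "(\<one> \<oplus> b) [^] n = psum R (Suc n) (\<lambda>i. [(n choose i)] \<cdot> \<one>) b"
proof (induction n)
  case (Suc n)
  let ?c = "\<lambda>n i. [(n choose i)] \<cdot> \<one>"
  let ?P = "psum R (Suc n) (?c n) b"
  \<comment> \<open>Splitting off the constant term leaves coefficients with successor indices, to
    which Pascal's rule applies.\<close>
  have "psum R (Suc (Suc n)) (?c (Suc n)) b = \<one> \<oplus> b \<otimes> psum R (Suc n) (\<lambda>i. ?c n i \<oplus> ?c n (Suc i)) b"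
    by (subst psum_split_0) (simp_all add: add.nat_pow_mult del: psum_Suc)
  also have "\<dots> = b \<otimes> ?P \<oplus> (\<one> \<oplus> b \<otimes> psum R (Suc n) (\<lambda>i. ?c n (Suc i)) b)"
    by (subst psum_add) (simp_all add: r_distr a_ac del: psum_Suc)
  also have "\<one> \<oplus> b \<otimes> psum R (Suc n) (\<lambda>i. ?c n (Suc i)) b = psum R (Suc (Suc n)) (?c n) b"
    by (subst psum_split_0) (simp_all del: psum_Suc)
  also have "\<dots> = ?P"
    by (subst psum_Suc) (simp_all add: binomial_eq_0 del: psum_Suc)
  also have "b \<otimes> ?P \<oplus> ?P = (\<one> \<oplus> b) [^] Suc n"
    using Suc by (simp add: l_distr r_distr m_comm a_comm del: psum_Suc)
  finally show ?case ..
qed simp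

text \<open>The linear term is split off because it decides the value of \<open>p\<close>: if \<open>1 + b\<close> is a \<open>p\<close>-th root of
  unity, the identity reads \<open>b\<^bsup>p-1\<^esup> = - p (1 + b h)\<close>.\<close>

lemma one_plus_pow_prime:
  assumes [simp]: "b \<in> carrier R" and p: "Factorial_Ring.prime (p::nat)"
  obtains h where "h \<in> carrier R"
    "(\<one> \<oplus> b) [^] p = \<one> \<oplus> [p] \<cdot> \<one> \<otimes> b \<oplus> b [^] p \<oplus> [p] \<cdot> \<one> \<otimes> (b \<otimes> b \<otimes> h)"
proof -
  let ?c = "\<lambda>i. [(p choose i)] \<cdot> \<one>"
  \<comment> \<open>The binomial coefficient divided by p. The shift by 2 comes from the factor b^2
    in front of \<open>h\<close>, so the relevant indices i + 2 lie strictly below p.\<close>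
  define q where "q i = (if p dvd (p choose Suc (Suc i)) then [((p choose Suc (Suc i)) div p)] \<cdot> \<one> else \<zero>)" for i
  obtain m where m: "p = Suc (Suc m)"
    using prime_ge_2_nat[OF p] by (metis add_2_eq_Suc le_Suc_ex)
  have q [simp]: "q i \<in> carrier R" for i
    by (simp add: q_def)
  have dv: "p dvd (p choose i)" if "0 < i" "i < p" for i
  proof -
    have "i * (p choose i) = p * ((p - 1) choose (i - 1))"
      using that by (metis Suc_diff_1 times_binomial_minus1_eq)
    then have "p dvd i * (p choose i)"
      by simp
    then show ?thesis
      using that p by (auto simp: prime_dvd_mult_iff dest: dvd_imp_le)
  qed
  have c: "?c (Suc (Suc i)) = [p] \<cdot> \<one> \<otimes> q i" if "i < m" for i
  proof -
    have "p dvd (p choose Suc (Suc i))"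
      using dv[of "Suc (Suc i)"] that m by simp
    then show ?thesis
      by (auto simp: q_def add.nat_pow_pow add_pow_ldistr elim!: dvdE)
  qed
  have "(\<one> \<oplus> b) [^] p = psum R p ?c b \<oplus> b [^] p"
    by (simp add: binomial_psum)
  also have "psum R p ?c b = \<one> \<oplus> b \<otimes> ([p] \<cdot> \<one> \<oplus> b \<otimes> psum R m (\<lambda>i. ?c (Suc (Suc i))) b)"
    unfolding m by (subst psum_split_0, simp_all del: psum_Suc binomial_Suc_Suc, subst psum_split_0)
      (simp_all del: psum_Suc binomial_Suc_Suc)
  also have "psum R m (\<lambda>i. ?c (Suc (Suc i))) b = [p] \<cdot> \<one> \<otimes> psum R m q b"
    by (subst psum_smult[symmetric]) (auto intro!: psum_cong c)
  finally have "(\<one> \<oplus> b) [^] p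
    = \<one> \<oplus> b \<otimes> ([p] \<cdot> \<one> \<oplus> b \<otimes> ([p] \<cdot> \<one> \<otimes> psum R m q b)) \<oplus> b [^] p" .
  also have "\<dots> = \<one> \<oplus> [p] \<cdot> \<one> \<otimes> b \<oplus> b [^] p \<oplus> [p] \<cdot> \<one> \<otimes> (b \<otimes> b \<otimes> psum R m q b)"
  proof -
    have "\<one> \<oplus> b \<otimes> (k \<oplus> b \<otimes> (k \<otimes> h)) \<oplus> c = \<one> \<oplus> k \<otimes> b \<oplus> c \<oplus> k \<otimes> (b \<otimes> b \<otimes> h)"
      if "k \<in> carrier R" "h \<in> carrier R" "c \<in> carrier R" for k h c
      using that assms(1) by algebra
    then show ?thesis by simp
  qed
  finally show ?thesis
    using that[of "psum R m q b"] by simp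
qed

end

lemma (in ring_hom_cring) hom_add_pow:
  fixes n :: nat
  shows "x \<in> carrier R \<Longrightarrow> h (add_pow R n x) = add_pow S n (h x)"
  by (induction n) auto

lemma (in ring_hom_cring) hom_psum:
  assumes "\<And>i. a i \<in> carrier R" "x \<in> carrier R"
  shows "h (psum R n a x) = psum S n (\<lambda>i. h (a i)) (h x)"
  using assms by (induction n) auto

section \<open>Valuations and residue fields\<close>

context valued_field
begin

abbreviation (input) "\<O> \<equiv> val_ring L v (carrier L)"
abbreviation (input) "\<M> \<equiv> val_ideal L v"
abbreviation (input) "\<P> a \<equiv> PIdl\<^bsub>val_Ring L v\<^esub> a"

lemma v_one [simp]: "v \<one> = 0"
  using val_mult[of \<one> \<one>] by simp

lemma v_minus_one: "v (\<ominus> \<one>) = 0"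
proof -
  have "v (\<ominus> \<one>) + v (\<ominus> \<one>) = 0"
    using val_mult[of "\<ominus> \<one>" "\<ominus> \<one>"] by (simp add: l_minus r_minus)
  then show ?thesis
    by simp
qed

lemma v_uminus [simp]: "x \<in> carrier L \<Longrightarrow> x \<noteq> \<zero> \<Longrightarrow> v (\<ominus> x) = v x"
  using val_mult[of "\<ominus> \<one>" x] v_minus_one by (simp add: l_minus)

lemma v_mult: "x \<in> carrier L \<Longrightarrow> y \<in> carrier L \<Longrightarrow> x \<noteq> \<zero> \<Longrightarrow> y \<noteq> \<zero> \<Longrightarrow> v (x \<otimes> y) = v x + v y"
  using val_mult by simp

lemma inv_props [simp]:
  assumes "x \<in> carrier L" "x \<noteq> \<zero>"
  shows "inv x \<in> carrier L" "inv x \<noteq> \<zero>" "x \<otimes> inv x = \<one>" "inv x \<otimes> x = \<one>"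
  using assms field_Units by auto

lemma v_inv: "x \<in> carrier L \<Longrightarrow> x \<noteq> \<zero> \<Longrightarrow> v (inv x) = - v x"
  using v_mult[of x "inv x"] by (simp add: add_eq_0_iff)

lemma O_mem: "x \<in> \<O> \<longleftrightarrow> x \<in> carrier L \<and> (x = \<zero> \<or> 0 \<le> v x)"
  by (auto simp: val_ring_def)

lemma M_mem: "x \<in> \<M> \<longleftrightarrow> x \<in> carrier L \<and> (x = \<zero> \<or> 0 < v x)"
  by (auto simp: val_ideal_def)

lemma O_closed: "x \<in> \<O> \<Longrightarrow> x \<in> carrier L"
  by (simp add: O_mem)

lemma M_subset_O: "x \<in> \<M> \<Longrightarrow> x \<in> \<O>"
  by (auto simp: O_mem M_mem)

lemma O_zero [simp]: "\<zero> \<in> \<O>" and O_one [simp]: "\<one> \<in> \<O>" and M_zero [simp]: "\<zero> \<in> \<M>"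
  and one_not_M [simp]: "\<one> \<notin> \<M>"
  by (auto simp: O_mem M_mem)

lemma O_mult [simp]: "x \<in> \<O> \<Longrightarrow> y \<in> \<O> \<Longrightarrow> x \<otimes> y \<in> \<O>"
  by (cases "x = \<zero> \<or> y = \<zero>") (auto simp: O_mem v_mult)

lemma O_add [simp]: "x \<in> \<O> \<Longrightarrow> y \<in> \<O> \<Longrightarrow> x \<oplus> y \<in> \<O>"
  using val_add[of x y]
  by (cases "x = \<zero> \<or> y = \<zero> \<or> x \<oplus> y = \<zero>") (auto simp: O_mem min_def split: if_splits)

lemma O_uminus [simp]: "x \<in> \<O> \<Longrightarrow> \<ominus> x \<in> \<O>"
  by (cases "x = \<zero>") (auto simp: O_mem)

lemma O_minus [simp]: "x \<in> \<O> \<Longrightarrow> y \<in> \<O> \<Longrightarrow> x \<ominus> y \<in> \<O>"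
  by (simp add: minus_eq)

lemma O_pow [simp]: "x \<in> \<O> \<Longrightarrow> x [^] (n::nat) \<in> \<O>"
  by (induction n) auto

lemma O_add_pow [simp]:
  fixes n :: nat
  shows "x \<in> \<O> \<Longrightarrow> [n] \<cdot> x \<in> \<O>"
  by (induction n) auto

lemma M_mult [simp]: "x \<in> \<O> \<Longrightarrow> y \<in> \<M> \<Longrightarrow> x \<otimes> y \<in> \<M>"
  by (cases "x = \<zero> \<or> y = \<zero>") (auto simp: O_mem M_mem v_mult add_nonneg_pos)

lemma M_add [simp]: "x \<in> \<M> \<Longrightarrow> y \<in> \<M> \<Longrightarrow> x \<oplus> y \<in> \<M>"
  using val_add[of x y]
  by (cases "x = \<zero> \<or> y = \<zero> \<or> x \<oplus> y = \<zero>") (auto simp: M_mem min_def split: if_splits)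

lemma M_uminus [simp]: "x \<in> \<M> \<Longrightarrow> \<ominus> x \<in> \<M>"
  by (cases "x = \<zero>") (auto simp: M_mem)

lemma M_minus [simp]: "x \<in> \<M> \<Longrightarrow> y \<in> \<M> \<Longrightarrow> x \<ominus> y \<in> \<M>"
  by (simp add: minus_eq)

lemma unit_mem: "x \<in> \<O> \<Longrightarrow> x \<notin> \<M> \<longleftrightarrow> x \<noteq> \<zero> \<and> v x = 0"
  by (auto simp: O_mem M_mem)

lemma unit_inv: "x \<in> carrier L \<Longrightarrow> x \<noteq> \<zero> \<Longrightarrow> v x = 0 \<Longrightarrow> inv x \<in> \<O>"
  by (auto simp: O_mem v_inv)

lemma M_prime: "x \<in> \<O> \<Longrightarrow> y \<in> \<O> \<Longrightarrow> x \<otimes> y \<in> \<M> \<Longrightarrow> x \<in> \<M> \<or> y \<in> \<M>"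
  using unit_mem[of x] unit_mem[of y] unit_mem[of "x \<otimes> y"] v_mult[of x y] integral_iff[of x y]
  by (auto simp: O_closed)

lemma M_pow: "x \<in> \<O> \<Longrightarrow> x [^] (n::nat) \<in> \<M> \<Longrightarrow> x \<in> \<M>"
proof (induction n)
  case (Suc n)
  then show ?case
    using M_prime[of "x [^] n" x] by auto
qed simp

lemma v_pow_zero: "x \<in> carrier L \<Longrightarrow> x \<noteq> \<zero> \<Longrightarrow> v x = 0 \<Longrightarrow> v (x [^] (n::nat)) = 0"
  by (induction n) (auto simp: v_mult nat_pow_eq_0_iff)

lemma subring_O: "subring \<O> L"
  by (rule subringI) (auto simp: O_closed)

lemma cring_O: "cring (val_Ring L v)"
  using subring_is_domain[OF subring_O] by (simp add: domain_def)

lemma pow_val_Ring: "x [^]\<^bsub>val_Ring L v\<^esub> (n::nat) = x [^] n"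
  by (simp add: nat_pow_def)

lemma add_pow_val_Ring:
  fixes n :: nat
  shows "add_pow (val_Ring L v) n x = [n] \<cdot> x"
  by (simp add: add_pow_def nat_pow_def)

lemma uminus_O [simp]: "y \<in> \<O> \<Longrightarrow> \<ominus>\<^bsub>val_Ring L v\<^esub> y = \<ominus> y"
proof -
  assume y: "y \<in> \<O>"
  interpret O: cring "val_Ring L v" by (rule cring_O)
  show ?thesis
    by (rule O.minus_equality) (use y in \<open>auto simp: O_closed l_neg\<close>)
qed

lemma minus_O [simp]: "x \<in> \<O> \<Longrightarrow> y \<in> \<O> \<Longrightarrow> x \<ominus>\<^bsub>val_Ring L v\<^esub> y = x \<ominus> y"
  by (simp add: a_minus_def)

lemma ideal_M: "ideal \<M> (val_Ring L v)"
proof -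
  interpret O: cring "val_Ring L v" by (rule cring_O)
  have "\<M> \<noteq> {}"
    using M_zero by blast
  then have "subgroup \<M> (add_monoid (val_Ring L v))"
    by (intro O.add.subgroupI) (auto simp: M_subset_O)
  moreover have "y \<otimes> x \<in> \<M>" if "x \<in> \<O>" "y \<in> \<M>" for x y
    using M_mult[OF that] m_comm[of x y] that by (simp add: O_closed M_subset_O)
  ultimately show ?thesis
    by (intro idealI O.ring_axioms) auto
qed

lemma residue_hom: "ring_hom_cring (val_Ring L v) (residue_field L v) (residue L v)"
proof -
  interpret O: cring "val_Ring L v" by (rule cring_O)
  interpret M: ideal \<M> "val_Ring L v" by (rule ideal_M)
  have "residue L v = (+>\<^bsub>val_Ring L v\<^esub>) \<M>"
    by (simp add: residue_def fun_eq_iff)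
  then show ?thesis
    using M.rcos_ring_hom_cring[OF cring_O] by (simp add: residue_field_def)
qed

lemma residue_field_carrier: "carrier (residue_field L v) = residue L v ` \<O>"
  by (auto simp: residue_field_def FactRing_def A_RCOSETS_def' residue_def)

lemma residue_eq_iff:
  assumes "x \<in> \<O>" "y \<in> \<O>"
  shows "residue L v x = residue L v y \<longleftrightarrow> x \<ominus> y \<in> \<M>"
proof -
  interpret O: cring "val_Ring L v" by (rule cring_O)
  interpret M: ideal \<M> "val_Ring L v" by (rule ideal_M)
  show ?thesis
    using O.quotient_eq_iff_same_a_r_cos[OF ideal_M, of x y] assms by (simp add: residue_def)
qed

lemma residue_field_zero: "\<zero>\<^bsub>residue_field L v\<^esub> = residue L v \<zero>"
  and residue_field_one: "\<one>\<^bsub>residue_field L v\<^esub> = residue L v \<one>"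
proof -
  interpret h: ring_hom_cring "val_Ring L v" "residue_field L v" "residue L v" by (rule residue_hom)
  show "\<zero>\<^bsub>residue_field L v\<^esub> = residue L v \<zero>" "\<one>\<^bsub>residue_field L v\<^esub> = residue L v \<one>"
    using h.hom_zero h.hom_one by simp_all
qed

lemma residue_eq_zero_iff: "x \<in> \<O> \<Longrightarrow> residue L v x = \<zero>\<^bsub>residue_field L v\<^esub> \<longleftrightarrow> x \<in> \<M>"
  using residue_eq_iff[of x \<zero>] by (simp add: residue_field_zero minus_eq O_closed)

lemma residue_field_is_field: "field (residue_field L v)"
proof -
  interpret h: ring_hom_cring "val_Ring L v" "residue_field L v" "residue L v" by (rule residue_hom)
  show ?thesis
  proof (rule h.S.cring_fieldI2)
    show "\<zero>\<^bsub>residue_field L v\<^esub> \<noteq> \<one>\<^bsub>residue_field L v\<^esub>"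
      using residue_eq_zero_iff[of \<one>] by (simp add: residue_field_one)
  next
    fix a assume "a \<in> carrier (residue_field L v)" and nz: "a \<noteq> \<zero>\<^bsub>residue_field L v\<^esub>"
    then obtain x where x: "x \<in> \<O>" "a = residue L v x"
      by (auto simp: residue_field_carrier)
    then have u: "x \<noteq> \<zero>" "v x = 0" "x \<in> carrier L"
      using nz residue_eq_zero_iff unit_mem by (auto simp: O_closed)
    then have "inv x \<in> \<O>"
      by (simp add: unit_inv)
    moreover have "a \<otimes>\<^bsub>residue_field L v\<^esub> residue L v (inv x) = \<one>\<^bsub>residue_field L v\<^esub>"
      using h.hom_mult[of x "inv x"] x u \<open>inv x \<in> \<O>\<close> by (simp add: residue_field_one)
    ultimately show "\<exists>b\<in>carrier (residue_field L v). a \<otimes>\<^bsub>residue_field L v\<^esub> b = \<one>\<^bsub>residue_field L v\<^esub>"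
      by (auto simp: residue_field_carrier)
  qed
qed

lemma subfield_residue_subfield:
  assumes K: "subfield K L"
  shows "subfield (residue_subfield L v K) (residue_field L v)"
proof -
  interpret h: ring_hom_cring "val_Ring L v" "residue_field L v" "residue L v" by (rule residue_hom)
  interpret k: field "residue_field L v" by (rule residue_field_is_field)
  note KE = subringE[OF subfieldE(1)[OF K]]
  let ?K = "val_ring L v K"
  have sub: "x \<in> ?K \<longleftrightarrow> x \<in> K \<and> x \<in> \<O>" for x
    using KE(1) by (auto simp: val_ring_def)
  show ?thesis
  proof (rule k.subfieldI'[OF h.S.subringI])
    show "residue_subfield L v K \<subseteq> carrier (residue_field L v)"
      using sub by (auto simp: residue_subfield_def residue_field_carrier)
    show "\<one>\<^bsub>residue_field L v\<^esub> \<in> residue_subfield L v K"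
      using sub KE by (auto simp: residue_subfield_def residue_field_one)
    fix a b assume "a \<in> residue_subfield L v K" "b \<in> residue_subfield L v K"
    then obtain x y where xy: "x \<in> ?K" "y \<in> ?K" "a = residue L v x" "b = residue L v y"
      by (auto simp: residue_subfield_def)
    have "\<ominus> x \<in> ?K" "x \<otimes> y \<in> ?K" "x \<oplus> y \<in> ?K"
      using xy sub KE by auto
    moreover have "\<ominus>\<^bsub>residue_field L v\<^esub> a = residue L v (\<ominus> x)" 
      "a \<otimes>\<^bsub>residue_field L v\<^esub> b = residue L v (x \<otimes> y)" "a \<oplus>\<^bsub>residue_field L v\<^esub> b = residue L v (x \<oplus> y)"
      using h.hom_a_inv[of x] h.hom_mult[of x y] h.hom_add[of x y] xy sub by auto
    ultimately show "\<ominus>\<^bsub>residue_field L v\<^esub> a \<in> residue_subfield L v K"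
      "a \<otimes>\<^bsub>residue_field L v\<^esub> b \<in> residue_subfield L v K" "a \<oplus>\<^bsub>residue_field L v\<^esub> b \<in> residue_subfield L v K"
      by (auto simp: residue_subfield_def)
  next
    fix a assume "a \<in> residue_subfield L v K - {\<zero>\<^bsub>residue_field L v\<^esub>}"
    then obtain x where x: "x \<in> K" "x \<in> \<O>" "a = residue L v x" "x \<notin> \<M>"
      using sub residue_eq_zero_iff by (auto simp: residue_subfield_def)
    then have u: "x \<noteq> \<zero>" "v x = 0" "x \<in> carrier L" "inv x \<in> \<O>" "inv x \<in> K"
      using unit_mem subfield_m_inv(1)[OF K, of x] by (auto simp: O_closed unit_inv)
    moreover have "inv\<^bsub>residue_field L v\<^esub> a = residue L v (inv x)"
    proof (rule h.S.comm_inv_char)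
      show "a \<otimes>\<^bsub>residue_field L v\<^esub> residue L v (inv x) = \<one>\<^bsub>residue_field L v\<^esub>"
        using h.hom_mult[of x "inv x"] x u by (simp add: residue_field_one)
    qed (use x u in \<open>auto simp: residue_field_carrier\<close>)
    ultimately show "inv\<^bsub>residue_field L v\<^esub> a \<in> residue_subfield L v K"
      using sub by (auto simp: residue_subfield_def)
  qed
qed

end

text \<open>If v y < 0, then z = 1/y lies in \<open>\<M>\<close>, and multiplying the equation by
  z^n writes 1 as a sum of terms a_i z^(n-i) in \<open>\<M>\<close>.\<close>

lemma (in valued_field) integrally_closed:
  assumes y: "y \<in> carrier L" and a: "\<And>i. a i \<in> \<O>" and eq: "y [^] n = psum L n a y"
  shows "y \<in> \<O>"
proof (rule ccontr)
  assume "y \<notin> \<O>"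
  then have y0: "y \<noteq> \<zero>" and "v y < 0"
    using y by (auto simp: O_mem)
  define z where "z = inv y"
  have z: "z \<in> carrier L" "y \<otimes> z = \<one>" "z \<in> \<M>"
    using y y0 \<open>v y < 0\<close> by (auto simp: z_def M_mem v_inv)
  have pow: "y [^] i \<otimes> z [^] i = \<one>" for i :: nat
    using nat_pow_distrib[OF y z(1), of i] z(2) by simp
  have zM: "z [^] Suc i \<in> \<M>" for i :: nat
    using z M_subset_O[OF z(3)] by (induction i) auto
  have "psum L n a y \<in> {t \<in> carrier L. t \<otimes> z [^] n \<in> \<M>}"
  proof (rule psum_in)
    fix i assume "i < n"
    then obtain k where k: "n = i + Suc k"
      using less_iff_Suc_add by auto
    have "a i \<otimes> y [^] i \<otimes> z [^] n = a i \<otimes> (y [^] i \<otimes> z [^] i) \<otimes> z [^] Suc k"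
      unfolding k nat_pow_mult[OF z(1), symmetric] using a[of i] y z(1) by (simp add: m_assoc O_closed)
    then have "a i \<otimes> y [^] i \<otimes> z [^] n \<in> \<M>"
      using a[of i] zM[of k] unfolding pow by (simp add: O_closed)
    then show "a i \<otimes> y [^] i \<in> {t \<in> carrier L. t \<otimes> z [^] n \<in> \<M>}"
      using a[of i] y by (simp add: O_closed)
  qed (use a y z in \<open>auto simp: O_closed l_distr\<close>)
  then show False
    using pow[of n] eq by simp
qed

section \<open>Extensions of prime degree with the same residue degree\<close>

locale residually_inert_extension = valued_field L v + prime_degree_extension L K p
  for L :: "('a, 'm) ring_scheme" (structure) and v :: "'a \<Rightarrow> 'g :: linordered_ab_group_add" and K p +
  assumes dim_residue:
    "ring.dimension (residue_field L v) p (residue_subfield L v K) (carrier (residue_field L v))"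
begin

text \<open>Since [Lv:Kv] is prime, a residue outside Kv generates Lv. By
  \<open>unit_generator_iff\<close> this one condition carries all clauses of
  \<open>unit_generator\<close>.\<close>

definition resgen :: "'a \<Rightarrow> bool" where
  "resgen x \<longleftrightarrow> x \<in> \<O> \<and> residue L v x \<notin> residue_subfield L v K"

lemma residue_extension: "prime_degree_extension (residue_field L v) (residue_subfield L v K) p"
  by (intro prime_degree_extension.intro residue_field_is_field prime_degree_extension_axioms.intro
      subfield_residue_subfield subfield_K dim_residue prime_p)

lemmas K_ring = subringE[OF subfieldE(1)[OF subfield_K]]

lemma K_closed: "x \<in> K \<Longrightarrow> x \<in> carrier L"
  using K_subset by blast

lemma K_inv: "x \<in> K \<Longrightarrow> x \<noteq> \<zero> \<Longrightarrow> inv x \<in> K"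
  using subfield_m_inv(1)[OF subfield_K] by auto

lemma val_ring_K: "x \<in> val_ring L v K \<longleftrightarrow> x \<in> K \<and> x \<in> \<O>"
  using K_closed by (auto simp: val_ring_def)

lemma ex_resgen: obtains y where "resgen y"
proof -
  interpret k: prime_degree_extension "residue_field L v" "residue_subfield L v K" p
    by (rule residue_extension)
  obtain y where "y \<in> \<O>" "residue L v y \<notin> residue_subfield L v K"
    using k.K_neq_carrier k.K_subset by (auto simp: residue_field_carrier)
  then show ?thesis
    using that by (auto simp: resgen_def)
qed

lemma resgen_O: "resgen x \<Longrightarrow> x \<in> \<O>" and resgen_closed: "resgen x \<Longrightarrow> x \<in> carrier L"
  by (auto simp: resgen_def O_closed)

lemma resgen_iff: "resgen x \<longleftrightarrow> x \<in> \<O> \<and> (\<forall>a\<in>K. a \<in> \<O> \<longrightarrow> x \<ominus> a \<notin> \<M>)"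
  unfolding resgen_def residue_subfield_def image_iff using residue_eq_iff[of x] val_ring_K by blast

lemma resgen_notin_K: "resgen x \<Longrightarrow> x \<notin> K"
  by (auto simp: resgen_def residue_subfield_def val_ring_K)

lemma resgen_unit: "resgen x \<Longrightarrow> x \<notin> \<M>" 
  using resgen_iff[of x] K_ring(2) by (force simp: minus_eq O_closed)

text \<open>Linear independence over Kv of the powers of the residue of x, pulled back to
  \<open>\<O>\<close>.\<close>

lemma resgen_psum_in_M:
  assumes x: "resgen x" and a: "\<And>i. a i \<in> K" "\<And>i. a i \<in> \<O>" and "psum L p a x \<in> \<M>" and "i < p"
  shows "a i \<in> \<M>"
proof -
  interpret k: prime_degree_extension "residue_field L v" "residue_subfield L v K" p
    by (rule residue_extension)
  interpret h: ring_hom_cring "val_Ring L v" "residue_field L v" "residue L v" by (rule residue_hom)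
  note xO = resgen_O[OF x]
  have ps: "psum (val_Ring L v) n a x = psum L n a x" for n
    by (induction n) (use a xO in \<open>auto simp: O_closed nat_pow_consistent[symmetric]\<close>)
  have "psum (residue_field L v) p (\<lambda>i. residue L v (a i)) (residue L v x) = residue L v (psum L p a x)"
    using h.hom_psum[of a x p] a xO by (simp add: ps)
  also have "\<dots> = \<zero>\<^bsub>residue_field L v\<^esub>"
    using assms(4) M_subset_O residue_eq_zero_iff by blast
  finally have "residue L v (a i) = \<zero>\<^bsub>residue_field L v\<^esub>"
    using x a \<open>i < p\<close> by (intro k.psum_eq_zeroD[where x = "residue L v x" and a = "\<lambda>i. residue L v (a i)"])
      (auto simp: resgen_def residue_field_carrier residue_subfield_def val_ring_K)
  then show ?thesis
    using a residue_eq_zero_iff by blast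
qed

text \<open>Dividing by a coefficient of least value makes all coefficients integral and one of them
  1. By independence of the residues the scaled sum is a unit, so the original sum has that least
  value.\<close>

lemma v_psum:
  assumes x: "resgen x" and a: "\<And>i. a i \<in> K" and "i < p" "a i \<noteq> \<zero>"
  obtains j where "j < p" "a j \<noteq> \<zero>" "\<And>i. i < p \<Longrightarrow> a i \<noteq> \<zero> \<Longrightarrow> v (a j) \<le> v (a i)"
    "psum L p a x \<noteq> \<zero>" "v (psum L p a x) = v (a j)"
proof -
  note xO = resgen_O[OF x] and xL = resgen_closed[OF x]
  let ?S = "{i. i < p \<and> a i \<noteq> \<zero>}"
  have "finite ?S" "?S \<noteq> {}"
    using assms by auto
  note arg_min = arg_min_if_finite(1)[OF this, of "\<lambda>i. v (a i)"] arg_min_least[OF this, of _ "\<lambda>i. v (a i)"]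
  define j where "j = arg_min_on (\<lambda>i. v (a i)) ?S"
  have j: "j \<in> ?S" "\<And>i. i \<in> ?S \<Longrightarrow> v (a j) \<le> v (a i)"
    using arg_min unfolding j_def by blast+
  have aL: "a i \<in> carrier L" for i
    using a K_closed by blast
  define c where "c = inv (a j)"
  have c: "c \<in> K" "c \<in> carrier L" "c \<noteq> \<zero>" "c \<otimes> a j = \<one>" "v c = - v (a j)"
    using j a[of j] aL[of j] by (auto simp: c_def K_inv v_inv)
  define b where "b i = (if i < p then c \<otimes> a i else \<zero>)" for i
  have bK: "b i \<in> K" for i
    using c a K_ring by (auto simp: b_def)
  have bO: "b i \<in> \<O>" for i
    using c aL[of i] j(2)[of i] by (cases "i < p \<and> a i \<noteq> \<zero>") (auto simp: b_def O_mem v_mult)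
  have "psum L p b x = psum L p (\<lambda>i. c \<otimes> a i) x"
    using bK c aL xL K_closed by (intro psum_cong) (auto simp: b_def)
  then have ps: "psum L p b x = c \<otimes> psum L p a x"
    using psum_smult[of a c x p] aL c xL by simp
  have "psum L p b x \<notin> \<M>"
    using resgen_psum_in_M[where a = b and i = j, OF x bK bO] j c(4) by (auto simp: b_def)
  moreover have "psum L p b x \<in> \<O>"
    using bO xO by (intro psum_in) (auto simp: O_closed)
  ultimately have u: "psum L p b x \<noteq> \<zero>" "v (psum L p b x) = 0"
    using unit_mem by auto
  have "psum L p a x \<noteq> \<zero>"
    using u c unfolding ps by auto
  moreover from this have "v (psum L p a x) = v (a j)"
    using u(2) c aL xL unfolding ps by (simp add: v_mult)
  ultimately show ?thesis
    using that[of j] j by auto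
qed

lemma coord_in_O:
  assumes x: "resgen x" and a: "\<And>i. a i \<in> K" and "psum L p a x \<in> \<O>" "i < p"
  shows "a i \<in> \<O>"
proof (cases "a i = \<zero>")
  case False
  then show ?thesis
    using v_psum[where a = a, OF x a assms(4) False] assms(3,4) a[of i] by (metis K_closed O_mem order_trans)
qed simp

text \<open>This is vL = vK: in the power basis of a residual generator, the value of a sum is the
  value of one of its coefficients.\<close>

lemma ex_same_value:
  assumes "b \<in> carrier L" "b \<noteq> \<zero>"
  obtains c where "c \<in> K" "c \<noteq> \<zero>" "v c = v b"
proof -
  obtain y where y: "resgen y"
    by (rule ex_resgen)
  obtain a where a: "\<And>i. a i \<in> K" "b = psum L p a y"
    using ex_psum[OF resgen_closed[OF y] resgen_notin_K[OF y] assms(1)] by metis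
  have "\<exists>i<p. a i \<noteq> \<zero>"
  proof (rule ccontr)
    assume "\<not> ?thesis"
    then have "psum L p a y = psum L p (\<lambda>i. \<zero>) y"
      using a(1) K_closed y by (intro psum_cong) (auto simp: resgen_closed)
    also have "\<dots> = \<zero>"
      using psum_single[of \<zero> y p 0] y by (simp add: resgen_closed)
    finally show False
      using assms a by simp
  qed
  then show ?thesis
    using v_psum[where a = a, OF y a(1)] a that by metis
qed

lemma ex_O_psum:
  assumes x: "resgen x" and b: "b \<in> \<O>"
  obtains a where "\<And>i. a i \<in> K" "\<And>i. a i \<in> \<O>" "b = psum L p a x"
proof -
  obtain a where a: "\<And>i. a i \<in> K" "b = psum L p a x"
    using ex_psum[OF resgen_closed[OF x] resgen_notin_K[OF x] O_closed[OF b]] by metis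
  \<comment> \<open>\<open>coord_in_O\<close> controls only the coefficients below p, while
    integrality is claimed for all \<open>i\<close>.\<close>
  define a' where "a' i = (if i < p then a i else \<zero>)" for i
  have "a' i \<in> K" for i
    using a K_ring by (auto simp: a'_def)
  moreover have "a' i \<in> \<O>" for i
    using coord_in_O[where a = a, OF x a(1)] a(2) b by (auto simp: a'_def)
  moreover have "psum L p a' x = psum L p a x"
    by (rule psum_cong) (use a K_closed calculation resgen_closed[OF x] in \<open>auto simp: a'_def\<close>)
  ultimately show ?thesis
    using that[of a'] a by simp
qed

lemma resgen_generate_ring:
  assumes x: "resgen x"
  shows "generate_ring L (val_ring L v K \<union> {x}) = \<O>"
proof
  have "val_ring L v K \<union> {x} \<subseteq> \<O>" 
    using x val_ring_K by (auto simp: resgen_O)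
  moreover from this have "val_ring L v K \<union> {x} \<subseteq> carrier L"
    using O_closed by blast
  ultimately show "generate_ring L (val_ring L v K \<union> {x}) \<subseteq> \<O>"
    using generate_ring_min_subring1[OF _ subring_O] by blast
next
  have sub: "subring (generate_ring L (val_ring L v K \<union> {x})) L" (is "subring ?G L")
    by (rule generate_ring_is_subring) (use x K_closed in \<open>auto simp: val_ring_K resgen_closed\<close>)
  note G = subringE[OF sub]
  have xG: "x \<in> ?G" and KG: "val_ring L v K \<subseteq> ?G"
    by (auto intro: generate_ring.incl)
  have pow: "x [^] i \<in> ?G" for i :: nat
    using xG G by (induction i) auto
  show "\<O> \<subseteq> ?G"
  proof
    fix b assume "b \<in> \<O>"
    then obtain a where a: "\<And>i. a i \<in> K" "\<And>i. a i \<in> \<O>" "b = psum L p a x"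
      using ex_O_psum[OF x] by metis
    have "a i \<in> ?G" for i
      using a KG val_ring_K by blast
    then have "psum L p a x \<in> ?G"
      by (intro psum_in G(6)[OF _ pow] G(2) G(7)) (use a K_closed resgen_closed[OF x] in auto)
    then show "b \<in> ?G"
      using a by simp
  qed
qed

text \<open>If the residue of x lay in Kv, the field that it generates over Kv would be Kv, which is
  smaller than Lv.\<close>

lemma unit_generator_iff: "unit_generator L K v x \<longleftrightarrow> resgen x"
proof -
  interpret k: prime_degree_extension "residue_field L v" "residue_subfield L v K" p
    by (rule residue_extension)
  show ?thesis
  proof
    assume x: "resgen x"
    then have "x \<in> carrier L" "x \<noteq> \<zero>" "v x = 0"
      using unit_mem resgen_unit resgen_O resgen_closed by auto
    moreover have "generate_field (residue_field L v) (residue_subfield L v K \<union> {residue L v x}) = carrier (residue_field L v)"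
      using x by (intro k.generate_field_eq_carrier) (auto simp: resgen_def residue_field_carrier)
    ultimately show "unit_generator L K v x"
      using resgen_generate_ring[OF x] by (simp add: unit_generator_def)
  next
    assume x: "unit_generator L K v x"
    then have xO: "x \<in> \<O>"
      by (auto simp: unit_generator_def O_mem)
    show "resgen x"
    proof (rule ccontr)
      assume "\<not> resgen x"
      then have "residue_subfield L v K \<union> {residue L v x} = residue_subfield L v K"
        using xO by (auto simp: resgen_def)
      then have "carrier (residue_field L v) \<subseteq> residue_subfield L v K"
        using x k.generate_field_min_subfield1[OF k.K_subset k.subfield_K] by (simp add: unit_generator_def)
      then show False
        using k.K_subset k.K_neq_carrier by auto
    qed
  qed
qed

end

section \<open>Kummer theory\<close>

text \<open>A nonzero polynomial with n coefficients has degree below n. The library collects roots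
  in a multiset, whose size bounds the number of distinct roots.\<close>

lemma (in field) psum_roots:
  assumes a: "\<And>i. a i \<in> carrier R" and S: "S \<subseteq> carrier R" "finite S" "n \<le> card S"
    and zero: "\<And>x. x \<in> S \<Longrightarrow> psum R n a x = \<zero>" and "i < n"
  shows "a i = \<zero>"
proof -
  define Ks where "Ks = map a (rev [0..<n])"
  have Ks: "set Ks \<subseteq> carrier R" "length Ks = n"
    using a by (auto simp: Ks_def)
  have eval: "eval (normalize Ks) x = psum R n a x" if "x \<in> carrier R" for x
    using combine_eq_eval[of Ks x] eval_normalize[OF Ks(1) that] Ks combine_exp_base_eq_psum[of a x n] a that
    by (simp add: Ks_def)
  have card_le_size: "card (set_mset M) \<le> size M" for M :: "'a multiset"
    by (induction M) (auto simp: card_insert_if)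
  have "normalize Ks = []"
  proof (rule ccontr)
    assume ne: "normalize Ks \<noteq> []"
    have P: "normalize Ks \<in> carrier (poly_ring R)"
      using normalize_gives_polynomial[OF Ks(1)] by (simp add: univ_poly_carrier)
    have "S \<subseteq> set_mset (roots (normalize Ks))"
      using roots_mem_iff_is_root[OF P] ne S(1) zero eval by (auto simp: is_root_def)
    then have "card S \<le> size (roots (normalize Ks))"
      using card_mono[OF finite_set_mset] card_le_size le_trans by blast
    also have "\<dots> \<le> degree (normalize Ks)"
      by (rule size_roots_le_degree[OF P])
    also have "\<dots> < n"
      using normalize_length_le[of Ks] ne Ks(2) by (cases "normalize Ks") auto
    finally show False
      using S(3) by simp
  qed
  moreover have "set l \<subseteq> {\<zero>}" if "normalize l = []" for l
    using that by (induction l) (auto split: if_splits)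
  ultimately have "set Ks \<subseteq> {\<zero>}"
    by blast
  then show ?thesis
    using \<open>i < n\<close> by (force simp: Ks_def)
qed

text \<open>The coefficients of the product of the \<open>X - r\<close> for \<open>r\<close> in the list.\<close>

primrec root_coeffs :: "('a, 'm) ring_scheme \<Rightarrow> 'a list \<Rightarrow> nat \<Rightarrow> 'a" where
  "root_coeffs R [] i = (if i = 0 then \<one>\<^bsub>R\<^esub> else \<zero>\<^bsub>R\<^esub>)"
| "root_coeffs R (r # rs) i =
    (case i of 0 \<Rightarrow> \<zero>\<^bsub>R\<^esub> | Suc j \<Rightarrow> root_coeffs R rs j) \<ominus>\<^bsub>R\<^esub> r \<otimes>\<^bsub>R\<^esub> root_coeffs R rs i"

context cring
begin

lemma root_coeffs_closed [simp]: "set rs \<subseteq> carrier R \<Longrightarrow> root_coeffs R rs i \<in> carrier R"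
  by (induction rs arbitrary: i) (auto split: nat.split)

lemma root_coeffs_gt: "set rs \<subseteq> carrier R \<Longrightarrow> i > length rs \<Longrightarrow> root_coeffs R rs i = \<zero>"
  by (induction rs arbitrary: i) (auto split: nat.split simp: minus_eq)

lemma root_coeffs_length: "set rs \<subseteq> carrier R \<Longrightarrow> root_coeffs R rs (length rs) = \<one>"
  by (induction rs) (auto simp: root_coeffs_gt minus_eq)

lemma root_coeffs_swap:
  assumes "r \<in> carrier R" "s \<in> carrier R" "set rs \<subseteq> carrier R"
  shows "root_coeffs R (r # s # rs) i = root_coeffs R (s # r # rs) i"
proof -
  have "(a \<ominus> s \<otimes> b) \<ominus> r \<otimes> (b \<ominus> s \<otimes> c) = (a \<ominus> r \<otimes> b) \<ominus> s \<otimes> (b \<ominus> r \<otimes> c)"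
    if "a \<in> carrier R" "b \<in> carrier R" "c \<in> carrier R" for a b c
    using that assms(1,2) by algebra
  moreover have "(\<zero> \<ominus> s \<otimes> \<zero>) = \<zero>" if "s \<in> carrier R" for s
    using that by algebra
  ultimately show ?thesis
    using assms by (auto split: nat.split simp: m_lcomm minus_eq r_minus[symmetric] intro!: arg_cong2[where f = "(\<oplus>)"])
qed

text \<open>Of the symmetry in the roots, rotation suffices: an automorphism shifts an orbit
  cyclically.\<close>

lemma root_coeffs_rotate:
  assumes "r \<in> carrier R" "set rs \<subseteq> carrier R"
  shows "root_coeffs R (rs @ [r]) i = root_coeffs R (r # rs) i"
  using assms(2)
proof (induction rs arbitrary: i)
  case (Cons s rs)
  have "root_coeffs R (rs @ [r]) i = root_coeffs R (r # rs) i" for i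
    using Cons by simp
  then have "root_coeffs R (s # (rs @ [r])) i = root_coeffs R (s # r # rs) i"
    by (simp only: root_coeffs.simps(2)[of R s])
  then show ?case
    using Cons assms(1) root_coeffs_swap[of s r rs i] by simp
qed simp

text \<open>The polynomial is X q - r q, where q is the product over \<open>rs\<close>; at r both
  terms equal r q(r). Its degree is one more than the length of \<open>rs\<close>, its number of
  coefficients two more.\<close>

lemma psum_root_coeffs_hd:
  assumes "r \<in> carrier R" "set rs \<subseteq> carrier R"
  shows "psum R (Suc (Suc (length rs))) (root_coeffs R (r # rs)) r = \<zero>"
proof -
  let ?n = "length rs" and ?c = "root_coeffs R rs"
  let ?d = "\<lambda>i. case i of 0 \<Rightarrow> \<zero> | Suc j \<Rightarrow> ?c j"
  have c [simp]: "?c i \<in> carrier R" and d [simp]: "?d i \<in> carrier R" for i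
    using assms by (auto split: nat.split)
  have eq: "root_coeffs R (r # rs) = (\<lambda>i. ?d i \<ominus> r \<otimes> ?c i)"
    by (rule ext) simp
  have "psum R (Suc (Suc ?n)) (root_coeffs R (r # rs)) r
      = psum R (Suc (Suc ?n)) ?d r \<ominus> psum R (Suc (Suc ?n)) (\<lambda>i. r \<otimes> ?c i) r"
    using psum_minus[of ?d "\<lambda>i. r \<otimes> ?c i" r "Suc (Suc ?n)"] assms(1)
    unfolding eq by (simp del: psum_Suc)
  also have "psum R (Suc (Suc ?n)) (\<lambda>i. r \<otimes> ?c i) r = r \<otimes> psum R (Suc (Suc ?n)) ?c r"
    by (rule psum_smult) (use assms in auto)
  also have "psum R (Suc (Suc ?n)) ?c r = psum R (Suc ?n) ?c r"
    using psum_Suc[of ?c r "Suc ?n"] assms by (simp add: root_coeffs_gt del: psum_Suc)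
  also have "psum R (Suc (Suc ?n)) ?d r = r \<otimes> psum R (Suc ?n) ?c r"
    using assms by (subst psum_split_0) (simp_all del: psum_Suc)
  finally show ?thesis
    using assms by (simp add: r_right_minus_eq del: psum_Suc root_coeffs.simps)
qed

lemma psum_extend:
  assumes "\<And>i. a i \<in> carrier R" "x \<in> carrier R" "m \<le> n" "\<And>i. m \<le> i \<Longrightarrow> a i = \<zero>"
  shows "psum R n a x = psum R m a x"
  using assms(3) by (induction n rule: dec_induct) (use assms(1,2,4) in auto)

end

lemma (in ring_hom_cring) hom_root_coeffs:
  "set rs \<subseteq> carrier R \<Longrightarrow> h (root_coeffs R rs i) = root_coeffs S (map h rs) i"
  by (induction rs arbitrary: i) (auto split: nat.split simp: R.minus_eq S.minus_eq)

lemma Gal_hom: 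
  assumes "field L" "\<sigma> \<in> Gal L K"
  shows "ring_hom_cring L L \<sigma>"
proof -
  interpret field L by fact
  show ?thesis
    by (rule ring_hom_cringI) (use assms is_cring in \<open>auto simp: Gal_def ring_iso_def\<close>)
qed

lemma Gal_inj: "\<sigma> \<in> Gal L K \<Longrightarrow> inj_on \<sigma> (carrier L)"
  by (auto simp: Gal_def ring_iso_def bij_betw_def)

lemma Gal_fix: "\<sigma> \<in> Gal L K \<Longrightarrow> x \<in> K \<Longrightarrow> \<sigma> x = x"
  by (auto simp: Gal_def)

section \<open>Automorphisms over K and their orbits\<close>

context prime_degree_extension
begin

text \<open>The fixed field of \<sigma> contains K and misses \<open>z\<close>; no field lies
  strictly between K and F.\<close>

lemma fixed_by_Gal:
  assumes s: "\<sigma> \<in> Gal F K" and z: "z \<in> carrier F" "\<sigma> z \<noteq> z" and x: "x \<in> carrier F" "\<sigma> x = x"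
  shows "x \<in> K"
proof -
  interpret h: ring_hom_cring F F \<sigma>
    by (rule Gal_hom[OF field_axioms s])
  let ?E = "{x \<in> carrier F. \<sigma> x = x}"
  have "subfield ?E F"
  proof (intro subfieldI' subringI)
    fix k assume k: "k \<in> ?E - {\<zero>}"
    then have "inv k \<in> carrier F" "k \<otimes> inv k = \<one>" "k \<in> carrier F"
      using field_Units by auto
    moreover from this have "k \<otimes> \<sigma> (inv k) = \<one>"
      using k h.hom_mult[of k "inv k"] h.hom_one by simp
    ultimately have "\<sigma> (inv k) = inv k"
      using comm_inv_char h.hom_closed by metis
    then show "inv k \<in> ?E"
      using \<open>inv k \<in> carrier F\<close> by simp
  qed (auto simp: h.hom_mult h.hom_add h.hom_a_inv h.hom_one)
  moreover have "K \<subseteq> ?E"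
    using K_subset Gal_fix[OF s] by auto
  ultimately show ?thesis
    using intermediate_field[of ?E] z x by auto
qed

lemma Gal_psum:
  assumes s: "\<sigma> \<in> Gal F K" and "\<And>i. a i \<in> K" "x \<in> carrier F"
  shows "\<sigma> (psum F n a x) = psum F n a (\<sigma> x)"
proof -
  interpret h: ring_hom_cring F F \<sigma>
    by (rule Gal_hom[OF field_axioms s])
  have "\<sigma> (psum F n a x) = psum F n (\<lambda>i. \<sigma> (a i)) (\<sigma> x)"
    using assms(2,3) K_subset by (intro h.hom_psum) auto
  then show ?thesis
    using Gal_fix[OF s] assms(2) by simp
qed

lemma Gal_closed: "\<sigma> \<in> Gal F K \<Longrightarrow> x \<in> carrier F \<Longrightarrow> \<sigma> x \<in> carrier F"
  by (auto simp: Gal_def ring_iso_def ring_hom_def)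

lemma Gal_funpow_closed: "\<sigma> \<in> Gal F K \<Longrightarrow> x \<in> carrier F \<Longrightarrow> (\<sigma> ^^ i) x \<in> carrier F"
  by (induction i) (auto simp: Gal_closed)

text \<open>An orbit of length \<open>m\<close> yields a polynomial of degree \<open>m\<close> over \<open>K\<close>, the fixed field.\<close>

lemma root_coeffs_orbit_in_K:
  assumes s: "\<sigma> \<in> Gal F K" and z: "z \<in> carrier F" "\<sigma> z \<noteq> z" and x: "x \<in> carrier F" "(\<sigma> ^^ m) x = x"
  shows "root_coeffs F (map (\<lambda>i. (\<sigma> ^^ i) x) [0..<m]) i \<in> K"
proof (cases m)
  case (Suc n)
  interpret h: ring_hom_cring F F \<sigma>
    by (rule Gal_hom[OF field_axioms s])
  note cl = Gal_funpow_closed[OF s x(1)]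
  let ?l = "map (\<lambda>i. (\<sigma> ^^ i) x) [0..<m]" and ?t = "map (\<lambda>i. (\<sigma> ^^ i) x) [1..<m]"
  have l: "?l = x # ?t"
    using Suc by (simp add: upt_rec)
  have "map \<sigma> ?l = map (\<lambda>i. (\<sigma> ^^ i) x) (map Suc [0..<m])"
    by simp
  also have "\<dots> = ?t @ [x]"
    using x(2) Suc by (simp only: map_Suc_upt) simp
  finally have "\<sigma> (root_coeffs F ?l i) = root_coeffs F (?t @ [x]) i"
    using h.hom_root_coeffs[of ?l i] cl by auto
  also have "\<dots> = root_coeffs F ?l i"
    unfolding l using root_coeffs_rotate[of x ?t i] cl x by auto
  finally show ?thesis
    using cl by (intro fixed_by_Gal[OF s z]) (auto intro!: root_coeffs_closed)
qed (use subringE[OF subfieldE(1)[OF subfield_K]] in simp)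

text \<open>The iterates of x are roots of its minimal polynomial, so two of the first p + 1
  coincide and \<sigma>^m x = x for some positive m <= p. If m < p, the polynomial of the orbit
  would be a monic relation of degree m over K, against the independence of 1, ..., x^(p-1).\<close>

lemma Gal_order:
  assumes s: "\<sigma> \<in> Gal F K" and x: "x \<in> carrier F" "\<sigma> x \<noteq> x"
  shows "(\<sigma> ^^ p) x = x"
proof -
  interpret h: ring_hom_cring F F \<sigma>
    by (rule Gal_hom[OF field_axioms s])
  note cl = Gal_funpow_closed[OF s]
  have xK: "x \<notin> K"
    using Gal_fix[OF s] x by auto
  have inj: "(\<sigma> ^^ i) y = (\<sigma> ^^ i) z \<Longrightarrow> y = z" if "y \<in> carrier F" "z \<in> carrier F" for i y z
  proof (induction i)
    case (Suc i)
    then have "(\<sigma> ^^ i) y = (\<sigma> ^^ i) z"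
      using that by (auto intro: inj_onD[OF Gal_inj[OF s] _ cl cl])
    then show ?case
      using Suc by simp
  qed simp
  obtain a where a: "\<And>i. a i \<in> K" "x [^] p = psum F p a x"
    using ex_psum[OF x(1) xK nat_pow_closed[OF x(1)]] by metis
  \<comment> \<open>The minimal polynomial of x up to sign. Its leading coefficient -1 would have to
    vanish if the p + 1 iterates were distinct.\<close>
  define b where "b i = (if i < p then a i else if i = p then \<ominus> \<one> else \<zero>)" for i
  have bF: "b i \<in> carrier F" for i
    using a K_subset by (auto simp: b_def)
  have aF: "a i \<in> carrier F" for i
    using a K_subset by auto
  have root: "((\<sigma> ^^ i) x) [^] p = psum F p a ((\<sigma> ^^ i) x)" for i
  proof (induction i)
    case (Suc i)
    have "\<sigma> (((\<sigma> ^^ i) x) [^] p) = \<sigma> (psum F p a ((\<sigma> ^^ i) x))"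
      using Suc by simp
    then show ?case
      using Gal_psum[where a = a, OF s a(1) cl[OF x(1)]] cl[OF x(1), of i] h.hom_pow[of "(\<sigma> ^^ i) x" p] by simp
  qed (use a in simp)
  have "psum F (Suc p) b ((\<sigma> ^^ i) x) = \<zero>" for i
  proof -
    have "psum F p b ((\<sigma> ^^ i) x) = psum F p a ((\<sigma> ^^ i) x)"
      by (rule psum_cong) (use bF aF cl[OF x(1)] in \<open>auto simp: b_def\<close>)
    then show ?thesis
      using bF cl[OF x(1), of i] root[of i, symmetric] by (simp add: b_def l_minus r_neg)
  qed
  then have "b p = \<zero>" if "inj_on (\<lambda>i. (\<sigma> ^^ i) x) {..p}"
    using that bF cl[OF x(1)]
    by (intro psum_roots[of b "(\<lambda>i. (\<sigma> ^^ i) x) ` {..p}" "Suc p" p]) (auto simp: card_image simp del: psum_Suc)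
  moreover have "b p \<noteq> \<zero>"
    using r_neg[of \<one>] by (auto simp: b_def)
  ultimately obtain i j where ij: "i < j" "j \<le> p" "(\<sigma> ^^ i) x = (\<sigma> ^^ j) x"
    unfolding inj_on_def by (metis atMost_iff linorder_neqE_nat)
  define m where "m = j - i"
  have m: "0 < m" "m \<le> p" "(\<sigma> ^^ m) x = x"
  proof -
    have "(\<sigma> ^^ i) x = (\<sigma> ^^ i) ((\<sigma> ^^ m) x)"
      using ij by (simp add: m_def flip: funpow_add[THEN fun_cong, unfolded o_def])
    then show "(\<sigma> ^^ m) x = x"
      using inj[OF x(1) cl[OF x(1)]] by metis
  qed (use ij in \<open>auto simp: m_def\<close>)
  have "\<not> m < p"
  proof
    assume "m < p"
    let ?l = "map (\<lambda>i. (\<sigma> ^^ i) x) [0..<m]" and ?t = "map (\<lambda>i. (\<sigma> ^^ i) x) [1..<m]"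
    have l: "?l = x # ?t"
      using m by (simp add: upt_rec)
    have lc: "set ?l \<subseteq> carrier F" "set ?t \<subseteq> carrier F"
      using cl[OF x(1)] by auto
    have "psum F p (root_coeffs F ?l) x = psum F (Suc m) (root_coeffs F ?l) x"
      using \<open>m < p\<close> lc x root_coeffs_gt[OF lc(1)] by (intro psum_extend root_coeffs_closed) auto
    also have "\<dots> = \<zero>"
      using psum_root_coeffs_hd[OF x(1) lc(2)] m(1) unfolding l by simp
    finally have "root_coeffs F ?l m = \<zero>"
      using root_coeffs_orbit_in_K[OF s x x(1) m(3)] \<open>m < p\<close>
      by (intro psum_eq_zeroD[OF x(1) xK, where a = "root_coeffs F ?l"])
    then show False
      using root_coeffs_length[OF lc(1)] by simp
  qed
  then show ?thesis
    using m by simp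
qed

end

section \<open>Roots of unity and Lagrange resolvents\<close>

locale kummer_prime_extension = prime_degree_extension F K p
  for F :: "('a, 'm) ring_scheme" (structure) and K and p +
  assumes galois: "galois_extension F K" and card_roots: "card {\<zeta> \<in> K. \<zeta> [^] p = \<one>} = p"
begin

lemma ex_moved:
  obtains \<sigma> z where "\<sigma> \<in> Gal F K" "z \<in> carrier F" "\<sigma> z \<noteq> z"
  using galois K_neq_carrier unfolding galois_extension_def by blast

text \<open>X^p - 1 already has p roots in K, so a further one in F would exceed its degree.\<close>

lemma root_of_unity_in_K:
  assumes z: "\<zeta> \<in> carrier F" "\<zeta> [^] p = \<one>"
  shows "\<zeta> \<in> K"
proof (rule ccontr)
  assume "\<zeta> \<notin> K"
  let ?S = "{\<zeta> \<in> K. \<zeta> [^] p = \<one>}"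
  have fin: "finite ?S"
    using card_roots p_ge_2 by (intro card_ge_0_finite) simp
  define b where "b i = (if i = p then \<one> else \<zero>) \<oplus> (if i = 0 then \<ominus> \<one> else \<zero>)" for i
  have b: "b i \<in> carrier F" for i
    by (simp add: b_def)
  have "psum F (Suc p) b x = \<zero>" if x: "x \<in> carrier F" "x [^] p = \<one>" for x
  proof -
    have "psum F (Suc p) b x = psum F (Suc p) (\<lambda>i. if i = p then \<one> else \<zero>) x \<oplus> psum F (Suc p) (\<lambda>i. if i = 0 then \<ominus> \<one> else \<zero>) x"
      unfolding b_def[abs_def] by (rule psum_add) (use x in auto)
    then show ?thesis
      using x by (simp add: psum_single r_neg del: psum_Suc)
  qed
  then have "b p = \<zero>"
    using \<open>\<zeta> \<notin> K\<close> fin card_roots z K_subset b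
    by (intro psum_roots[of b "insert \<zeta> ?S" "Suc p" p]) (auto simp del: psum_Suc)
  then show False
    using p_ge_2 by (simp add: b_def)
qed

text \<open>The sum is the Lagrange resolvent of z. Applying \<sigma> and multiplying by \<zeta>
  shifts its terms by one place; the last term returns to the first since \<sigma>^p z = z and
  \<zeta>^p = 1.\<close>

lemma Gal_resolvent:
  assumes s: "\<sigma> \<in> Gal F K" and z: "z \<in> carrier F" "(\<sigma> ^^ p) z = z" and r: "\<zeta> \<in> K" "\<zeta> [^] p = \<one>"
  shows "\<zeta> \<otimes> \<sigma> (psum F p (\<lambda>i. (\<sigma> ^^ i) z) \<zeta>) = psum F p (\<lambda>i. (\<sigma> ^^ i) z) \<zeta>" (is "_ \<otimes> \<sigma> ?E = _")
proof -
  interpret h: ring_hom_cring F F \<sigma>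
    by (rule Gal_hom[OF field_axioms s])
  let ?s = "\<lambda>i. (\<sigma> ^^ i) z"
  have cl: "?s i \<in> carrier F" for i
    by (rule Gal_funpow_closed[OF s z(1)])
  have rF: "\<zeta> \<in> carrier F"
    using r K_subset by auto
  have E: "?E \<in> carrier F"
    using cl rF by (rule psum_closed)
  have "\<sigma> ?E = psum F p (\<lambda>i. ?s (Suc i)) \<zeta>"
    using h.hom_psum[of ?s \<zeta> p] cl rF Gal_fix[OF s r(1)] by simp
  \<comment> \<open>The sum with p + 1 terms is evaluated twice, by splitting off its first and then
    its last term, both of which equal z.\<close>
  then have "z \<oplus> \<zeta> \<otimes> \<sigma> ?E = psum F (Suc p) ?s \<zeta>"
    using psum_split_0[of ?s \<zeta> p] cl rF by simp
  also have "\<dots> = z \<oplus> ?E"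
    using psum_Suc[of ?s \<zeta> p] cl rF z r(2) E by (simp add: a_comm)
  finally show ?thesis
    by (rule add.l_cancel) (use z(1) E rF h.hom_closed[OF E] in auto)
qed

text \<open>A nonzero resolvent for some \<zeta> other than 1 is multiplied by the inverse of
  \<zeta> under \<sigma>; hence it is moved while its p-th power is fixed. What needs proof is that
  not all these resolvents vanish.\<close>

lemma ex_kummer_element:
  obtains \<theta> where "\<theta> \<in> carrier F" "\<theta> \<notin> K" "\<theta> [^] p \<in> K"
proof -
  obtain \<sigma> z where s: "\<sigma> \<in> Gal F K" and z: "z \<in> carrier F" "\<sigma> z \<noteq> z"
    by (rule ex_moved)
  interpret h: ring_hom_cring F F \<sigma>
    by (rule Gal_hom[OF field_axioms s])
  have ord: "(\<sigma> ^^ p) z = z"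
    by (rule Gal_order[OF s z])
  let ?s = "\<lambda>i. (\<sigma> ^^ i) z"
  define E where "E \<zeta> = psum F p ?s \<zeta>" for \<zeta>
  let ?S = "{\<zeta> \<in> K. \<zeta> [^] p = \<one>}"
  have cl: "?s i \<in> carrier F" for i
    by (rule Gal_funpow_closed[OF s z(1)])
  have fin: "finite ?S"
    using card_roots p_ge_2 by (intro card_ge_0_finite) simp
  have E: "E \<zeta> \<in> carrier F" if "\<zeta> \<in> carrier F" for \<zeta>
    using cl that unfolding E_def by (rule psum_closed)
  have res: "\<zeta> \<otimes> \<sigma> (E \<zeta>) = E \<zeta>" if "\<zeta> \<in> ?S" for \<zeta>
    unfolding E_def using Gal_resolvent[OF s z(1) ord] that by blast
  have "\<exists>\<zeta>\<in>?S - {\<one>}. E \<zeta> \<noteq> \<zero>"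
  proof (rule ccontr)
    assume "\<not> ?thesis"
    then have E0: "E \<zeta> = \<zero>" if "\<zeta> \<in> ?S - {\<one>}" for \<zeta>
      using that by blast
    \<comment> \<open>Subtracting \<sigma>^(p-1) z times 1 + X + ... + X^(p-1), which vanishes at
      every \<zeta> other than 1, removes the top coefficient. The remaining p - 1 coefficients are
      then killed by the p - 1 roots, and t 0 = 0 says that \<sigma>^(p-1) fixes z.\<close>
    define t where "t i = ?s i \<ominus> ?s (p - 1) \<otimes> \<one>" for i
    have t: "t i \<in> carrier F" for i
      using cl by (simp add: t_def)
    have "psum F (p - 1) t \<zeta> = \<zero>" if \<zeta>: "\<zeta> \<in> ?S - {\<one>}" for \<zeta>
    proof -
      have rF: "\<zeta> \<in> carrier F"
        using \<zeta> K_subset by auto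
      let ?P = "psum F p (\<lambda>i. \<one>) \<zeta>"
      have P: "?P \<in> carrier F"
        using rF by simp
      have "\<one> \<oplus> \<zeta> \<otimes> ?P = \<one> \<oplus> ?P"
        using psum_split_0[of "\<lambda>i. \<one>" \<zeta> p] psum_Suc[of "\<lambda>i. \<one>" \<zeta> p] rF \<zeta> P by (simp add: a_comm)
      then have "\<zeta> \<otimes> ?P = \<one> \<otimes> ?P"
        using add.l_cancel[of \<one> "\<zeta> \<otimes> ?P" ?P] rF P by simp
      then have P0: "?P = \<zero>"
        using rF P \<zeta> m_rcancel[of ?P \<zeta> \<one>] by auto
      have sm: "psum F p (\<lambda>i. ?s (p - 1) \<otimes> \<one>) \<zeta> = \<zero>"
        using psum_smult[of "\<lambda>i. \<one>" "?s (p - 1)" \<zeta> p] rF cl P0 by simp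
      have "psum F p t \<zeta> = E \<zeta> \<ominus> psum F p (\<lambda>i. ?s (p - 1) \<otimes> \<one>) \<zeta>"
        unfolding t_def[abs_def] E_def by (rule psum_minus) (use cl rF in auto)
      then have "psum F p t \<zeta> = \<zero>"
        unfolding sm E0[OF \<zeta>] by (simp add: minus_eq)
      moreover have "psum F p t \<zeta> = psum F (p - 1) t \<zeta> \<oplus> t (p - 1) \<otimes> \<zeta> [^] (p - 1)"
        using psum_Suc[of t \<zeta> "p - 1"] t rF p_ge_2 by simp
      moreover have "t (p - 1) = \<zero>"
        using cl[of "p - 1"] by (simp add: t_def r_right_minus_eq)
      ultimately show ?thesis
        using t rF by simp
    qed
    then have "t 0 = \<zero>"
      using p_ge_2 fin card_roots t K_subset subringE(3)[OF subfieldE(1)[OF subfield_K]]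
      by (intro psum_roots[of t "?S - {\<one>}" "p - 1" 0]) auto
    then have "z = ?s (p - 1)"
      using cl[of "p - 1"] z(1) r_right_minus_eq[of z "?s (p - 1)"] by (simp add: t_def)
    then have "\<sigma> z = (\<sigma> ^^ Suc (p - 1)) z"
      by simp
    then show False
      using ord p_ge_2 z(2) by simp
  qed
  then obtain \<zeta> where r: "\<zeta> \<in> ?S" "\<zeta> \<noteq> \<one>" "E \<zeta> \<noteq> \<zero>"
    by blast
  let ?t = "E \<zeta>"
  have rF: "\<zeta> \<in> carrier F"
    using r K_subset by auto
  have tF: "?t \<in> carrier F" "\<sigma> ?t \<in> carrier F"
    using E[OF rF] by auto
  have "\<sigma> ?t \<noteq> ?t"
    using res[OF r(1)] m_rcancel[of ?t \<zeta> \<one>] r tF rF by auto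
  then have "?t \<notin> K"
    using Gal_fix[OF s] by auto
  moreover have "?t [^] p = (\<zeta> \<otimes> \<sigma> ?t) [^] p"
    by (simp only: res[OF r(1)])
  then have "?t [^] p = (\<sigma> ?t) [^] p"
    using r(1) rF tF by (simp add: nat_pow_distrib)
  then have "\<sigma> (?t [^] p) = ?t [^] p"
    using h.hom_pow[OF tF(1), of p] by metis
  then have "?t [^] p \<in> K"
    by (intro fixed_by_Gal[OF s z]) (use tF in auto)
  ultimately show ?thesis
    using that tF by blast
qed

lemma kummer_generator_iff: "kummer_generator F K p \<theta> \<longleftrightarrow> \<theta> \<in> carrier F \<and> \<theta> \<notin> K \<and> \<theta> [^] p \<in> K"
proof -
  have "generate_field F (K \<union> {\<theta>}) \<noteq> carrier F" if "\<theta> \<in> K"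
  proof -
    have "generate_field F (K \<union> {\<theta>}) \<subseteq> K"
      by (rule generate_field_min_subfield1[OF _ subfield_K]) (use that K_subset in auto)
    then show ?thesis
      using K_subset K_neq_carrier by auto
  qed
  then show ?thesis
    using generate_field_eq_carrier[of \<theta>] by (auto simp: kummer_generator_def)
qed

lemma Gal_kummer_element:
  assumes s: "\<sigma> \<in> Gal F K" and t: "\<theta> \<in> carrier F" "\<theta> \<noteq> \<zero>" "\<theta> [^] p \<in> K"
  obtains \<zeta> where "\<zeta> \<in> K" "\<zeta> [^] p = \<one>" "\<sigma> \<theta> = \<zeta> \<otimes> \<theta>"
proof -
  interpret h: ring_hom_cring F F \<sigma>
    by (rule Gal_hom[OF field_axioms s])
  have inv: "inv \<theta> \<in> carrier F" "inv \<theta> \<otimes> \<theta> = \<one>"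
    using t field_Units by auto
  define \<zeta> where "\<zeta> = \<sigma> \<theta> \<otimes> inv \<theta>"
  have r: "\<zeta> \<in> carrier F" "\<sigma> \<theta> = \<zeta> \<otimes> \<theta>"
    using t inv by (auto simp: \<zeta>_def m_assoc)
  have "\<theta> [^] p \<noteq> \<zero>"
    using t by (simp add: nat_pow_eq_0_iff)
  moreover have "\<zeta> [^] p \<otimes> \<theta> [^] p = \<one> \<otimes> \<theta> [^] p"
    using Gal_fix[OF s t(3)] h.hom_pow[of \<theta> p] t r by (simp add: nat_pow_distrib[symmetric])
  ultimately have "\<zeta> [^] p = \<one>"
    using m_rcancel[of "\<theta> [^] p" "\<zeta> [^] p" \<one>] t r by simp
  then show ?thesis
    using that root_of_unity_in_K r by blast
qed

end

section \<open>Kummer generators adapted to the valuation\<close>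

context valued_field
begin

lemma PIdl_mem: "b \<in> \<P> a \<longleftrightarrow> (\<exists>r\<in>\<O>. b = r \<otimes> a)"
  by (auto simp: cgenideal_def)

lemma PIdl_ideal: "a \<in> \<O> \<Longrightarrow> ideal (\<P> a) (val_Ring L v)"
  using cring.cgenideal_ideal[OF cring_O, of a] by simp

lemma PIdl_add: "a \<in> carrier L \<Longrightarrow> b \<in> \<P> a \<Longrightarrow> c \<in> \<P> a \<Longrightarrow> b \<oplus> c \<in> \<P> a"
  unfolding PIdl_mem by (metis O_add O_closed l_distr)

lemma PIdl_zero: "a \<in> carrier L \<Longrightarrow> \<zero> \<in> \<P> a"
  unfolding PIdl_mem by (intro bexI[of _ \<zero>]) auto

lemma PIdl_self: "a \<in> carrier L \<Longrightarrow> a \<in> \<P> a"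
  unfolding PIdl_mem by (intro bexI[of _ \<one>]) auto

lemma PIdl_mult: "a \<in> carrier L \<Longrightarrow> r \<in> \<O> \<Longrightarrow> b \<in> \<P> a \<Longrightarrow> r \<otimes> b \<in> \<P> a"
  unfolding PIdl_mem by (metis O_mult O_closed m_assoc)

lemma PIdl_unit_mult:
  assumes "u \<in> carrier L" "u \<noteq> \<zero>" "v u = 0" "a \<in> carrier L"
  shows "\<P> (u \<otimes> a) = \<P> a"
proof
  have "u \<in> \<O>" "inv u \<in> \<O>"
    using assms unit_inv by (auto simp: O_mem)
  show "\<P> (u \<otimes> a) \<subseteq> \<P> a"
  proof
    fix b assume "b \<in> \<P> (u \<otimes> a)"
    then obtain r where r: "r \<in> \<O>" "b = r \<otimes> (u \<otimes> a)"
      unfolding PIdl_mem by blast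
    then have "b = (r \<otimes> u) \<otimes> a"
      using assms by (simp add: m_assoc O_closed)
    then show "b \<in> \<P> a"
      unfolding PIdl_mem using r \<open>u \<in> \<O>\<close> by auto
  qed
  show "\<P> a \<subseteq> \<P> (u \<otimes> a)"
  proof
    fix b assume "b \<in> \<P> a"
    then obtain r where r: "r \<in> \<O>" "b = r \<otimes> a"
      unfolding PIdl_mem by blast
    then have "b = (r \<otimes> inv u) \<otimes> (u \<otimes> a)"
      using assms by (simp add: m_assoc O_closed m_assoc[symmetric, of "inv u" u a])
    then show "b \<in> \<P> (u \<otimes> a)"
      unfolding PIdl_mem using r \<open>inv u \<in> \<O>\<close> by auto
  qed
qed

end

text \<open>\<open>S\<close> records where the cofactor, the sum of all x^i y^(n-1-i), lies. With
  \<open>\<O>\<close> for \<open>S\<close> the divisibility becomes integral.\<close>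

lemma (in cring) pow_minus_pow_dvd:
  assumes "S \<subseteq> carrier R" "x \<in> S" "y \<in> S" "\<zero> \<in> S" "\<one> \<in> S"
    "\<And>s t. s \<in> S \<Longrightarrow> t \<in> S \<Longrightarrow> s \<oplus> t \<in> S" "\<And>s t. s \<in> S \<Longrightarrow> t \<in> S \<Longrightarrow> s \<otimes> t \<in> S"
  obtains w where "w \<in> S" "x [^] (n::nat) \<ominus> y [^] n = w \<otimes> (x \<ominus> y)"
proof -
  have "\<exists>w\<in>S. x [^] n \<ominus> y [^] n = w \<otimes> (x \<ominus> y)"
  proof (induction n)
    case 0
    then show ?case
      using assms by (intro bexI[of _ \<zero>]) (auto simp: minus_eq r_neg subset_iff)
  next
    case (Suc n)
    then obtain w where w: "w \<in> S" "x [^] n \<ominus> y [^] n = w \<otimes> (x \<ominus> y)"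
      by blast
    have pow: "x [^] n \<in> S" "y [^] n \<in> S"
      using assms by (induction n) auto
    have xy: "x \<in> carrier R" "y \<in> carrier R" "w \<in> carrier R" "y [^] n \<in> carrier R" "x [^] n \<in> carrier R"
      using assms w by auto
    have id: "a \<otimes> x \<ominus> b \<otimes> y = (a \<ominus> b) \<otimes> x \<oplus> b \<otimes> (x \<ominus> y)" 
      "(w \<otimes> (x \<ominus> y)) \<otimes> x \<oplus> b \<otimes> (x \<ominus> y) = (w \<otimes> x \<oplus> b) \<otimes> (x \<ominus> y)"
      if "a \<in> carrier R" "b \<in> carrier R" for a b
      using that xy(1-3) by algebra+
    have "x [^] Suc n \<ominus> y [^] Suc n = (w \<otimes> x \<oplus> y [^] n) \<otimes> (x \<ominus> y)"
      using id[OF xy(5,4)] w(2) by simp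
    then show ?case
      using assms w pow by auto
  qed
  then show ?thesis
    using that by blast
qed

text \<open>For a prime p, \<open>p_in_M\<close> says that char Kv = p and \<open>p_nonzero\<close>
  that K does not have characteristic p.\<close>

locale kummer_inert_extension = residually_inert_extension L v K p + kummer_prime_extension L K p
  for L :: "('a, 'm) ring_scheme" (structure) and v :: "'a \<Rightarrow> 'g :: linordered_ab_group_add" and K p +
  assumes p_in_M: "[p] \<cdot> \<one> \<in> val_ideal L v" and p_nonzero: "[p] \<cdot> \<one> \<noteq> \<zero>"
begin

text \<open>Since x^p has integral coordinates, x satisfies a monic equation over the valuation ring
  of K, and so does its conjugate.\<close>

lemma Gal_O_resgen:
  assumes s: "\<sigma> \<in> Gal L K" and x: "resgen x"
  shows "\<sigma> x \<in> \<O>"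
proof -
  interpret h: ring_hom_cring L L \<sigma>
    by (rule Gal_hom[OF field_axioms s])
  obtain a where a: "\<And>i. a i \<in> K" "\<And>i. a i \<in> \<O>" "x [^] p = psum L p a x"
    using ex_O_psum[OF x O_pow[OF resgen_O[OF x]]] by metis
  have xL: "x \<in> carrier L" and sx: "\<sigma> x \<in> carrier L"
    using resgen_closed[OF x] Gal_closed[OF s] by auto
  have "(\<sigma> x) [^] p = psum L p a (\<sigma> x)"
    using Gal_psum[OF s, of a x p] h.hom_pow[OF xL, of p] a xL by metis
  then show ?thesis
    by (intro integrally_closed[OF sx, of a]) (use a in auto)
qed

text \<open>A polynomial in x with integral coefficients from K goes to the same polynomial in
  \<sigma> x. This stands in for the uniqueness of the extension of v.\<close>

lemma Gal_O:
  assumes s: "\<sigma> \<in> Gal L K" and b: "b \<in> \<O>"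
  shows "\<sigma> b \<in> \<O>"
proof -
  obtain x where x: "resgen x"
    by (rule ex_resgen)
  obtain a where a: "\<And>i. a i \<in> K" "\<And>i. a i \<in> \<O>" "b = psum L p a x"
    using ex_O_psum[OF x b] by metis
  have "\<sigma> b = psum L p a (\<sigma> x)"
    using Gal_psum[OF s, of a x p] a resgen_closed[OF x] by metis
  also have "\<dots> \<in> \<O>"
    by (rule psum_in) (use a Gal_O_resgen[OF s x] O_closed in auto)
  finally show ?thesis .
qed

lemma v_root_of_unity:
  assumes "\<zeta> \<in> carrier L" "\<zeta> [^] p = \<one>"
  shows "\<zeta> \<in> \<O>"
proof -
  have "\<zeta> [^] p = psum L p (\<lambda>i. if i = 0 then \<one> else \<zero>) \<zeta>"
    using psum_single[of \<one> \<zeta> p 0] assms p_ge_2 by simp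
  then show ?thesis
    by (intro integrally_closed[OF assms(1), of "\<lambda>i. if i = 0 then \<one> else \<zero>" p]) auto
qed

text \<open>With t = \<zeta> - 1, the equation (1 + t)^p = 1 first gives t^p in \<open>\<M>\<close>,
  hence t in \<open>\<M>\<close>. Only then is 1 + t h known to be a unit, which is what makes p and
  t^(p-1) associated.\<close>

lemma root_of_unity_minus_one:
  assumes z: "\<zeta> \<in> carrier L" "\<zeta> [^] p = \<one>" "\<zeta> \<noteq> \<one>"
  obtains u where "u \<in> carrier L" "u \<noteq> \<zero>" "v u = 0" "[p] \<cdot> \<one> = u \<otimes> (\<zeta> \<ominus> \<one>) [^] (p - 1)"
    "\<zeta> \<ominus> \<one> \<in> \<M>"
proof -
  define t where "t = \<zeta> \<ominus> \<one>"
  have tL: "t \<in> carrier L" and tz: "\<one> \<oplus> t = \<zeta>" and t0: "t \<noteq> \<zero>"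
    using z r_right_minus_eq[of \<zeta> \<one>] by (auto simp: t_def minus_eq a_lcomm r_neg)
  have tO: "t \<in> \<O>"
    using v_root_of_unity[OF z(1,2)] by (simp add: t_def)
  interpret O: cring "val_Ring L v" by (rule cring_O)
  obtain h where h: "h \<in> \<O>"
    "(\<one> \<oplus> t) [^] p = \<one> \<oplus> [p] \<cdot> \<one> \<otimes> t \<oplus> t [^] p \<oplus> [p] \<cdot> \<one> \<otimes> (t \<otimes> t \<otimes> h)"
    using O.one_plus_pow_prime[of t p] tO prime_p unfolding pow_val_Ring add_pow_val_Ring by auto
  have hL: "h \<in> carrier L"
    using h O_closed by blast
  let ?p = "[p] \<cdot> \<one>"
  have pL: "?p \<in> carrier L"
    by simp
  have tp: "t [^] p = t \<otimes> t [^] (p - 1)"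
    using p_ge_2 tL nat_pow_Suc2[of t "p - 1"] by simp
  have id: "q = \<ominus> (k \<otimes> t) \<ominus> k \<otimes> (t \<otimes> t \<otimes> h) \<oplus> ((\<one> \<oplus> k \<otimes> t \<oplus> q \<oplus> k \<otimes> (t \<otimes> t \<otimes> h)) \<ominus> \<one>)"
    if "k \<in> carrier L" "q \<in> carrier L" for k q
    using that tL hL by (simp add: ring_cancel)
  have tpow: "t [^] p = \<ominus> (?p \<otimes> t) \<ominus> ?p \<otimes> (t \<otimes> t \<otimes> h)"
    using id[OF pL nat_pow_closed[OF tL, of p]] h(2) tL hL unfolding tz z(2) by (simp add: r_neg minus_eq)
  have "?p \<otimes> t \<in> \<M>" "?p \<otimes> (t \<otimes> t \<otimes> h) \<in> \<M>"
    using M_mult[of t ?p] M_mult[of "t \<otimes> t \<otimes> h" ?p] p_in_M tO h(1) tL hL pL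
    by (simp_all add: m_comm[of ?p])
  then have "t [^] p \<in> \<M>"
    unfolding tpow by simp
  then have tM: "t \<in> \<M>"
    by (rule M_pow[OF tO])
  \<comment> \<open>Chosen such that t^(p-1) = p w; the unit \<open>u\<close> of the statement is
    its inverse.\<close>
  define w where "w = \<ominus> (\<one> \<oplus> t \<otimes> h)"
  have "w \<in> \<O>"
    using tO h by (simp add: w_def)
  moreover have "w \<notin> \<M>"
  proof
    assume "w \<in> \<M>"
    then have "\<ominus> w \<ominus> t \<otimes> h \<in> \<M>"
      using tM M_mult[OF h(1) tM] m_comm[OF hL tL] by simp
    moreover have "\<ominus> w \<ominus> t \<otimes> h = \<one>"
      using tL hL by (simp add: w_def minus_eq a_assoc r_neg)
    ultimately show False
      by simp
  qed
  ultimately have w: "w \<noteq> \<zero>" "v w = 0" "w \<in> carrier L"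
    using unit_mem O_closed by auto
  have "t \<otimes> t [^] (p - 1) = t \<otimes> (?p \<otimes> w)"
    unfolding tp[symmetric] tpow
  proof -
    show "\<ominus> (?p \<otimes> t) \<ominus> ?p \<otimes> (t \<otimes> t \<otimes> h) = t \<otimes> (?p \<otimes> w)"
      unfolding w_def using pL tL hL by (simp add: ring_cancel)
  qed
  then have tw: "t [^] (p - 1) = ?p \<otimes> w"
    using m_lcancel[OF t0 tL, of "t [^] (p - 1)" "?p \<otimes> w"] tL pL w by simp
  have "?p = inv w \<otimes> t [^] (p - 1)"
    using w pL unfolding tw by (simp add: m_comm[of ?p] m_assoc[symmetric])
  moreover have "inv w \<noteq> \<zero>" "inv w \<in> carrier L" "v (inv w) = 0"
    using w by (auto simp: v_inv)
  ultimately show ?thesis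
    using that[of "inv w"] tM by (simp add: t_def)
qed

text \<open>Both (p-1)-st powers are associated to p, so the quotient r has a unit as its (p-1)-st
  power. Read as a monic equation with integral constant term, this makes r integral.\<close>

lemma root_of_unity_dvd:
  assumes z: "\<zeta> \<in> carrier L" "\<zeta> [^] p = \<one>" "\<zeta> \<noteq> \<one>" and z': "\<zeta>' \<in> carrier L" "\<zeta>' [^] p = \<one>"
  obtains r where "r \<in> \<O>" "\<zeta>' \<ominus> \<one> = r \<otimes> (\<zeta> \<ominus> \<one>)"
proof (cases "\<zeta>' = \<one>")
  case True
  then show ?thesis
    using that[of \<zero>] z by (simp add: minus_eq r_neg)
next
  case False
  let ?t = "\<zeta> \<ominus> \<one>" and ?t' = "\<zeta>' \<ominus> \<one>"
  obtain u where u: "u \<in> carrier L" "u \<noteq> \<zero>" "v u = 0" "[p] \<cdot> \<one> = u \<otimes> ?t [^] (p - 1)"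
    using root_of_unity_minus_one[OF z] by blast
  obtain u' where u': "u' \<in> carrier L" "u' \<noteq> \<zero>" "v u' = 0" "[p] \<cdot> \<one> = u' \<otimes> ?t' [^] (p - 1)"
    using root_of_unity_minus_one[OF z' False] by blast
  have t: "?t \<in> carrier L" "?t \<noteq> \<zero>" "?t' \<in> carrier L" "?t' \<noteq> \<zero>"
    using z z' False by (auto simp: r_right_minus_eq)
  define r where "r = ?t' \<otimes> inv ?t"
  have r: "r \<in> carrier L" "?t' = r \<otimes> ?t" "r \<noteq> \<zero>"
    using t by (auto simp: r_def m_assoc integral_iff)
  have tp: "?t [^] (p - 1) \<noteq> \<zero>" "?t [^] (p - 1) \<in> carrier L"
    using t by (auto simp: nat_pow_eq_0_iff)
  have "u' \<otimes> (r [^] (p - 1) \<otimes> ?t [^] (p - 1)) = u \<otimes> ?t [^] (p - 1)"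
    using u(4) u'(4) r t unfolding r(2) by (simp add: nat_pow_distrib)
  then have "(u' \<otimes> r [^] (p - 1)) \<otimes> ?t [^] (p - 1) = u \<otimes> ?t [^] (p - 1)"
    using u' r tp by (simp add: m_assoc)
  then have "u' \<otimes> r [^] (p - 1) = u"
    using m_rcancel[OF tp, of "u' \<otimes> r [^] (p - 1)" u] u u' r by simp
  then have "v (r [^] (p - 1)) = 0"
    using v_mult[of u' "r [^] (p - 1)"] u u' r by (simp add: nat_pow_eq_0_iff)
  then have "r [^] (p - 1) = psum L (p - 1) (\<lambda>i. if i = 0 then r [^] (p - 1) else \<zero>) r" 
    using psum_single[of "r [^] (p - 1)" r "p - 1" 0] r p_ge_2 by simp
  then have "r \<in> \<O>"
    by (rule integrally_closed[OF r(1), rotated]) (use \<open>v (r [^] (p - 1)) = 0\<close> r in \<open>auto simp: O_mem\<close>)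
  then show ?thesis
    using that r by blast
qed

text \<open>Maximality of v w for w = h - d is used twice. If v w = 0, no element of K is congruent
  to h modulo \<open>\<M>\<close>, so h is a residual generator. If v w > 0, the multiple of w
  scaled to value 0 is one, because a congruent element of K would improve d.\<close>

lemma ex_standard_kummer_element:
  obtains \<eta> where "\<eta> \<in> carrier L" "\<eta> \<notin> K" "\<eta> [^] p \<in> K"
    "resgen \<eta> \<or> (\<exists>c\<in>K - {\<zero>}. \<eta> \<in> \<O> \<and> \<eta> \<ominus> \<one> \<in> \<M> \<and> resgen (c \<otimes> (\<eta> \<ominus> \<one>)))"
proof -
  have kummer_mult: "a \<otimes> \<theta> \<in> carrier L \<and> a \<otimes> \<theta> \<notin> K \<and> (a \<otimes> \<theta>) [^] p \<in> K"
    if a: "a \<in> K" "a \<noteq> \<zero>" and th: "\<theta> \<in> carrier L" "\<theta> \<notin> K" "\<theta> [^] p \<in> K" for a \<theta>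
  proof -
    have aL: "a \<in> carrier L"
      using a K_closed by blast
    have "a [^] p \<in> K"
      using a K_ring(3,6) by (induction p) auto
    moreover have "\<theta> = inv a \<otimes> (a \<otimes> \<theta>)"
      using aL a th by (simp add: m_assoc[symmetric])
    then have "a \<otimes> \<theta> \<notin> K"
      using K_inv[OF a] K_ring(6) th(2) by metis
    ultimately show ?thesis
      using aL th K_ring(6) by (simp add: nat_pow_distrib)
  qed
  obtain \<theta> where th: "\<theta> \<in> carrier L" "\<theta> \<notin> K" "\<theta> [^] p \<in> K"
    by (rule ex_kummer_element)
  have th0: "\<theta> \<noteq> \<zero>"
    using th(2) K_ring(2) by auto
  obtain c where c: "c \<in> K" "c \<noteq> \<zero>" "v c = v \<theta>"
    using ex_same_value[OF th(1) th0] by blast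
  define h where "h = inv c \<otimes> \<theta>"
  have cL: "c \<in> carrier L"
    using c K_closed by blast
  have h: "h \<in> carrier L" "h \<notin> K" "h [^] p \<in> K"
    unfolding h_def using kummer_mult[OF K_inv[OF c(1,2)] _ th] c cL by auto
  have h0: "h \<noteq> \<zero>"
    using h(2) K_ring(2) by auto
  have vh: "v h = 0"
    unfolding h_def using c cL th th0 by (simp add: v_mult v_inv)
  obtain y where y: "resgen y"
    by (rule ex_resgen)
  note yL = resgen_closed[OF y]
  obtain a where a: "\<And>i. a i \<in> K" "h = psum L p a y"
    using ex_psum[OF yL resgen_notin_K[OF y] h(1)] by metis
  \<comment> \<open>The coordinates of h - e for \<open>e\<close> in K: only the constant one
    depends on \<open>e\<close>.\<close>
  define b where "b e = (\<lambda>i. a i \<ominus> (if i = 0 then e else \<zero>))" for e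
  have bK: "b e i \<in> K" if "e \<in> K" for e i
    using a that K_ring by (auto simp: b_def minus_eq)
  have ps: "psum L p (b e) y = h \<ominus> e" if "e \<in> K" for e
  proof -
    have "psum L p (b e) y = psum L p a y \<ominus> psum L p (\<lambda>i. if i = 0 then e else \<zero>) y"
      unfolding b_def by (rule psum_minus) (use a that K_closed yL in auto)
    then show ?thesis
      using a that K_closed yL p_ge_2 by (simp add: psum_single)
  qed
  define d where "d = a 0"
  have dK: "d \<in> K" and dL: "d \<in> carrier L"
    using a K_closed by (auto simp: d_def)
  define w where "w = h \<ominus> d"
  have wL: "w \<in> carrier L" and w0: "w \<noteq> \<zero>"
    using h dK dL r_right_minus_eq[of h d] by (auto simp: w_def)
  have "\<exists>i<p. b d i \<noteq> \<zero>"
  proof (rule ccontr)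
    assume "\<not> ?thesis"
    then have "psum L p (b d) y = psum L p (\<lambda>i. \<zero>) y"
      using bK[OF dK] K_closed yL by (intro psum_cong) auto
    also have "\<dots> = \<zero>"
      using psum_single[of \<zero> y p 0] yL by simp
    finally show False
      using w0 ps[OF dK] by (simp add: w_def)
  qed
  then obtain j where j: "j < p" "b d j \<noteq> \<zero>" "v w = v (b d j)"
    using v_psum[OF y, of "b d"] bK[OF dK] unfolding ps[OF dK] w_def by metis
  have "j \<noteq> 0"
  proof
    assume "j = 0"
    then show False
      using j(2) dL by (simp add: b_def d_def minus_eq r_neg)
  qed
  \<comment> \<open>The constant coordinate of h - d is 0, so its value is attained at some j > 0.
    This coordinate is shared by all h - e and bounds their values.\<close>
  have best: "v (h \<ominus> e) \<le> v w" if e: "e \<in> K" for e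
  proof -
    have eq: "b e j = b d j"
      using \<open>j \<noteq> 0\<close> by (simp add: b_def)
    obtain k where k: "\<And>i. i < p \<Longrightarrow> b e i \<noteq> \<zero> \<Longrightarrow> v (b e k) \<le> v (b e i)" "v (h \<ominus> e) = v (b e k)"
      using v_psum[OF y, of "b e" j] bK[OF e] j(1,2) unfolding ps[OF e] eq by metis
    then show ?thesis
      using k(1)[of j] k(2) j eq by simp
  qed
  have hO: "h \<in> \<O>" "h \<notin> \<M>"
    using h vh h0 by (auto simp: O_mem M_mem)
  have vw: "0 \<le> v w"
    using best[OF K_ring(2)] h vh by (simp add: minus_eq)
  show ?thesis
  proof (cases "v w = 0")
    case True
    have "h \<ominus> f \<notin> \<M>" if "f \<in> K" for f
      using best[OF that] True h(2) that r_right_minus_eq[of h f] h(1) K_closed[OF that] by (auto simp: M_mem)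
    then have "resgen h"
      using resgen_iff hO by blast
    then show ?thesis
      using that h by blast
  next
    case False
    then have wM: "w \<in> \<M>"
      using vw wL by (auto simp: M_mem less_le)
    obtain c where c: "c \<in> K" "c \<noteq> \<zero>" "v c = v (inv w)"
      using ex_same_value[of "inv w"] wL w0 by auto
    have cL: "c \<in> carrier L" and vc: "v c = - v w"
      using c K_closed wL w0 v_inv by auto
    have rw: "resgen (c \<otimes> w)"
      unfolding resgen_iff
    proof (intro conjI ballI impI notI)
      show "c \<otimes> w \<in> \<O>"
        using v_mult[OF cL wL c(2) w0] cL wL by (simp add: vc O_mem)
      fix f assume f: "f \<in> K" "c \<otimes> w \<ominus> f \<in> \<M>"
      have fL: "f \<in> carrier L"
        using f K_closed by blast
      have e: "d \<oplus> inv c \<otimes> f \<in> K"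
        using K_ring(6,7) dK f(1) K_inv[OF c(1,2)] by blast
      have "c \<otimes> w \<ominus> f = c \<otimes> (h \<ominus> (d \<oplus> inv c \<otimes> f))"
      proof -
        have "c \<otimes> (h \<ominus> d) \<ominus> c \<otimes> g = c \<otimes> (h \<ominus> (d \<oplus> g))" if "g \<in> carrier L" for g
          using that cL h(1) dL by algebra
        from this[of "inv c \<otimes> f"] show ?thesis
          using cL c(2) fL by (simp add: w_def m_assoc[symmetric])
      qed
      moreover have "h \<ominus> (d \<oplus> inv c \<otimes> f) \<noteq> \<zero>"
        using e h r_right_minus_eq[of h "d \<oplus> inv c \<otimes> f"] K_closed[OF e] by auto
      ultimately have "0 < v c + v (h \<ominus> (d \<oplus> inv c \<otimes> f))"
        using f(2) cL c(2) h(1) K_closed[OF e] by (simp add: M_mem v_mult integral_iff)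
      then show False
        using best[OF e] vc by (simp add: algebra_simps)
    qed
    have "d \<in> \<O>" "d \<notin> \<M>"
    proof -
      have d: "d = h \<ominus> w" "h = w \<oplus> d"
        using h(1) dL unfolding w_def by algebra+
      show "d \<in> \<O>"
        unfolding d(1) using hO M_subset_O[OF wM] by simp
      show "d \<notin> \<M>"
        using hO(2) M_add[OF wM] d(2) by auto
    qed
    then have d0: "d \<noteq> \<zero>" "inv d \<in> \<O>" "v d = 0"
      using unit_mem unit_inv dL by auto
    \<comment> \<open>Division by \<open>d\<close> preserves the Kummer property and turns h = d + w
      into a 1-unit. The constant of case (ii) becomes the product of \<open>c\<close> and
      \<open>d\<close>.\<close>
    define \<eta> where "\<eta> = inv d \<otimes> h"
    have eta: "\<eta> \<in> carrier L" "\<eta> \<notin> K" "\<eta> [^] p \<in> K"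
      unfolding \<eta>_def using kummer_mult[OF K_inv[OF dK d0(1)] _ h] dL d0(1) by auto
    have "\<eta> \<ominus> \<one> = inv d \<otimes> h \<ominus> inv d \<otimes> d"
      using dL d0 by (simp add: \<eta>_def)
    also have "\<dots> = inv d \<otimes> w"
      using inv_props(1)[OF dL d0(1)] h(1) dL unfolding w_def by algebra
    finally have eq: "\<eta> \<ominus> \<one> = inv d \<otimes> w" .
    have "(c \<otimes> d) \<otimes> (\<eta> \<ominus> \<one>) = c \<otimes> w"
      unfolding eq using cL dL d0(1) wL by (simp add: m_assoc m_assoc[symmetric, of d "inv d" w])
    moreover have "c \<otimes> d \<in> K - {\<zero>}"
      using c dK d0 cL dL K_ring(6) by (simp add: integral_iff)
    moreover have "\<eta> \<ominus> \<one> \<in> \<M>"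
      unfolding eq using wM d0(2) by simp
    moreover have "\<eta> \<in> \<O>"
      unfolding \<eta>_def using d0(2) hO by simp
    ultimately show ?thesis
      using that[OF eta] rw by metis
  qed
qed

end

section \<open>The ramification ideal and the derivation with respect to the generator\<close>

text \<open>Both cases of the theorem are of this form: \<open>\<theta> = \<eta>\<close> and \<open>c = 0\<close> in case (i), and
  \<open>\<theta> = c \<eta>\<close> in case (ii).\<close>

locale kummer_monogenic = kummer_inert_extension L v K p
  for L :: "('a, 'm) ring_scheme" (structure) and v :: "'a \<Rightarrow> 'g :: linordered_ab_group_add" and K p +
  fixes \<theta> c x :: 'a
  defines "x \<equiv> \<theta> \<ominus> c"
  assumes theta: "\<theta> \<in> carrier L" "\<theta> \<notin> K" "\<theta> [^] p \<in> K" and c_K: "c \<in> K" and resgen_x: "resgen x"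
begin

lemma xO: "x \<in> \<O>" and xL [simp]: "x \<in> carrier L" and cL [simp]: "c \<in> carrier L"
  and thetaL [simp]: "\<theta> \<in> carrier L" and xK: "x \<notin> K"
  using resgen_O resgen_closed resgen_notin_K resgen_x c_K K_closed theta by auto

lemma theta_eq: "\<theta> = x \<oplus> c"
  using theta(1) cL unfolding x_def by algebra

lemma theta_mult: "b \<in> carrier L \<Longrightarrow> \<theta> \<otimes> b = x \<otimes> b \<oplus> c \<otimes> b"
  using l_distr[OF xL cL, of b] by (simp add: theta_eq[symmetric])

lemma theta0: "\<theta> \<noteq> \<zero>"
  using theta(2) K_ring(2) by auto

lemma Gal_diff:
  assumes "\<sigma> \<in> Gal L K" "\<zeta> \<in> carrier L" "\<sigma> \<theta> = \<zeta> \<otimes> \<theta>"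
  shows "\<sigma> x \<ominus> x = (\<zeta> \<ominus> \<one>) \<otimes> \<theta>"
proof -
  interpret h: ring_hom_cring L L \<sigma>
    by (rule Gal_hom[OF field_axioms assms(1)])
  have "\<sigma> x = \<zeta> \<otimes> \<theta> \<ominus> c"
    using Gal_fix[OF assms(1) c_K] assms(3) by (simp add: x_def minus_eq h.hom_add h.hom_a_inv)
  then show ?thesis
    using assms(2) thetaL cL unfolding x_def by algebra
qed

lemma ex_generating_automorphism:
  obtains \<sigma> \<zeta> where "\<sigma> \<in> Gal L K" "\<zeta> \<in> K" "\<zeta> [^] p = \<one>" "\<zeta> \<noteq> \<one>" "\<sigma> \<theta> = \<zeta> \<otimes> \<theta>"
proof -
  obtain \<sigma> z where s: "\<sigma> \<in> Gal L K" and z: "z \<in> carrier L" "\<sigma> z \<noteq> z"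
    by (rule ex_moved)
  obtain \<zeta> where "\<zeta> \<in> K" "\<zeta> [^] p = \<one>" "\<sigma> \<theta> = \<zeta> \<otimes> \<theta>"
    using Gal_kummer_element[OF s theta(1) theta0 theta(3)] by blast
  moreover have "\<sigma> \<theta> \<noteq> \<theta>"
    using fixed_by_Gal[OF s z theta(1)] theta(2) by blast
  ultimately show ?thesis
    using that s by force
qed

text \<open>\<sigma> fixes the coefficients of b in the powers of y, and \<sigma> y - y divides each
  difference of powers integrally. The generator y is arbitrary because the separability criterion
  uses one other than x.\<close>

lemma Gal_diff_O:
  assumes s: "\<sigma> \<in> Gal L K" and b: "b \<in> \<O>" and y: "resgen y"
  shows "\<sigma> b \<ominus> b \<in> \<P> (\<sigma> y \<ominus> y)"
proof -
  note yO = resgen_O[OF y] and yL = resgen_closed[OF y] and syO = Gal_O_resgen[OF s y]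
  have syL: "\<sigma> y \<in> carrier L"
    using syO O_closed by blast
  obtain a where a: "\<And>i. a i \<in> K" "\<And>i. a i \<in> \<O>" "b = psum L p a y"
    using ex_O_psum[OF y b] by metis
  have aL: "a i \<in> carrier L" for i
    using a K_closed by blast
  have sb: "\<sigma> b = psum L p a (\<sigma> y)"
    using Gal_psum[OF s, of a y p] a yL by metis
  have diff: "psum L n a (\<sigma> y) \<ominus> psum L n a y \<in> \<P> (\<sigma> y \<ominus> y)" for n
  proof (induction n)
    case 0
    then show ?case
      using PIdl_zero syL yL by (simp add: minus_eq)
  next
    case (Suc n)
    obtain w where w: "w \<in> \<O>" "\<sigma> y [^] n \<ominus> y [^] n = w \<otimes> (\<sigma> y \<ominus> y)"
      by (rule pow_minus_pow_dvd[of \<O> "\<sigma> y" y n]) (use syO yO O_closed in auto)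
    have id: "(s \<oplus> k \<otimes> e) \<ominus> (t \<oplus> k \<otimes> f) = (s \<ominus> t) \<oplus> k \<otimes> (e \<ominus> f)"
      if "s \<in> carrier L" "t \<in> carrier L" "k \<in> carrier L" "e \<in> carrier L" "f \<in> carrier L" for s t k e f
      using that by algebra
    have "a n \<otimes> (\<sigma> y [^] n \<ominus> y [^] n) \<in> \<P> (\<sigma> y \<ominus> y)"
      unfolding w(2) using w(1) a(2) syL yL by (intro PIdl_mult PIdl_self) auto
    then show ?case
      using Suc PIdl_add[of "\<sigma> y \<ominus> y"] aL yL syL by (simp add: id)
  qed
  show ?thesis
    using diff[of p] unfolding sb a(3)[symmetric] .
qed

text \<open>Every b is k w with k in K and a unit w, and k cancels in (\<tau> b - b)/b, leaving a
  multiple of \<tau> x - x = (\<zeta>' - 1) \<theta>. All the \<zeta>' - 1 are multiples of \<zeta>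
  - 1. Conversely, b = x contributes the generator divided by x, and x is integral.\<close>

lemma ramification_ideal_eq:
  assumes s: "\<sigma> \<in> Gal L K" and z: "\<zeta> \<in> K" "\<zeta> [^] p = \<one>" "\<zeta> \<noteq> \<one>" "\<sigma> \<theta> = \<zeta> \<otimes> \<theta>"
  shows "ramification_ideal L K v = \<P> (\<sigma> x \<ominus> x)"
proof -
  interpret O: cring "val_Ring L v" by (rule cring_O)
  let ?g = "\<sigma> x \<ominus> x"
  let ?S = "{(\<tau> b \<ominus> b) \<otimes> inv b | \<tau> b. \<tau> \<in> Gal L K \<and> b \<in> carrier L - {\<zero>}}"
  have gO: "?g \<in> \<O>"
    using Gal_O[OF s xO] xO by simp
  have gL: "?g \<in> carrier L"
    using gO O_closed by blast
  have zL: "\<zeta> \<in> carrier L"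
    using z K_closed by blast
  have g: "?g = (\<zeta> \<ominus> \<one>) \<otimes> \<theta>"
    by (rule Gal_diff[OF s zL z(4)])
  have dvd: "\<tau> x \<ominus> x \<in> \<P> ?g" if t: "\<tau> \<in> Gal L K" for \<tau>
  proof -
    obtain \<zeta>' where z': "\<zeta>' \<in> K" "\<zeta>' [^] p = \<one>" "\<tau> \<theta> = \<zeta>' \<otimes> \<theta>"
      using Gal_kummer_element[OF t theta(1) theta0 theta(3)] by blast
    have zL': "\<zeta>' \<in> carrier L"
      using z' K_closed by blast
    obtain r where "r \<in> \<O>" "\<zeta>' \<ominus> \<one> = r \<otimes> (\<zeta> \<ominus> \<one>)"
      using root_of_unity_dvd[OF zL z(2,3) zL' z'(2)] by blast
    then show ?thesis
      unfolding g Gal_diff[OF t zL' z'(3)] PIdl_mem using zL by (auto simp: m_assoc O_closed)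
  qed
  have sub: "?S \<subseteq> \<P> ?g"
  proof
    fix e assume "e \<in> ?S"
    then obtain \<tau> b where t: "\<tau> \<in> Gal L K" and b: "b \<in> carrier L" "b \<noteq> \<zero>" and e: "e = (\<tau> b \<ominus> b) \<otimes> inv b"
      by auto
    interpret h: ring_hom_cring L L \<tau>
      by (rule Gal_hom[OF field_axioms t])
    obtain k where k: "k \<in> K" "k \<noteq> \<zero>" "v k = v b"
      using ex_same_value[OF b] by blast
    have kL: "k \<in> carrier L"
      using k K_closed by blast
    define w where "w = inv k \<otimes> b"
    have w: "w \<in> carrier L" "w \<noteq> \<zero>" "v w = 0" "b = k \<otimes> w"
      using k kL b by (auto simp: w_def v_mult v_inv integral_iff m_assoc[symmetric])
    then have wO: "w \<in> \<O>" "inv w \<in> \<O>"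
      using unit_inv by (auto simp: O_mem)
    have "\<tau> b = k \<otimes> \<tau> w"
      unfolding w(4) using h.hom_mult[OF kL w(1)] Gal_fix[OF t k(1)] by simp
    moreover have "inv b = inv k \<otimes> inv w"
      unfolding w(4) using kL k w by (intro comm_inv_char) (auto simp: m_ac)
    ultimately have "e = (k \<otimes> (\<tau> w) \<ominus> k \<otimes> w) \<otimes> (inv k \<otimes> inv w)"
      using e w(4) by simp
    also have "\<dots> = (k \<otimes> inv k) \<otimes> (inv w \<otimes> (\<tau> w \<ominus> w))"
      using kL inv_props(1)[OF kL k(2)] inv_props(1)[OF w(1,2)] w(1) h.hom_closed[OF w(1)] by algebra
    also have "\<dots> = inv w \<otimes> (\<tau> w \<ominus> w)"
      using kL k(2) w h.hom_closed[OF w(1)] by simp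
    finally have e': "e = inv w \<otimes> (\<tau> w \<ominus> w)" .
    obtain r where r: "r \<in> \<O>" "\<tau> w \<ominus> w = r \<otimes> (\<tau> x \<ominus> x)"
      using Gal_diff_O[OF t wO(1) resgen_x] unfolding PIdl_mem by blast
    show "e \<in> \<P> ?g"
      unfolding e' r(2) using wO(2) r(1) by (intro PIdl_mult[OF gL] dvd[OF t])
  qed
  have PO: "\<P> ?g \<subseteq> \<O>"
    using gO by (auto simp: PIdl_mem)
  show ?thesis
    unfolding ramification_ideal_def
  proof
    show "Idl\<^bsub>val_Ring L v\<^esub> ?S \<subseteq> \<P> ?g"
      by (rule O.genideal_minimal[OF PIdl_ideal[OF gO] sub])
    have "?S \<subseteq> carrier (val_Ring L v)"
      using sub PO by simp
    then have id: "ideal (Idl\<^bsub>val_Ring L v\<^esub> ?S) (val_Ring L v)" and S: "?S \<subseteq> Idl\<^bsub>val_Ring L v\<^esub> ?S"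
      using O.genideal_ideal O.genideal_self by blast+
    have x0: "x \<noteq> \<zero>"
      using xK K_ring(2) by auto
    have "?g = ?g \<otimes> inv x \<otimes> x"
      using gL x0 by (simp add: m_assoc)
    moreover have "?g \<otimes> inv x \<otimes> x \<in> Idl\<^bsub>val_Ring L v\<^esub> ?S"
    proof -
      have "?g \<otimes> inv x \<in> Idl\<^bsub>val_Ring L v\<^esub> ?S"
        using s x0 by (intro subsetD[OF S] CollectI exI[of _ \<sigma>] exI[of _ x]) auto
      then show ?thesis
        using ideal.I_r_closed[OF id, of "?g \<otimes> inv x" x] xO by simp
    qed
    ultimately show "\<P> ?g \<subseteq> Idl\<^bsub>val_Ring L v\<^esub> ?S"
      using O.cgenideal_minimal[OF id] by simp
  qed
qed

text \<open>Requiring zeros from p on makes the whole function unique, so that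
  \<open>coord_unique\<close> yields equalities of functions.\<close>

definition coord :: "'a \<Rightarrow> nat \<Rightarrow> 'a" where
  "coord b = (SOME a. (\<forall>i. a i \<in> K) \<and> (\<forall>i\<ge>p. a i = \<zero>) \<and> b = psum L p a x)"

lemma coord:
  assumes "b \<in> carrier L"
  shows "coord b i \<in> K" "coord b i \<in> carrier L" "i \<ge> p \<Longrightarrow> coord b i = \<zero>" "psum L p (coord b) x = b"
proof -
  obtain a where a: "\<And>i. a i \<in> K" "b = psum L p a x"
    using ex_psum[OF xL xK assms] by metis
  define a' where "a' i = (if i < p then a i else \<zero>)" for i
  have a': "a' i \<in> K" for i
    using a K_ring(2) by (simp add: a'_def)
  have "psum L p a' x = psum L p a x"
    by (rule psum_cong) (use a a' K_closed in \<open>auto simp: a'_def\<close>)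
  then have "\<exists>a. (\<forall>i. a i \<in> K) \<and> (\<forall>i\<ge>p. a i = \<zero>) \<and> b = psum L p a x"
    using a a' by (intro exI[of _ a']) (auto simp: a'_def)
  from someI_ex[OF this] show "coord b i \<in> K" "i \<ge> p \<Longrightarrow> coord b i = \<zero>" "psum L p (coord b) x = b"
    unfolding coord_def by auto
  then show "coord b i \<in> carrier L"
    using K_closed by blast
qed

lemma coord_unique:
  assumes a: "\<And>i. a i \<in> K" "\<And>i. i \<ge> p \<Longrightarrow> a i = \<zero>"
  shows "coord (psum L p a x) = a"
proof
  fix i
  have aL: "a i \<in> carrier L" for i
    using a K_closed by blast
  let ?b = "psum L p a x"
  have bL: "?b \<in> carrier L"
    using aL by simp
  note co = coord[OF bL]
  show "coord ?b i = a i"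
  proof (cases "i < p")
    case True
    have "psum L p (\<lambda>i. coord ?b i \<ominus> a i) x = \<zero>"
      using psum_minus[of "coord ?b" a x p] co(2,4) aL bL by (simp add: r_right_minus_eq)
    then have "coord ?b i \<ominus> a i = \<zero>"
      using True co(1) a(1) K_ring(5,7)
      by (intro psum_eq_zeroD[OF xL xK, where a = "\<lambda>i. coord ?b i \<ominus> a i"]) (auto simp: minus_eq)
    then show ?thesis
      using co(2) aL by (simp add: r_right_minus_eq)
  qed (use co(3) a(2) in auto)
qed

lemma coord_O: "b \<in> \<O> \<Longrightarrow> coord b i \<in> \<O>"
proof -
  assume b: "b \<in> \<O>"
  note co = coord[OF O_closed[OF b]]
  show ?thesis
    using coord_in_O[OF resgen_x, of "coord b" i] co(1,3,4) b by (cases "i < p") auto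
qed

lemma coord_add:
  assumes "a \<in> carrier L" "b \<in> carrier L"
  shows "coord (a \<oplus> b) = (\<lambda>i. coord a i \<oplus> coord b i)"
proof -
  have "psum L p (\<lambda>i. coord a i \<oplus> coord b i) x = a \<oplus> b"
    using psum_add[of "coord a" "coord b" x p] coord[OF assms(1)] coord[OF assms(2)] by simp
  then show ?thesis
    using coord_unique[of "\<lambda>i. coord a i \<oplus> coord b i"] coord[OF assms(1)] coord[OF assms(2)] K_ring(7) by auto
qed

lemma coord_smult:
  assumes "k \<in> K" "b \<in> carrier L"
  shows "coord (k \<otimes> b) = (\<lambda>i. k \<otimes> coord b i)"
proof -
  have "psum L p (\<lambda>i. k \<otimes> coord b i) x = k \<otimes> b"
    using psum_smult[of "coord b" k x p] coord[OF assms(2)] K_closed[OF assms(1)] by simp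
  then show ?thesis
    using coord_unique[of "\<lambda>i. k \<otimes> coord b i"] coord[OF assms(2)] K_ring(6) assms(1) K_closed by auto
qed

lemma coord_pow: "j < p \<Longrightarrow> k \<in> K \<Longrightarrow> coord (k \<otimes> x [^] j) = (\<lambda>i. if i = j then k else \<zero>)"
  using coord_unique[of "\<lambda>i. if i = j then k else \<zero>"] psum_single[of k x p j] K_ring(2) K_closed by auto

text \<open>The formal derivative of the polynomial of degree below \<open>p\<close> that represents \<open>b\<close>. It satisfies the
  product rule only modulo \<open>different\<close>, which is \<open>f' x\<close> for the minimal polynomial \<open>f\<close> of \<open>x\<close>.\<close>

definition D :: "'a \<Rightarrow> 'a" where
  "D b = psum L p (\<lambda>i. [Suc i] \<cdot> \<one> \<otimes> coord b (Suc i)) x"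

lemma D_closed [simp]: "b \<in> carrier L \<Longrightarrow> D b \<in> carrier L"
  unfolding D_def by (rule psum_closed) (auto simp: coord)

lemma D_O: "b \<in> \<O> \<Longrightarrow> D b \<in> \<O>"
  unfolding D_def by (rule psum_in) (use xO coord_O O_closed in \<open>auto simp del: add.nat_pow_Suc\<close>)

lemma D_add: "a \<in> carrier L \<Longrightarrow> b \<in> carrier L \<Longrightarrow> D (a \<oplus> b) = D a \<oplus> D b"
  unfolding D_def coord_add by (subst psum_add[symmetric]) (auto simp: coord r_distr simp del: add.nat_pow_Suc)

lemma D_smult: "k \<in> K \<Longrightarrow> b \<in> carrier L \<Longrightarrow> D (k \<otimes> b) = k \<otimes> D b"
  unfolding D_def coord_smult by (subst psum_smult[symmetric]) (auto simp: coord m_lcomm K_closed simp del: add.nat_pow_Suc)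

lemma D_K: "k \<in> K \<Longrightarrow> D k = \<zero>"
proof -
  assume k: "k \<in> K"
  have "coord k = (\<lambda>i. if i = 0 then k else \<zero>)"
    using coord_pow[of 0 k] k K_closed p_ge_2 by simp
  then have "D k = psum L p (\<lambda>i. if i = 0 then \<zero> else \<zero>) x"
    unfolding D_def by (intro psum_cong) (auto simp del: add.nat_pow_Suc)
  then show ?thesis
    using psum_single[of \<zero> x p 0] by simp
qed

lemma D_x: "D x = \<one>"
proof -
  have "coord x = (\<lambda>i. if i = 1 then \<one> else \<zero>)"
    using coord_pow[of 1 \<one>] K_ring(3) p_ge_2 by simp
  then have "D x = psum L p (\<lambda>i. if i = 0 then \<one> else \<zero>) x"
    unfolding D_def by (intro psum_cong) auto
  then show ?thesis
    using psum_single[of \<one> x p 0] p_ge_2 by simp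
qed

text \<open>If x^p = r(x) with r of degree below p, the minimal polynomial is X^p - r, and r'(x) is
  \<open>D\<close> of x^p.\<close>

definition different :: 'a where
  "different = [p] \<cdot> \<one> \<otimes> x [^] (p - 1) \<ominus> D (x [^] p)"

lemma different_closed [simp]: "different \<in> carrier L"
  by (simp add: different_def)

lemma different_O: "different \<in> \<O>"
  unfolding different_def using xO D_O by simp

text \<open>Multiplication by x shifts the coordinates; the top one spills over into x^p, which lies
  outside the basis.\<close>

lemma x_mult_eq_psum:
  assumes b: "b \<in> carrier L"
  shows "x \<otimes> b = psum L p (\<lambda>i. case i of 0 \<Rightarrow> \<zero> | Suc j \<Rightarrow> if i < p then coord b j else \<zero>) x \<oplus> coord b (p - 1) \<otimes> x [^] p"
proof -
  note co = coord[OF b]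
  let ?s = "\<lambda>i. case i of 0 \<Rightarrow> \<zero> | Suc j \<Rightarrow> coord b j"
  have s: "?s i \<in> carrier L" for i
    using co by (auto split: nat.split)
  have "x \<otimes> b = psum L (Suc p) ?s x"
    using psum_split_0[of ?s x p] s co(4) b by simp
  also have "\<dots> = psum L p ?s x \<oplus> coord b (p - 1) \<otimes> x [^] p"
    using psum_Suc[of ?s x p] s p_ge_2 by (cases p) auto
  also have "psum L p ?s x = psum L p (\<lambda>i. case i of 0 \<Rightarrow> \<zero> | Suc j \<Rightarrow> if i < p then coord b j else \<zero>) x"
    by (rule psum_cong) (use co in \<open>auto split: nat.split\<close>)
  finally show ?thesis .
qed

text \<open>The product rule is exact for formal polynomials. The error arises from the spilled
  term: its formal derivative contains p x^(p-1), while \<open>D\<close> sees the reduced form of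
  x^p.\<close>

lemma D_x_mult:
  assumes b: "b \<in> carrier L"
  shows "D (x \<otimes> b) = x \<otimes> D b \<oplus> b \<ominus> coord b (p - 1) \<otimes> different"
proof -
  note co = coord[OF b]
  let ?s = "\<lambda>i. case i of 0 \<Rightarrow> \<zero> | Suc j \<Rightarrow> if i < p then coord b j else \<zero>"
  have s: "?s i \<in> K" "?s i \<in> carrier L" for i
    using co K_ring(2) by (auto split: nat.split)
  have ps: "psum L p ?s x \<in> carrier L"
    using s by simp
  have cs: "coord (psum L p ?s x) = ?s"
    by (rule coord_unique) (use s in \<open>auto split: nat.split\<close>)
  \<comment> \<open>\<open>?q\<close> are the coefficients of x times D b, and \<open>?r\<close>
    those of x D b + b, the formal derivative of X b(X).\<close>
  let ?q = "\<lambda>i. [i] \<cdot> \<one> \<otimes> coord b i"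
  let ?r = "\<lambda>i. [Suc i] \<cdot> \<one> \<otimes> coord b i"
  have q: "?q i \<in> carrier L" and r: "?r i \<in> carrier L" for i
    using co by auto
  define n where "n = p - 1"
  have n: "p = Suc n" and pn: "p - 1 = n"
    using p_ge_2 by (auto simp: n_def)
  have "x \<otimes> D b = psum L (Suc p) ?q x"
    unfolding D_def using psum_split_0[of ?q x p] q co by simp
  also have "\<dots> = psum L p ?q x"
    using psum_Suc[of ?q x p] q co by simp
  finally have "x \<otimes> D b \<oplus> b = psum L p ?r x"
    using psum_add[of ?q "coord b" x p] q co by (simp add: l_distr)
  also have "\<dots> = psum L n ?r x \<oplus> [p] \<cdot> \<one> \<otimes> coord b n \<otimes> x [^] n"
    using psum_Suc[of ?r x n, OF r xL] unfolding n[symmetric] .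
  finally have 1: "x \<otimes> D b \<oplus> b = psum L n ?r x \<oplus> [p] \<cdot> \<one> \<otimes> coord b n \<otimes> x [^] n" .
  have "D (psum L p ?s x) = psum L p (\<lambda>i. if i < n then ?r i else \<zero>) x"
    unfolding D_def cs by (rule psum_cong) (use co n in \<open>auto simp del: add.nat_pow_Suc\<close>)
  also have "\<dots> = psum L n (\<lambda>i. if i < n then ?r i else \<zero>) x"
    by (rule psum_extend) (use r n in auto)
  also have "\<dots> = psum L n ?r x"
    by (rule psum_cong) (use r in auto)
  finally have 2: "D (psum L p ?s x) = psum L n ?r x" .
  have "D (x \<otimes> b) = psum L n ?r x \<oplus> coord b n \<otimes> D (x [^] p)"
    unfolding x_mult_eq_psum[OF b] pn using ps co by (simp add: D_add D_smult 2)
  also have "\<dots> = (psum L n ?r x \<oplus> [p] \<cdot> \<one> \<otimes> coord b n \<otimes> x [^] n) \<ominus> coord b n \<otimes> different"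
  proof -
    have "s \<oplus> k \<otimes> e = (s \<oplus> q \<otimes> k \<otimes> y) \<ominus> k \<otimes> (q \<otimes> y \<ominus> e)"
      if "s \<in> carrier L" "k \<in> carrier L" "e \<in> carrier L" "q \<in> carrier L" "y \<in> carrier L" for s k e q y
      using that by (simp add: ring_cancel)
    then show ?thesis
      unfolding different_def pn using r co by (simp del: psum_Suc)
  qed
  finally show ?thesis
    unfolding 1 pn .
qed

text \<open>Below exponent p no power of x spills over, so the product rule stays exact and powers
  of \<theta> = x + c are monic in x. The factor \<theta> avoids the exponent i - 1.\<close>

lemma coord_theta_pow:
  "i < p \<Longrightarrow> (\<forall>j>i. coord (\<theta> [^] i) j = \<zero>) \<and> coord (\<theta> [^] i) i = \<one> \<and> \<theta> \<otimes> D (\<theta> [^] i) = [i] \<cdot> \<one> \<otimes> \<theta> [^] i"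
proof (induction i)
  case 0
  have "coord \<one> = (\<lambda>i. if i = 0 then \<one> else \<zero>)"
    using coord_pow[of 0 \<one>] K_ring(3) p_ge_2 by simp
  then show ?case
    using D_K[OF K_ring(3)] by simp
next
  case (Suc i)
  let ?b = "\<theta> [^] i"
  have b: "?b \<in> carrier L"
    by simp
  note co = coord[OF b]
  have IH: "\<And>j. j > i \<Longrightarrow> coord ?b j = \<zero>" "coord ?b i = \<one>" "\<theta> \<otimes> D ?b = [i] \<cdot> \<one> \<otimes> ?b"
    using Suc by auto
  have top: "coord ?b (p - 1) = \<zero>"
    using Suc(2) IH(1) by simp
  let ?s = "\<lambda>i. case i of 0 \<Rightarrow> \<zero> | Suc j \<Rightarrow> if i < p then coord ?b j else \<zero>"
  have s: "?s i \<in> K" "?s i \<in> carrier L" for i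
    using co K_ring(2) by (auto split: nat.split)
  have "x \<otimes> ?b = psum L p ?s x"
    using x_mult_eq_psum[OF b] top s by simp
  then have cx: "coord (x \<otimes> ?b) = ?s"
    using coord_unique[of ?s] s by (auto split: nat.split)
  have th: "\<theta> [^] Suc i = x \<otimes> ?b \<oplus> c \<otimes> ?b"
    using theta_mult[OF b] by (simp add: m_comm)
  have cth: "coord (\<theta> [^] Suc i) = (\<lambda>j. ?s j \<oplus> c \<otimes> coord ?b j)"
    unfolding th using coord_add[of "x \<otimes> ?b" "c \<otimes> ?b"] coord_smult[OF c_K b] cx by simp
  have "D (\<theta> [^] Suc i) = x \<otimes> D ?b \<oplus> ?b \<oplus> c \<otimes> D ?b"
    unfolding th using D_x_mult[OF b] top by (simp add: D_add D_smult c_K minus_eq)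
  also have "\<dots> = \<theta> \<otimes> D ?b \<oplus> ?b"
    using theta_mult[OF D_closed[OF b]] by (simp add: a_ac)
  also have "\<dots> = [Suc i] \<cdot> \<one> \<otimes> ?b"
    unfolding IH(3) by (simp add: l_distr)
  finally have "\<theta> \<otimes> D (\<theta> [^] Suc i) = [Suc i] \<cdot> \<one> \<otimes> \<theta> [^] Suc i"
    by (simp add: m_ac del: add.nat_pow_Suc)
  moreover have "coord (\<theta> [^] Suc i) j = \<zero>" if "j > Suc i" for j
    unfolding cth using that IH(1) by (cases j) auto
  moreover have "coord (\<theta> [^] Suc i) (Suc i) = \<one>"
    unfolding cth using IH Suc(2) by simp
  ultimately show ?case
    by blast
qed

text \<open>Since \<theta>^p lies in K, \<open>D\<close> kills it. Computed as \<theta> times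
  \<theta>^(p-1), whose top coordinate is 1, the same derivative is p \<theta>^(p-1) minus
  \<open>different\<close>.\<close>

lemma different_eq: "different = [p] \<cdot> \<one> \<otimes> \<theta> [^] (p - 1)"
proof -
  let ?b = "\<theta> [^] (p - 1)"
  have b: "?b \<in> carrier L"
    by simp
  have co: "coord ?b (p - 1) = \<one>" "\<theta> \<otimes> D ?b = [(p - 1)] \<cdot> \<one> \<otimes> ?b"
    using coord_theta_pow[of "p - 1"] p_ge_2 by auto
  have th: "\<theta> [^] p = x \<otimes> ?b \<oplus> c \<otimes> ?b"
    using theta_mult[OF b] nat_pow_Suc2[of \<theta> "p - 1"] p_ge_2 by simp
  have "\<zero> = x \<otimes> D ?b \<oplus> ?b \<ominus> different \<oplus> c \<otimes> D ?b"
    using D_K[OF theta(3)] D_x_mult[OF b] co(1) unfolding th by (simp add: D_add D_smult c_K)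
  also have "\<dots> = \<theta> \<otimes> D ?b \<oplus> ?b \<ominus> different"
    using theta_mult[OF D_closed[OF b]] by (simp add: minus_eq a_ac)
  also have "\<theta> \<otimes> D ?b \<oplus> ?b = [Suc (p - 1)] \<cdot> \<one> \<otimes> ?b"
    unfolding co(2) by (simp add: l_distr)
  finally have "[p] \<cdot> \<one> \<otimes> ?b \<ominus> different = \<zero>"
    using p_ge_2 by simp
  then show ?thesis
    by (simp add: r_right_minus_eq)
qed

text \<open>Induction over the generation of the valuation ring by x and the integral elements of K:
  the rule is exact for the latter, and \<open>D_x_mult\<close> gives the error for x.\<close>

lemma D_mult:
  assumes "a \<in> \<O>" "b \<in> \<O>"
  shows "D (a \<otimes> b) \<ominus> (a \<otimes> D b \<oplus> b \<otimes> D a) \<in> \<P> different"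
proof -
  let ?P = "\<P> different"
  have Pcl: "t \<in> ?P \<Longrightarrow> t \<in> carrier L" for t
    by (auto simp: PIdl_mem O_closed)
  have "a \<in> generate_ring L (val_ring L v K \<union> {x})"
    using assms(1) resgen_generate_ring[OF resgen_x] by simp
  \<comment> \<open>The claim ranges over all b because the case of a product a1 a2 uses it for a1
    with the factors a2 b and a2.\<close>
  then have "a \<in> \<O> \<and> (\<forall>b\<in>\<O>. D (a \<otimes> b) \<ominus> (a \<otimes> D b \<oplus> b \<otimes> D a) \<in> ?P)"
  proof induction
    case one
    then show ?case
      using PIdl_zero[of different] D_K[OF K_ring(3)] by (auto simp: O_closed minus_eq r_neg)
  next
    case (incl a)
    then consider "a \<in> K" "a \<in> \<O>" | "a = x"
      by (auto simp: val_ring_K)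
    then show ?case
    proof cases
      case 1
      then show ?thesis
        using PIdl_zero[of different] D_K by (auto simp: O_closed D_smult minus_eq r_neg)
    next
      case 2
      have "D (x \<otimes> b) \<ominus> (x \<otimes> D b \<oplus> b \<otimes> D x) \<in> ?P" if b: "b \<in> \<O>" for b
      proof -
        have bL: "b \<in> carrier L"
          using b O_closed by blast
        have "D (x \<otimes> b) \<ominus> (x \<otimes> D b \<oplus> b \<otimes> D x) = \<ominus> coord b (p - 1) \<otimes> different"
        proof -
          have "(q \<oplus> e \<ominus> k \<otimes> f) \<ominus> (q \<oplus> e) = \<ominus> k \<otimes> f" 
            if "q \<in> carrier L" "e \<in> carrier L" "k \<in> carrier L" "f \<in> carrier L" for q e k f
            using that by (simp add: ring_cancel)
          then show ?thesis
            unfolding D_x_mult[OF bL] D_x using bL coord by simp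
        qed
        then show ?thesis
          using coord_O[OF b, of "p - 1"] unfolding PIdl_mem by auto
      qed
      then show ?thesis
        using 2 xO by blast
    qed
  next
    case (a_inv a)
    have "D (\<ominus> a \<otimes> b) \<ominus> (\<ominus> a \<otimes> D b \<oplus> b \<otimes> D (\<ominus> a)) \<in> ?P" if b: "b \<in> \<O>" for b
    proof -
      have L: "a \<in> carrier L" "b \<in> carrier L"
        using a_inv b O_closed by auto
      have m1: "\<ominus> \<one> \<in> K"
        using K_ring(3,5) by blast
      have "D (\<ominus> a \<otimes> b) \<ominus> (\<ominus> a \<otimes> D b \<oplus> b \<otimes> D (\<ominus> a)) = \<ominus> \<one> \<otimes> (D (a \<otimes> b) \<ominus> (a \<otimes> D b \<oplus> b \<otimes> D a))"
      proof -
        have "D (\<ominus> a) = \<ominus> D a"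
          using D_smult[OF m1 L(1)] L by (simp add: l_minus)
        moreover have "D (\<ominus> a \<otimes> b) = \<ominus> D (a \<otimes> b)"
          using D_smult[OF m1, of "a \<otimes> b"] L by (simp add: l_minus)
        moreover have "\<ominus> e \<ominus> (\<ominus> a \<otimes> f \<oplus> b \<otimes> \<ominus> g) = \<ominus> \<one> \<otimes> (e \<ominus> (a \<otimes> f \<oplus> b \<otimes> g))"
          if "e \<in> carrier L" "f \<in> carrier L" "g \<in> carrier L" for e f g
          using that L by algebra
        ultimately show ?thesis
          using L by simp
      qed
      then show ?thesis
        using a_inv b by (simp add: PIdl_mult)
    qed
    then show ?case
      using a_inv by simp
  next
    case (eng_add a1 a2)
    have "D ((a1 \<oplus> a2) \<otimes> b) \<ominus> ((a1 \<oplus> a2) \<otimes> D b \<oplus> b \<otimes> D (a1 \<oplus> a2)) \<in> ?P" if b: "b \<in> \<O>" for b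
    proof -
      have L: "a1 \<in> carrier L" "a2 \<in> carrier L" "b \<in> carrier L"
        using eng_add b O_closed by auto
      have "(e1 \<oplus> e2) \<ominus> ((a1 \<oplus> a2) \<otimes> f \<oplus> b \<otimes> (g1 \<oplus> g2)) = (e1 \<ominus> (a1 \<otimes> f \<oplus> b \<otimes> g1)) \<oplus> (e2 \<ominus> (a2 \<otimes> f \<oplus> b \<otimes> g2))"
        if "e1 \<in> carrier L" "e2 \<in> carrier L" "f \<in> carrier L" "g1 \<in> carrier L" "g2 \<in> carrier L" for e1 e2 f g1 g2
        using that L by algebra
      then have "D ((a1 \<oplus> a2) \<otimes> b) \<ominus> ((a1 \<oplus> a2) \<otimes> D b \<oplus> b \<otimes> D (a1 \<oplus> a2))
        = (D (a1 \<otimes> b) \<ominus> (a1 \<otimes> D b \<oplus> b \<otimes> D a1)) \<oplus> (D (a2 \<otimes> b) \<ominus> (a2 \<otimes> D b \<oplus> b \<otimes> D a2))"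
        using L by (simp add: D_add l_distr)
      then show ?thesis
        using eng_add b by (simp only:) (intro PIdl_add; simp)
    qed
    then show ?case
      using eng_add by simp
  next
    case (eng_mult a1 a2)
    have "D ((a1 \<otimes> a2) \<otimes> b) \<ominus> ((a1 \<otimes> a2) \<otimes> D b \<oplus> b \<otimes> D (a1 \<otimes> a2)) \<in> ?P" if b: "b \<in> \<O>" for b
    proof -
      have L: "a1 \<in> carrier L" "a2 \<in> carrier L" "b \<in> carrier L"
        using eng_mult b O_closed by auto
      \<comment> \<open>In the combination t1 + a1 t2 - b t3 the terms with D (a2 b), D a1 and D a2
        cancel, leaving the defect for a1 a2 and b.\<close>
      let ?t1 = "D (a1 \<otimes> (a2 \<otimes> b)) \<ominus> (a1 \<otimes> D (a2 \<otimes> b) \<oplus> (a2 \<otimes> b) \<otimes> D a1)"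
      let ?t2 = "D (a2 \<otimes> b) \<ominus> (a2 \<otimes> D b \<oplus> b \<otimes> D a2)"
      let ?t3 = "D (a1 \<otimes> a2) \<ominus> (a1 \<otimes> D a2 \<oplus> a2 \<otimes> D a1)"
      have "?t1 \<in> ?P" "?t2 \<in> ?P" "?t3 \<in> ?P"
        using eng_mult b by auto
      then have "?t1 \<oplus> (a1 \<otimes> ?t2 \<oplus> \<ominus> b \<otimes> ?t3) \<in> ?P"
        using eng_mult b by (intro PIdl_add PIdl_mult) auto
      moreover have "(e \<ominus> (a1 \<otimes> f \<oplus> (a2 \<otimes> b) \<otimes> d1)) \<oplus> (a1 \<otimes> (f \<ominus> (a2 \<otimes> db \<oplus> b \<otimes> d2)) \<oplus> \<ominus> b \<otimes> (g \<ominus> (a1 \<otimes> d2 \<oplus> a2 \<otimes> d1)))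
        = e \<ominus> ((a1 \<otimes> a2) \<otimes> db \<oplus> b \<otimes> g)"
        if "e \<in> carrier L" "f \<in> carrier L" "g \<in> carrier L" "d1 \<in> carrier L" "d2 \<in> carrier L" "db \<in> carrier L" for e f g d1 d2 db
        using that L by (simp add: ring_cancel)
      ultimately show ?thesis
        using L by (simp add: m_assoc)
    qed
    then show ?case
      using eng_mult by simp
  qed
  then show ?thesis
    using assms(2) by blast
qed

end

section \<open>Quotient modules and Kaehler differentials\<close>

lemma (in abelian_group) minus_eq_zero_iff:
  assumes "x \<in> carrier G" "y \<in> carrier G"
  shows "x \<ominus> y = \<zero> \<longleftrightarrow> x = y"
  using minus_equality[of x "\<ominus> y"] assms by (auto simp: a_minus_def r_neg)

locale module_with_submodule = module R M for R (structure) and M (structure) +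
  fixes N assumes submodule_N: "submodule N R M"
begin

lemmas N = submoduleE[OF submodule_N]

lemma abelian_subgroup_N: "abelian_subgroup N M"
  using submodule_N by (intro abelian_subgroupI3 additive_subgroupI M.abelian_group_axioms) (simp add: submodule_def)

lemma N_zero: "\<zero>\<^bsub>M\<^esub> \<in> N"
  using abelian_subgroup.axioms(1)[OF abelian_subgroup_N] additive_subgroup.zero_closed by blast

lemma coset_eq_iff:
  assumes "x \<in> carrier M" "y \<in> carrier M"
  shows "N +>\<^bsub>M\<^esub> x = N +>\<^bsub>M\<^esub> y \<longleftrightarrow> x \<ominus>\<^bsub>M\<^esub> y \<in> N"
proof -
  interpret S: abelian_subgroup N M by (rule abelian_subgroup_N)
  have "N +>\<^bsub>M\<^esub> x = N +>\<^bsub>M\<^esub> y \<longleftrightarrow> x \<in> N +>\<^bsub>M\<^esub> y"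
    using M.a_repr_independence[OF _ assms(2) S.a_subgroup] S.a_rcos_self[OF assms(1)] by blast
  also have "\<dots> \<longleftrightarrow> x \<ominus>\<^bsub>M\<^esub> y \<in> N"
    using S.a_rcos_module[OF assms(2,1)] by (simp add: a_minus_def)
  finally show ?thesis .
qed

lemma coset_mem_iff: "x \<in> carrier M \<Longrightarrow> y \<in> N +>\<^bsub>M\<^esub> x \<longleftrightarrow> y \<in> carrier M \<and> y \<ominus>\<^bsub>M\<^esub> x \<in> N"
proof -
  assume x: "x \<in> carrier M"
  interpret S: abelian_subgroup N M by (rule abelian_subgroup_N)
  show ?thesis
    using S.a_rcos_module[OF x, of y] M.a_r_coset_subset_G[OF S.a_subset x] by (auto simp: a_minus_def)
qed

lemma quotient_carrier: "carrier (quotient_module M N) = (\<lambda>x. N +>\<^bsub>M\<^esub> x) ` carrier M"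
  by (auto simp: quotient_module_def A_RCOSETS_def')

lemma quotient_zero: "\<zero>\<^bsub>quotient_module M N\<^esub> = N +>\<^bsub>M\<^esub> \<zero>\<^bsub>M\<^esub>"
  using abelian_subgroup.a_rcos_const[OF abelian_subgroup_N N_zero] by (simp add: quotient_module_def)

lemma coset_eq_zero_iff: "x \<in> carrier M \<Longrightarrow> N +>\<^bsub>M\<^esub> x = \<zero>\<^bsub>quotient_module M N\<^esub> \<longleftrightarrow> x \<in> N"
proof -
  assume x: "x \<in> carrier M"
  have "x \<ominus>\<^bsub>M\<^esub> \<zero>\<^bsub>M\<^esub> = x"
    using x M.minus_equality[of "\<zero>\<^bsub>M\<^esub>" "\<zero>\<^bsub>M\<^esub>"] by (simp add: a_minus_def)
  then show ?thesis
    using coset_eq_iff[of x "\<zero>\<^bsub>M\<^esub>"] x by (simp add: quotient_zero)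
qed

lemma quotient_add:
  "x \<in> carrier M \<Longrightarrow> y \<in> carrier M \<Longrightarrow>
     (N +>\<^bsub>M\<^esub> x) \<oplus>\<^bsub>quotient_module M N\<^esub> (N +>\<^bsub>M\<^esub> y) = N +>\<^bsub>M\<^esub> (x \<oplus>\<^bsub>M\<^esub> y)"
  using abelian_subgroup.a_rcos_sum[OF abelian_subgroup_N] by (simp add: quotient_module_def)

lemma smult_minus: "r \<in> carrier R \<Longrightarrow> x \<in> carrier M \<Longrightarrow> y \<in> carrier M \<Longrightarrow>
    r \<odot>\<^bsub>M\<^esub> (x \<ominus>\<^bsub>M\<^esub> y) = r \<odot>\<^bsub>M\<^esub> x \<ominus>\<^bsub>M\<^esub> r \<odot>\<^bsub>M\<^esub> y"
  by (simp add: a_minus_def smult_r_distr smult_r_minus)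

lemma quotient_smult:
  assumes "r \<in> carrier R" "x \<in> carrier M"
  shows "r \<odot>\<^bsub>quotient_module M N\<^esub> (N +>\<^bsub>M\<^esub> x) = N +>\<^bsub>M\<^esub> (r \<odot>\<^bsub>M\<^esub> x)"
proof -
  have "N +>\<^bsub>M\<^esub> (r \<odot>\<^bsub>M\<^esub> y) = N +>\<^bsub>M\<^esub> (r \<odot>\<^bsub>M\<^esub> x)" if "y \<in> N +>\<^bsub>M\<^esub> x" for y
  proof -
    have y: "y \<in> carrier M" "y \<ominus>\<^bsub>M\<^esub> x \<in> N"
      using that assms by (auto simp: coset_mem_iff)
    then have "r \<odot>\<^bsub>M\<^esub> y \<ominus>\<^bsub>M\<^esub> r \<odot>\<^bsub>M\<^esub> x \<in> N"
      using N(4)[OF assms(1) y(2)] smult_minus[OF assms(1) y(1) assms(2)] by simp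
    then show ?thesis
      using y assms by (simp add: coset_eq_iff)
  qed
  moreover have "x \<in> N +>\<^bsub>M\<^esub> x"
    using abelian_subgroup.a_rcos_self[OF abelian_subgroup_N] assms by blast
  ultimately have "(\<Union>y\<in>N +>\<^bsub>M\<^esub> x. N +>\<^bsub>M\<^esub> (r \<odot>\<^bsub>M\<^esub> y)) = N +>\<^bsub>M\<^esub> (r \<odot>\<^bsub>M\<^esub> x)"
    by (intro UN_constant_eq) blast+
  then show ?thesis
    by (simp add: quotient_module_def)
qed

lemma quotient_is_module: "module R (quotient_module M N)"
proof (rule moduleI)
  let ?Q = "quotient_module M N"
  note q = quotient_carrier quotient_zero quotient_add quotient_smult
  show "cring R"
    by (rule R.is_cring)
  show "abelian_group ?Q"
  proof (rule abelian_groupI)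
    fix x assume "x \<in> carrier ?Q"
    then obtain a where "a \<in> carrier M" "x = N +>\<^bsub>M\<^esub> a"
      by (auto simp: q)
    then show "\<exists>y\<in>carrier ?Q. y \<oplus>\<^bsub>?Q\<^esub> x = \<zero>\<^bsub>?Q\<^esub>"
      by (intro bexI[of _ "N +>\<^bsub>M\<^esub> (\<ominus>\<^bsub>M\<^esub> a)"]) (auto simp: q M.l_neg)
  qed (auto simp: q M.a_assoc M.a_comm M.a_lcomm)
qed (auto simp: quotient_carrier quotient_zero quotient_add quotient_smult smult_l_distr smult_r_distr smult_assoc1)

end

text \<open>The first isomorphism theorem, stated for the map before it passes to the
  quotient.\<close>

lemma module_isomorphic_quotientI:
  assumes M: "module R M" and Q: "module R Q" and N: "submodule N R M"
    and cl: "\<And>x. x \<in> carrier M \<Longrightarrow> \<phi> x \<in> carrier Q"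
    and add: "\<And>x y. x \<in> carrier M \<Longrightarrow> y \<in> carrier M \<Longrightarrow> \<phi> (x \<oplus>\<^bsub>M\<^esub> y) = \<phi> x \<oplus>\<^bsub>Q\<^esub> \<phi> y"
    and smult: "\<And>r x. r \<in> carrier R \<Longrightarrow> x \<in> carrier M \<Longrightarrow> \<phi> (r \<odot>\<^bsub>M\<^esub> x) = r \<odot>\<^bsub>Q\<^esub> \<phi> x"
    and surj: "\<And>y. y \<in> carrier Q \<Longrightarrow> \<exists>x\<in>carrier M. y = \<phi> x"
    and ker: "\<And>x. x \<in> carrier M \<Longrightarrow> \<phi> x = \<zero>\<^bsub>Q\<^esub> \<longleftrightarrow> x \<in> N"
  shows "module_isomorphic R (quotient_module M N) Q"
proof -
  interpret M: module R M by fact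
  interpret Q: module R Q by fact
  interpret MN: module_with_submodule R M N
    by (intro module_with_submodule.intro M module_with_submodule_axioms.intro N)
  \<comment> \<open>A representative is chosen arbitrarily; \<open>eq_iff\<close> below shows that
    the value does not depend on it and that the map is injective.\<close>
  define h where "h C = \<phi> (SOME x. x \<in> carrier M \<and> C = N +>\<^bsub>M\<^esub> x)" for C
  have neg: "\<phi> (\<ominus>\<^bsub>M\<^esub> y) = \<ominus>\<^bsub>Q\<^esub> \<phi> y" if "y \<in> carrier M" for y
  proof -
    have "\<phi> (\<ominus>\<^bsub>M\<^esub> y) \<oplus>\<^bsub>Q\<^esub> \<phi> y = \<phi> \<zero>\<^bsub>M\<^esub>"
      using add[of "\<ominus>\<^bsub>M\<^esub> y" y] that by (simp add: M.M.l_neg)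
    also have "\<dots> = \<zero>\<^bsub>Q\<^esub>"
      using ker[of "\<zero>\<^bsub>M\<^esub>"] MN.N_zero by simp
    finally show ?thesis
      using that cl Q.M.minus_equality[of "\<phi> (\<ominus>\<^bsub>M\<^esub> y)" "\<phi> y"] by simp
  qed
  have eq_iff: "\<phi> x = \<phi> y \<longleftrightarrow> N +>\<^bsub>M\<^esub> x = N +>\<^bsub>M\<^esub> y" if "x \<in> carrier M" "y \<in> carrier M" for x y
  proof -
    have "\<phi> (x \<ominus>\<^bsub>M\<^esub> y) = \<phi> x \<ominus>\<^bsub>Q\<^esub> \<phi> y"
      using that by (simp add: a_minus_def add neg)
    then show ?thesis
      using that ker[of "x \<ominus>\<^bsub>M\<^esub> y"] cl MN.coset_eq_iff Q.M.minus_eq_zero_iff by simp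
  qed
  have h: "h (N +>\<^bsub>M\<^esub> x) = \<phi> x" if "x \<in> carrier M" for x
  proof -
    have "\<exists>y. y \<in> carrier M \<and> N +>\<^bsub>M\<^esub> x = N +>\<^bsub>M\<^esub> y"
      using that by blast
    from someI_ex[OF this] show ?thesis
      unfolding h_def using eq_iff that by blast
  qed
  note q = MN.quotient_carrier MN.quotient_add MN.quotient_smult
  have "bij_betw h (carrier (quotient_module M N)) (carrier Q)"
    unfolding bij_betw_def inj_on_def q using h eq_iff cl surj by (auto simp: image_iff)
  then show ?thesis
    unfolding module_isomorphic_def using h add smult
    by (intro exI[of _ h]) (auto simp: q)
qed

lemma module_isomorphic_sym:
  assumes "module R M" and "module_isomorphic R M N"
  shows "module_isomorphic R N M"
proof -
  interpret module R M by fact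
  obtain h where h: "bij_betw h (carrier M) (carrier N)"
    "\<And>x y. x \<in> carrier M \<Longrightarrow> y \<in> carrier M \<Longrightarrow> h (x \<oplus>\<^bsub>M\<^esub> y) = h x \<oplus>\<^bsub>N\<^esub> h y"
    "\<And>r x. r \<in> carrier R \<Longrightarrow> x \<in> carrier M \<Longrightarrow> h (r \<odot>\<^bsub>M\<^esub> x) = r \<odot>\<^bsub>N\<^esub> h x"
    using assms(2) unfolding module_isomorphic_def by blast
  let ?g = "inv_into (carrier M) h"
  have inj: "inj_on h (carrier M)" and img: "h ` carrier M = carrier N"
    using h(1) by (auto simp: bij_betw_def)
  have g: "?g (h x) = x" if "x \<in> carrier M" for x
    using inj that by simp
  show ?thesis
    unfolding module_isomorphic_def
  proof (intro exI[of _ ?g] conjI ballI)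
    show "bij_betw ?g (carrier N) (carrier M)"
      by (rule bij_betw_inv_into[OF h(1)])
  next
    fix x y assume "x \<in> carrier N" "y \<in> carrier N"
    then obtain a b where ab: "a \<in> carrier M" "b \<in> carrier M" "x = h a" "y = h b"
      unfolding img[symmetric] by blast
    then have "x \<oplus>\<^bsub>N\<^esub> y = h (a \<oplus>\<^bsub>M\<^esub> b)"
      using h(2) by simp
    then show "?g (x \<oplus>\<^bsub>N\<^esub> y) = ?g x \<oplus>\<^bsub>M\<^esub> ?g y"
      using ab g by simp
  next
    fix r y assume r: "r \<in> carrier R" and "y \<in> carrier N"
    then obtain b where ab: "b \<in> carrier M" "y = h b"
      unfolding img[symmetric] by blast
    then have "r \<odot>\<^bsub>N\<^esub> y = h (r \<odot>\<^bsub>M\<^esub> b)"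
      using h(3) r by simp
    then show "?g (r \<odot>\<^bsub>N\<^esub> y) = r \<odot>\<^bsub>M\<^esub> ?g y"
      using ab g r by simp
  qed
qed

lemma module_isomorphic_zero_module:
  assumes "module R M" "module R N" "module_isomorphic R M N"
  shows "zero_module M \<longleftrightarrow> zero_module N"
proof -
  interpret M: module R M by fact
  interpret N: module R N by fact
  have z: "\<zero>\<^bsub>M\<^esub> \<in> carrier M" "\<zero>\<^bsub>N\<^esub> \<in> carrier N"
    by simp_all
  obtain h where "bij_betw h (carrier M) (carrier N)"
    using assms(3) unfolding module_isomorphic_def by blast
  then have "card (carrier M) = card (carrier N)"
    by (rule bij_betw_same_card)
  \<comment> \<open>A module is zero iff its carrier has one element, a property that any bijection
    transports.\<close>
  moreover have "A = {a} \<longleftrightarrow> card A = 1" if "a \<in> A" for A :: "'x set" and a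
    using that by (auto simp: card_1_singleton_iff)
  from this[OF z(1)] this[OF z(2)] 
  have "zero_module M \<longleftrightarrow> card (carrier M) = 1" "zero_module N \<longleftrightarrow> card (carrier N) = 1"
    by (auto simp: zero_module_def)
  ultimately show ?thesis
    by simp
qed

context cring
begin

lemma regular_is_module: "module R (regular_module R)"
  by (rule moduleI, rule is_cring, rule abelian_groupI)
    (use l_neg in \<open>auto simp: regular_module_def a_assoc a_comm a_lcomm l_distr r_distr m_assoc\<close>)

lemma regular_minus: 
  assumes "y \<in> carrier R" shows "\<ominus>\<^bsub>regular_module R\<^esub> y = \<ominus> y"
proof -
  interpret M: module R "regular_module R" by (rule regular_is_module)
  show ?thesis
    by (rule M.M.minus_equality) (use assms in \<open>auto simp: regular_module_def l_neg\<close>)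
qed

lemma ideal_is_submodule:
  assumes "ideal I R"
  shows "submodule I R (regular_module R)"
proof -
  interpret M: module R "regular_module R" by (rule regular_is_module)
  interpret I: ideal I R by fact
  show ?thesis
    by (rule M.submoduleI)
      (use I.a_subset I.zero_closed I.a_closed I.a_inv_closed I.I_l_closed regular_minus
        in \<open>auto simp: regular_module_def\<close>)
qed

lemma ideal_submodule_of_ideal:
  assumes "ideal I R" "ideal J R" "J \<subseteq> I"
  shows "module R (regular_module R\<lparr>carrier := I\<rparr>)" "submodule J R (regular_module R\<lparr>carrier := I\<rparr>)"
proof -
  show I: "module R (regular_module R\<lparr>carrier := I\<rparr>)"
    by (rule submodule.submodule_is_module[OF ideal_is_submodule[OF assms(1)] regular_is_module])
  interpret M: module R "regular_module R\<lparr>carrier := I\<rparr>" by (rule I)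
  have "module R (regular_module R\<lparr>carrier := J\<rparr>)"
    by (rule submodule.submodule_is_module[OF ideal_is_submodule[OF assms(2)] regular_is_module])
  then show "submodule J R (regular_module R\<lparr>carrier := I\<rparr>)"
    using assms(3) by (intro M.module_incl_imp_submodule) auto
qed

lemma zero_module_quotient_iff:
  assumes "ideal I R"
  shows "zero_module (quotient_module (regular_module R) I) \<longleftrightarrow> I = carrier R"
proof -
  interpret MN: module_with_submodule R "regular_module R" I
    by (intro module_with_submodule.intro regular_is_module module_with_submodule_axioms.intro ideal_is_submodule assms)
  interpret I: ideal I R by fact
  have car: "carrier (regular_module R) = carrier R"
    by (simp add: regular_module_def)
  have "zero_module (quotient_module (regular_module R) I) \<longleftrightarrow> (\<forall>x\<in>carrier R. I +>\<^bsub>regular_module R\<^esub> x = \<zero>\<^bsub>quotient_module (regular_module R) I\<^esub>)"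
    unfolding zero_module_def MN.quotient_carrier car using one_closed by blast
  also have "\<dots> \<longleftrightarrow> (\<forall>x\<in>carrier R. x \<in> I)"
    using MN.coset_eq_zero_iff by (simp add: car)
  finally show ?thesis
    using I.a_subset by blast
qed

text \<open>Multiplication by the non-zero-divisor g. For n = p - 1 and a generator g of the
  ramification ideal I, the target is I/I^p.\<close>

lemma module_isomorphic_principal_quotient:
  assumes g: "g \<in> carrier R" and inj: "\<And>x. x \<in> carrier R \<Longrightarrow> g \<otimes> x = \<zero> \<Longrightarrow> x = \<zero>"
  shows "module_isomorphic R (quotient_module (regular_module R) (PIdl (g [^] (n::nat))))
    (quotient_module (regular_module R\<lparr>carrier := PIdl g\<rparr>) (PIdl (g [^] Suc n)))"
proof -
  define J where "J = PIdl (g [^] Suc n)"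
  have id: "ideal (PIdl g) R" "ideal (PIdl (g [^] n)) R" "ideal J R"
    using g by (auto simp: J_def intro: cgenideal_ideal)
  have sub: "J \<subseteq> PIdl g"
    using g by (auto simp: J_def cgenideal_def m_assoc[symmetric])
  note I = ideal_submodule_of_ideal[OF id(1,3) sub]
  interpret Q: module_with_submodule R "regular_module R\<lparr>carrier := PIdl g\<rparr>" "J"
    by (intro module_with_submodule.intro I module_with_submodule_axioms.intro)
  let ?I = "regular_module R\<lparr>carrier := PIdl g\<rparr>"
  have ops: "x \<oplus>\<^bsub>?I\<^esub> y = x \<oplus> y" "r \<odot>\<^bsub>?I\<^esub> x = r \<otimes> x" "\<zero>\<^bsub>?I\<^esub> = \<zero>" "carrier ?I = PIdl g"
     "carrier (regular_module R) = carrier R" "x \<oplus>\<^bsub>regular_module R\<^esub> y = x \<oplus> y"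
     "r \<odot>\<^bsub>regular_module R\<^esub> x = r \<otimes> x" for x y r
    by (simp_all add: regular_module_def)
  have mem: "x \<otimes> g \<in> PIdl g" if "x \<in> carrier R" for x
    using that by (auto simp: cgenideal_def)
  have cancel: "x = y" if "x \<in> carrier R" "y \<in> carrier R" "x \<otimes> g = y \<otimes> g" for x y
  proof -
    have "g \<otimes> (x \<ominus> y) = x \<otimes> g \<ominus> y \<otimes> g"
      using that(1,2) g by algebra
    also have "\<dots> = \<zero>"
      using that g by (simp add: r_right_minus_eq)
    finally show ?thesis
      using inj[of "x \<ominus> y"] that r_right_minus_eq by simp
  qed
  show ?thesis
    unfolding J_def[symmetric]
  proof (rule module_isomorphic_quotientI[where \<phi> = "\<lambda>x. J +>\<^bsub>?I\<^esub> (x \<otimes> g)"])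
    show "module R (regular_module R)"
      by (rule regular_is_module)
    show "module R (quotient_module ?I J)"
      by (rule Q.quotient_is_module)
    show "submodule (PIdl (g [^] n)) R (regular_module R)"
      by (rule ideal_is_submodule[OF id(2)])
    fix x assume "x \<in> carrier (regular_module R)"
    then have x: "x \<in> carrier R"
      by (simp add: ops)
    have "J +>\<^bsub>?I\<^esub> (x \<otimes> g) = \<zero>\<^bsub>quotient_module ?I J\<^esub> \<longleftrightarrow> x \<otimes> g \<in> J"
      using Q.coset_eq_zero_iff[of "x \<otimes> g"] mem[OF x] by (simp add: ops)
    also have "x \<otimes> g \<in> J \<longleftrightarrow> x \<in> PIdl (g [^] n)"
    proof
      assume "x \<otimes> g \<in> J"
      then obtain r where r: "r \<in> carrier R" "x \<otimes> g = (r \<otimes> g [^] n) \<otimes> g"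
        using g by (auto simp: J_def cgenideal_def m_assoc)
      then have "x = r \<otimes> g [^] n"
        using cancel[OF x _ r(2)] g by simp
      then show "x \<in> PIdl (g [^] n)"
        using r by (auto simp: cgenideal_def)
    qed (use g in \<open>auto simp: J_def cgenideal_def m_assoc\<close>)
    finally show "(J +>\<^bsub>?I\<^esub> (x \<otimes> g) = \<zero>\<^bsub>quotient_module ?I J\<^esub>) \<longleftrightarrow> x \<in> PIdl (g [^] n)" .
  next
    fix y assume "y \<in> carrier (quotient_module ?I J)"
    then show "\<exists>x\<in>carrier (regular_module R). y = J +>\<^bsub>?I\<^esub> (x \<otimes> g)"
      unfolding Q.quotient_carrier by (auto simp: ops cgenideal_def)
  qed (use g mem in \<open>auto simp: Q.quotient_carrier Q.quotient_add Q.quotient_smult ops l_distr m_assoc\<close>)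
qed

lemma principal_ideal_prod:
  assumes "a \<in> carrier R" "b \<in> carrier R"
  shows "ideal_prod R (PIdl a) (PIdl b) = PIdl (a \<otimes> b)"
proof -
  have id: "ideal (PIdl (a \<otimes> b)) R"
    using assms by (intro cgenideal_ideal) simp
  have "ideal_prod R (PIdl a) (PIdl b) = Idl (PIdl (a \<otimes> b))"
    using ideal_prod_eq_genideal[OF cgenideal_ideal cgenideal_ideal] cgenideal_prod assms by simp
  also have "\<dots> = PIdl (a \<otimes> b)"
    using genideal_minimal[OF id subset_refl] genideal_self[OF ideal.Icarr[OF id, THEN subsetI]] by blast
  finally show ?thesis .
qed

lemma principal_ideal_pow: "g \<in> carrier R \<Longrightarrow> (PIdl g) [^]\<^bsub>ideals_set R\<^esub> (n::nat) = PIdl (g [^] n)"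
proof (induction n)
  case 0
  have "PIdl \<one> = carrier R"
    by (force simp: cgenideal_def)
  then show ?case
    by (simp add: ideals_set_def nat_pow_def)
next
  case (Suc n)
  then show ?case
    using principal_ideal_prod[OF nat_pow_closed[OF Suc.prems, of n] Suc.prems] by (simp add: ideals_set_def nat_pow_def)
qed

lemma free_is_module: "module R (free_module R S)"
proof (rule moduleI, rule is_cring)
  let ?F = "free_module R S"
  have fin: "finite {s. f s \<oplus> g s \<noteq> \<zero>}" if "finite {s. f s \<noteq> \<zero>}" "finite {s. g s \<noteq> \<zero>}" for f g :: "'c \<Rightarrow> 'a"
    by (rule finite_subset[OF _ finite_UnI[OF that]]) auto
  have fin': "finite {s. h (f s) \<noteq> \<zero>}" if "finite {s. f s \<noteq> \<zero>}" "h \<zero> = \<zero>" for f :: "'c \<Rightarrow> 'a" and h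
    by (rule finite_subset[OF _ that(1)]) (use that(2) in auto)
  have cl: "f s \<in> carrier R" if "f \<in> carrier ?F" for f s
    using that by (cases "s \<in> S") (auto simp: free_module_def)
  note d = free_module_def
  show "abelian_group ?F"
  proof (rule abelian_groupI)
    fix x assume x: "x \<in> carrier ?F"
    then have "(\<lambda>s. \<ominus> x s) \<in> carrier ?F"
      using fin'[of x "a_inv R"] by (auto simp: d)
    moreover have "(\<lambda>s. \<ominus> x s) \<oplus>\<^bsub>?F\<^esub> x = \<zero>\<^bsub>?F\<^esub>"
      using cl[OF x] by (auto simp: d fun_eq_iff l_neg)
    ultimately show "\<exists>y\<in>carrier ?F. y \<oplus>\<^bsub>?F\<^esub> x = \<zero>\<^bsub>?F\<^esub>"
      by blast
  next
    fix x y assume "x \<in> carrier ?F" "y \<in> carrier ?F"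
    then show "x \<oplus>\<^bsub>?F\<^esub> y \<in> carrier ?F" "x \<oplus>\<^bsub>?F\<^esub> y = y \<oplus>\<^bsub>?F\<^esub> x"
      using fin cl[of x] cl[of y] by (auto simp: d a_comm)
  next
    fix x y z assume "x \<in> carrier ?F" "y \<in> carrier ?F" "z \<in> carrier ?F"
    then show "x \<oplus>\<^bsub>?F\<^esub> y \<oplus>\<^bsub>?F\<^esub> z = x \<oplus>\<^bsub>?F\<^esub> (y \<oplus>\<^bsub>?F\<^esub> z)"
      using cl[of x] cl[of y] cl[of z] by (auto simp: d a_assoc)
  next
    fix x assume "x \<in> carrier ?F"
    then show "\<zero>\<^bsub>?F\<^esub> \<oplus>\<^bsub>?F\<^esub> x = x"
      using cl[of x] by (auto simp: d)
  qed (auto simp: d)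
  fix a x assume a: "a \<in> carrier R" and x: "x \<in> carrier ?F"
  show "a \<odot>\<^bsub>?F\<^esub> x \<in> carrier ?F"
    using a x fin'[of x "\<lambda>t. a \<otimes> t"] by (auto simp: d)
  {
    fix b assume "b \<in> carrier R"
    then show "(a \<oplus> b) \<odot>\<^bsub>?F\<^esub> x = a \<odot>\<^bsub>?F\<^esub> x \<oplus>\<^bsub>?F\<^esub> b \<odot>\<^bsub>?F\<^esub> x" "a \<otimes> b \<odot>\<^bsub>?F\<^esub> x = a \<odot>\<^bsub>?F\<^esub> (b \<odot>\<^bsub>?F\<^esub> x)"
      using cl[OF x] a by (auto simp: d l_distr m_assoc)
  next
    fix y assume "y \<in> carrier ?F"
    then show "a \<odot>\<^bsub>?F\<^esub> (x \<oplus>\<^bsub>?F\<^esub> y) = a \<odot>\<^bsub>?F\<^esub> x \<oplus>\<^bsub>?F\<^esub> a \<odot>\<^bsub>?F\<^esub> y"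
      using cl[OF x] cl[of y] a by (auto simp: d r_distr)
  }
next
  fix x assume "x \<in> carrier (free_module R S)"
  then have "x s \<in> carrier R" for s
    by (cases "s \<in> S") (auto simp: free_module_def)
  then show "\<one> \<odot>\<^bsub>free_module R S\<^esub> x = x"
    by (auto simp: free_module_def)
qed

end

lemma (in module) submodule_module_span:
  assumes "S \<subseteq> carrier M"
  shows "submodule (module_span R M S) R M" "S \<subseteq> module_span R M S"
    "\<And>N. submodule N R M \<Longrightarrow> S \<subseteq> N \<Longrightarrow> module_span R M S \<subseteq> N"
proof -
  have c: "submodule (carrier M) R M"
    by (rule carrier_is_submodule)
  have z: "\<zero>\<^bsub>M\<^esub> \<in> N" if "submodule N R M" for N
    using subgroup.one_closed[OF submodule.axioms(1)[OF that]] by simp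
  show "submodule (module_span R M S) R M"
  proof (rule submoduleI)
    show "module_span R M S \<subseteq> carrier M"
      using c assms by (auto simp: module_span_def)
  qed (use z submoduleE in \<open>auto simp: module_span_def\<close>)
qed (auto simp: module_span_def)

lemma (in cring) kaehler_relations_subset:
  assumes "A \<subseteq> carrier R"
  shows "kaehler_relations R A \<subseteq> carrier (free_module R (carrier R))"
proof -
  interpret F: module R "free_module R (carrier R)"
    by (rule free_is_module)
  have "kaehler_gen R b \<in> carrier (free_module R (carrier R))" if "b \<in> carrier R" for b
    using that by (auto simp: free_module_def kaehler_gen_def)
  then show ?thesis
    using assms unfolding kaehler_relations_def Let_def by (auto intro!: F.M.minus_closed)
qed

text \<open>The isomorphism is induced by \<open>b \<mapsto> b dx\<close>. Its kernel is found by extending \<open>D\<close> linearly to the free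
  module on the symbols \<open>d b\<close>, which maps all relations into \<open>(g)\<close> and \<open>b dx\<close> to \<open>b\<close>.\<close>

lemma (in cring) kaehler_monogenic:
  assumes A: "A \<subseteq> carrier R" "\<zero> \<in> A" "\<one> \<in> A" and x: "x \<in> carrier R"
    and D_cl: "\<And>b. b \<in> carrier R \<Longrightarrow> D b \<in> carrier R"
    and D_add: "\<And>a b. a \<in> carrier R \<Longrightarrow> b \<in> carrier R \<Longrightarrow> D (a \<oplus> b) = D a \<oplus> D b"
    and D_A: "\<And>a. a \<in> A \<Longrightarrow> D a = \<zero>"
    and D_mult: "\<And>a b. a \<in> carrier R \<Longrightarrow> b \<in> carrier R \<Longrightarrow> D (a \<otimes> b) \<ominus> (a \<otimes> D b \<oplus> b \<otimes> D a) \<in> PIdl g"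
    and D_x: "D x = \<one>"
    and gen: "\<And>b. b \<in> carrier R \<Longrightarrow> \<exists>a. (\<forall>i. a i \<in> A) \<and> b = psum R n a x"
    and D_monom: "\<And>a i. a \<in> A \<Longrightarrow> i < n \<Longrightarrow> D (a \<otimes> x [^] i) = a \<otimes> ([i] \<cdot> \<one> \<otimes> x [^] (i - 1))"
    and g: "g = [n] \<cdot> \<one> \<otimes> x [^] (n - 1) \<ominus> D (x [^] n)"
  shows "module_isomorphic R (kaehler_module R A) (quotient_module (regular_module R) (PIdl g))"
proof -
  define F where "F = free_module R (carrier R)"
  define N where "N = module_span R F (kaehler_relations R A)"
  define Q where "Q = quotient_module F N"
  let ?d = "kaehler_gen R"
  interpret F: module R F
    unfolding F_def by (rule free_is_module)
  have F_car: "f \<in> carrier F \<longleftrightarrow> (\<forall>s. f s \<in> carrier R) \<and> (\<forall>s. s \<notin> carrier R \<longrightarrow> f s = \<zero>) \<and> finite {s. f s \<noteq> \<zero>}" for f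
    unfolding F_def free_module_def by auto
  have F_ops: "f \<oplus>\<^bsub>F\<^esub> h = (\<lambda>s. f s \<oplus> h s)" "r \<odot>\<^bsub>F\<^esub> f = (\<lambda>s. r \<otimes> f s)" "\<zero>\<^bsub>F\<^esub> = (\<lambda>s. \<zero>)" for f h r
    by (simp_all add: F_def free_module_def)
  have d: "?d b \<in> carrier F" if "b \<in> carrier R" for b
    using that by (auto simp: F_car kaehler_gen_def)
  have g_cl: "g \<in> carrier R"
    using x D_cl by (simp add: g)
  have id: "ideal (PIdl g) R"
    by (rule cgenideal_ideal[OF g_cl])
  interpret I: ideal "PIdl g" R by (rule id)
  let ?rel = "kaehler_relations R A"
  have rel1: "?d a \<in> ?rel" if "a \<in> A" for a
    using that by (auto simp: kaehler_relations_def Let_def)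
  have rel2: "?d (a \<oplus> b) \<ominus>\<^bsub>F\<^esub> (?d a \<oplus>\<^bsub>F\<^esub> ?d b) \<in> ?rel" if "a \<in> carrier R" "b \<in> carrier R" for a b
    using that unfolding kaehler_relations_def Let_def F_def by blast
  have rel3: "?d (a \<otimes> b) \<ominus>\<^bsub>F\<^esub> (a \<odot>\<^bsub>F\<^esub> ?d b \<oplus>\<^bsub>F\<^esub> b \<odot>\<^bsub>F\<^esub> ?d a) \<in> ?rel" if "a \<in> carrier R" "b \<in> carrier R" for a b
    using that unfolding kaehler_relations_def Let_def F_def by blast
  have rel_cases: "(\<exists>a\<in>A. r = ?d a)
      \<or> (\<exists>a\<in>carrier R. \<exists>b\<in>carrier R. r = ?d (a \<oplus> b) \<ominus>\<^bsub>F\<^esub> (?d a \<oplus>\<^bsub>F\<^esub> ?d b))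
      \<or> (\<exists>a\<in>carrier R. \<exists>b\<in>carrier R. r = ?d (a \<otimes> b) \<ominus>\<^bsub>F\<^esub> (a \<odot>\<^bsub>F\<^esub> ?d b \<oplus>\<^bsub>F\<^esub> b \<odot>\<^bsub>F\<^esub> ?d a))"
    if "r \<in> ?rel" for r
    using that unfolding kaehler_relations_def Let_def F_def[symmetric] by blast
  have rel_sub: "?rel \<subseteq> carrier F"
    unfolding F_def by (rule kaehler_relations_subset[OF A(1)])
  note span = F.submodule_module_span[OF rel_sub, folded N_def]
  interpret FN: module_with_submodule R F N
    by (intro module_with_submodule.intro F.module_axioms module_with_submodule_axioms.intro span)
  interpret Q: module R Q
    unfolding Q_def by (rule FN.quotient_is_module)
  note q = FN.quotient_carrier[folded Q_def] FN.quotient_add[folded Q_def] FN.quotient_smult[folded Q_def]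

  \<comment> \<open>The universal derivation: the quotient is generated by dx and killed by
    g\<close>
  define \<delta> where "\<delta> b = N +>\<^bsub>F\<^esub> ?d b" for b
  have \<delta>_cl: "\<delta> b \<in> carrier Q" if "b \<in> carrier R" for b
    using that d by (simp add: \<delta>_def q)
  have \<delta>_A: "\<delta> a = \<zero>\<^bsub>Q\<^esub>" if "a \<in> A" for a
    using that FN.coset_eq_zero_iff[of "?d a"] rel1 span(2) d A(1) by (auto simp: \<delta>_def Q_def)
  have \<delta>_add: "\<delta> (a \<oplus> b) = \<delta> a \<oplus>\<^bsub>Q\<^esub> \<delta> b" if "a \<in> carrier R" "b \<in> carrier R" for a b
    using that rel2[OF that] span(2) d FN.coset_eq_iff by (auto simp: \<delta>_def q)
  have \<delta>_mult: "\<delta> (a \<otimes> b) = a \<odot>\<^bsub>Q\<^esub> \<delta> b \<oplus>\<^bsub>Q\<^esub> b \<odot>\<^bsub>Q\<^esub> \<delta> a" if "a \<in> carrier R" "b \<in> carrier R" for a b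
    using that rel3[OF that] span(2) d FN.coset_eq_iff by (auto simp: \<delta>_def q)
  note \<delta>x = \<delta>_cl[OF x]
  have \<delta>_pow: "\<delta> (x [^] i) = ([i] \<cdot> \<one> \<otimes> x [^] (i - 1)) \<odot>\<^bsub>Q\<^esub> \<delta> x" for i :: nat
  proof (induction i)
    case 0
    then show ?case
      using \<delta>_A[OF A(3)] \<delta>x x by simp
  next
    case (Suc i)
    have "x \<otimes> ([i] \<cdot> \<one> \<otimes> x [^] (i - 1)) = [i] \<cdot> \<one> \<otimes> x [^] i"
      using x by (cases i) (auto simp: m_ac)
    then have "\<delta> (x [^] Suc i) = x [^] i \<odot>\<^bsub>Q\<^esub> \<delta> x \<oplus>\<^bsub>Q\<^esub> ([i] \<cdot> \<one> \<otimes> x [^] i) \<odot>\<^bsub>Q\<^esub> \<delta> x"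
      using \<delta>_mult[of "x [^] i" x] Suc x \<delta>x Q.smult_assoc1[of x "[i] \<cdot> \<one> \<otimes> x [^] (i - 1)" "\<delta> x"] by simp
    also have "\<dots> = ([Suc i] \<cdot> \<one> \<otimes> x [^] i) \<odot>\<^bsub>Q\<^esub> \<delta> x"
      using x \<delta>x by (simp add: Q.smult_l_distr[symmetric] l_distr a_comm)
    finally show ?case
      by simp
  qed
  \<comment> \<open>Both sides are additive in b, so it suffices to compare them on monomials with
    coefficients in A, where \<delta> kills the coefficient.\<close>
  have \<delta>_eq: "\<delta> b = D b \<odot>\<^bsub>Q\<^esub> \<delta> x" if "b \<in> carrier R" for b
  proof -
    obtain a where a: "\<And>i. a i \<in> A" "b = psum R n a x"
      using gen[OF \<open>b \<in> carrier R\<close>] by blast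
    have aR: "a i \<in> carrier R" for i
      using a A(1) by blast
    have "m \<le> n \<Longrightarrow> \<delta> (psum R m a x) = D (psum R m a x) \<odot>\<^bsub>Q\<^esub> \<delta> x" for m
    proof (induction m)
      case 0
      then show ?case
        using \<delta>_A[OF A(2)] D_A[OF A(2)] \<delta>x by simp
    next
      case (Suc m)
      let ?c = "[m] \<cdot> \<one> \<otimes> x [^] (m - 1)"
      have c: "?c \<in> carrier R"
        using x by simp
      have "\<delta> (a m \<otimes> x [^] m) = a m \<odot>\<^bsub>Q\<^esub> (?c \<odot>\<^bsub>Q\<^esub> \<delta> x)"
        using \<delta>_mult[OF aR[of m] nat_pow_closed[OF x, of m]] \<delta>_A[OF a(1)] \<delta>_pow[of m] \<delta>x x aR by simp
      also have "\<dots> = D (a m \<otimes> x [^] m) \<odot>\<^bsub>Q\<^esub> \<delta> x"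
        using D_monom[OF a(1)] Suc.prems aR c \<delta>x by (simp add: Q.smult_assoc1)
      finally show ?case
        using Suc aR x \<delta>x D_cl by (simp add: \<delta>_add D_add Q.smult_l_distr)
    qed
    then show ?thesis
      unfolding a(2) by blast
  qed
  \<comment> \<open>The differential of x^n is computed twice, by the power rule and through
    \<open>D\<close>; the two multiples of dx differ by g dx, which therefore vanishes.\<close>
  have "[n] \<cdot> \<one> \<otimes> x [^] (n - 1) = g \<oplus> D (x [^] n)"
    unfolding g using x D_cl by (simp add: minus_eq a_assoc l_neg)
  then have "(g \<oplus> D (x [^] n)) \<odot>\<^bsub>Q\<^esub> \<delta> x = D (x [^] n) \<odot>\<^bsub>Q\<^esub> \<delta> x"
    using \<delta>_pow[of n] \<delta>_eq[of "x [^] n"] x by simp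
  then have g\<delta>: "g \<odot>\<^bsub>Q\<^esub> \<delta> x = \<zero>\<^bsub>Q\<^esub>"
    using g_cl x D_cl \<delta>x by (simp add: Q.smult_l_distr)
  have surj: "\<exists>b\<in>carrier R. y = b \<odot>\<^bsub>Q\<^esub> \<delta> x" if "y \<in> carrier Q" for y
  proof -
    \<comment> \<open>Induction over a finite set that contains the support, setting one coefficient
      to zero at a time.\<close>
    have "\<exists>b\<in>carrier R. N +>\<^bsub>F\<^esub> f = b \<odot>\<^bsub>Q\<^esub> \<delta> x" if "finite S" "f \<in> carrier F" "{s. f s \<noteq> \<zero>} \<subseteq> S" for S f
      using that
    proof (induction S arbitrary: f rule: finite_induct)
      case empty
      then have "f = \<zero>\<^bsub>F\<^esub>"
        by (auto simp: F_ops)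
      then show ?case
        using FN.coset_eq_zero_iff[of f] FN.N_zero \<delta>x by (intro bexI[of _ \<zero>]) (auto simp: Q_def[symmetric])
    next
      case (insert s S)
      define h where "h = f(s := \<zero>)"
      have fs: "f s \<in> carrier R"
        using insert.prems by (simp add: F_car)
      have "{t. h t \<noteq> \<zero>} \<subseteq> {t. f t \<noteq> \<zero>}"
        by (auto simp: h_def)
      then have "finite {t. h t \<noteq> \<zero>}"
        by (rule finite_subset) (use insert.prems(1) in \<open>simp add: F_car\<close>)
      moreover have "h t \<in> carrier R" "t \<notin> carrier R \<Longrightarrow> h t = \<zero>" for t
        using insert.prems(1) by (auto simp: F_car h_def)
      ultimately have "h \<in> carrier F"
        by (simp add: F_car)
      moreover have "{t. h t \<noteq> \<zero>} \<subseteq> S"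
        using insert.prems(2) by (auto simp: h_def)
      ultimately obtain b where b: "b \<in> carrier R" "N +>\<^bsub>F\<^esub> h = b \<odot>\<^bsub>Q\<^esub> \<delta> x"
        using insert.IH by blast
      show ?case
      proof (cases "s \<in> carrier R")
        case False
        then have "h = f"
          using insert.prems(1) by (auto simp: h_def F_car)
        then show ?thesis
          using b by blast
      next
        case True
        have "f = h \<oplus>\<^bsub>F\<^esub> f s \<odot>\<^bsub>F\<^esub> ?d s"
          using insert.prems(1) by (auto simp: h_def F_ops F_car kaehler_gen_def fun_eq_iff)
        then have "N +>\<^bsub>F\<^esub> f = N +>\<^bsub>F\<^esub> (h \<oplus>\<^bsub>F\<^esub> f s \<odot>\<^bsub>F\<^esub> ?d s)"
          by simp
        also have "\<dots> = (b \<oplus> f s \<otimes> D s) \<odot>\<^bsub>Q\<^esub> \<delta> x"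
          using \<open>h \<in> carrier F\<close> fs d[OF True] b \<delta>_eq[OF True] D_cl[OF True] \<delta>x
          by (simp add: q(2,3)[symmetric] \<delta>_def[symmetric] Q.smult_l_distr Q.smult_assoc1)
        finally show ?thesis
          using b(1) fs D_cl[OF True] by blast
      qed
    qed
    then show ?thesis
      using that unfolding q(1) by (auto simp: F_car)
  qed

  \<comment> \<open>The linear extension of D to the free module, and the kernel\<close>
  define \<Phi> where "\<Phi> f = (\<Oplus>s\<in>{s. f s \<noteq> \<zero>}. f s \<otimes> D s)" for f
  \<comment> \<open>The index set may exceed the support, so that two elements can be summed over a
    common set.\<close>
  have Phi: "\<Phi> f = (\<Oplus>s\<in>S. f s \<otimes> D s)" if "f \<in> carrier F" "finite S" "{s. f s \<noteq> \<zero>} \<subseteq> S" "S \<subseteq> carrier R" for f S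
    unfolding \<Phi>_def using that D_cl by (intro add.finprod_mono_neutral_cong_left) (auto simp: F_car)
  have supp: "{s. f s \<noteq> \<zero>} \<subseteq> carrier R" "finite {s. f s \<noteq> \<zero>}" "f s \<in> carrier R" if "f \<in> carrier F" for f s
    using that by (auto simp: F_car)
  have Phi_cl: "\<Phi> f \<in> carrier R" if "f \<in> carrier F" for f
    unfolding \<Phi>_def using supp[OF that] D_cl by (intro finsum_closed) auto
  have Phi_add: "\<Phi> (f \<oplus>\<^bsub>F\<^esub> h) = \<Phi> f \<oplus> \<Phi> h" if "f \<in> carrier F" "h \<in> carrier F" for f h
  proof -
    let ?S = "{s. f s \<noteq> \<zero>} \<union> {s. h s \<noteq> \<zero>}"
    have S: "finite ?S" "?S \<subseteq> carrier R" "{s. (f \<oplus>\<^bsub>F\<^esub> h) s \<noteq> \<zero>} \<subseteq> ?S"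
      using supp that by (auto simp: F_ops)
    have cl: "f s \<in> carrier R" "h s \<in> carrier R" for s
      using supp(3) that by blast+
    have DS: "D s \<in> carrier R" if "s \<in> ?S" for s
      using D_cl S(2) that by blast
    have "\<Phi> (f \<oplus>\<^bsub>F\<^esub> h) = (\<Oplus>s\<in>?S. (f \<oplus>\<^bsub>F\<^esub> h) s \<otimes> D s)"
      by (rule Phi) (use S that in auto)
    also have "\<dots> = (\<Oplus>s\<in>?S. f s \<otimes> D s \<oplus> h s \<otimes> D s)"
      by (rule add.finprod_cong') (use cl DS in \<open>auto simp: F_ops l_distr\<close>)
    also have "\<dots> = (\<Oplus>s\<in>?S. f s \<otimes> D s) \<oplus> (\<Oplus>s\<in>?S. h s \<otimes> D s)"
      by (rule finsum_addf) (use cl DS in auto)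
    also have "(\<Oplus>s\<in>?S. f s \<otimes> D s) = \<Phi> f"
      by (rule Phi[symmetric]) (use S that in auto)
    also have "(\<Oplus>s\<in>?S. h s \<otimes> D s) = \<Phi> h"
      by (rule Phi[symmetric]) (use S that in auto)
    finally show ?thesis .
  qed
  have Phi_smult: "\<Phi> (r \<odot>\<^bsub>F\<^esub> f) = r \<otimes> \<Phi> f" if "r \<in> carrier R" "f \<in> carrier F" for r f
  proof -
    let ?S = "{s. f s \<noteq> \<zero>}"
    have cl: "f s \<in> carrier R" for s
      using supp(3) that by blast
    have DS: "D s \<in> carrier R" if "s \<in> ?S" for s
      using D_cl supp(1)[OF \<open>f \<in> carrier F\<close>] that by blast
    have "\<Phi> (r \<odot>\<^bsub>F\<^esub> f) = (\<Oplus>s\<in>?S. (r \<odot>\<^bsub>F\<^esub> f) s \<otimes> D s)"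
      by (rule Phi) (use that F.smult_closed[OF that] supp[OF that(2)] in \<open>auto simp: F_ops(2)\<close>)
    also have "\<dots> = (\<Oplus>s\<in>?S. r \<otimes> (f s \<otimes> D s))"
      by (rule add.finprod_cong') (use that cl DS in \<open>auto simp: F_ops(2) m_assoc\<close>)
    also have "\<dots> = r \<otimes> \<Phi> f"
      unfolding \<Phi>_def by (rule finsum_rdistr[symmetric]) (use that supp(2) cl DS in auto)
    finally show ?thesis .
  qed
  have Phi_uminus: "\<Phi> (\<ominus>\<^bsub>F\<^esub> f) = \<ominus> \<Phi> f" if "f \<in> carrier F" for f
  proof -
    have "\<Phi> (\<ominus>\<^bsub>F\<^esub> f) \<oplus> \<Phi> f = \<Phi> \<zero>\<^bsub>F\<^esub>"
      using Phi_add[of "\<ominus>\<^bsub>F\<^esub> f" f] that by (simp add: F.M.l_neg)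
    also have "\<dots> = \<zero>"
      by (simp add: \<Phi>_def F_ops(3))
    finally show ?thesis
      using minus_equality[of "\<Phi> (\<ominus>\<^bsub>F\<^esub> f)" "\<Phi> f"] Phi_cl that by simp
  qed
  have Phi_d: "\<Phi> (?d b) = D b" if "b \<in> carrier R" for b
  proof -
    have "\<Phi> (?d b) = (\<Oplus>s\<in>{b}. ?d b s \<otimes> D s)"
      by (rule Phi) (use d that in \<open>auto simp: kaehler_gen_def split: if_splits\<close>)
    then show ?thesis
      using D_cl[OF that] by (simp add: kaehler_gen_def)
  qed
  \<comment> \<open>The preimage of (g) is a submodule, so by minimality of the span only the
    generating relations are checked.\<close>
  have "N \<subseteq> {f \<in> carrier F. \<Phi> f \<in> PIdl g}"
  proof (rule span(3))
    show "submodule {f \<in> carrier F. \<Phi> f \<in> PIdl g} R F"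
    proof (rule F.submoduleI)
      show "\<zero>\<^bsub>F\<^esub> \<in> {f \<in> carrier F. \<Phi> f \<in> PIdl g}"
        using I.zero_closed by (simp add: \<Phi>_def) (simp add: F_ops(3))
    qed (auto simp: Phi_add Phi_smult Phi_uminus I.I_l_closed)
    show "?rel \<subseteq> {f \<in> carrier F. \<Phi> f \<in> PIdl g}"
    proof
      fix r assume r: "r \<in> ?rel"
      then have "r \<in> carrier F"
        using rel_sub by blast
      moreover have "\<Phi> r \<in> PIdl g"
        using rel_cases[OF r]
      proof (elim disjE bexE)
        fix a assume "a \<in> A" "r = ?d a"
        then show ?thesis
          using Phi_d[of a] D_A A(1) I.zero_closed by auto
      next
        fix a b assume ab: "a \<in> carrier R" "b \<in> carrier R" "r = ?d (a \<oplus> b) \<ominus>\<^bsub>F\<^esub> (?d a \<oplus>\<^bsub>F\<^esub> ?d b)"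
        then have "\<Phi> r = \<zero>"
          using d D_cl by (simp add: a_minus_def Phi_add Phi_uminus Phi_d D_add r_neg)
        then show ?thesis
          using I.zero_closed by simp
      next
        fix a b assume ab: "a \<in> carrier R" "b \<in> carrier R" "r = ?d (a \<otimes> b) \<ominus>\<^bsub>F\<^esub> (a \<odot>\<^bsub>F\<^esub> ?d b \<oplus>\<^bsub>F\<^esub> b \<odot>\<^bsub>F\<^esub> ?d a)"
        then have "\<Phi> r = D (a \<otimes> b) \<ominus> (a \<otimes> D b \<oplus> b \<otimes> D a)"
          using d D_cl by (simp add: a_minus_def Phi_add Phi_smult Phi_uminus Phi_d)
        then show ?thesis
          using D_mult[OF ab(1,2)] by simp
      qed
      ultimately show "r \<in> {f \<in> carrier F. \<Phi> f \<in> PIdl g}"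
        by blast
    qed
  qed
  then have N_Phi: "\<Phi> f \<in> PIdl g" if "f \<in> N" for f
    using that by blast
  have ker: "b \<odot>\<^bsub>Q\<^esub> \<delta> x = \<zero>\<^bsub>Q\<^esub> \<longleftrightarrow> b \<in> PIdl g" if b: "b \<in> carrier R" for b
  proof
    assume "b \<odot>\<^bsub>Q\<^esub> \<delta> x = \<zero>\<^bsub>Q\<^esub>"
    then have "b \<odot>\<^bsub>F\<^esub> ?d x \<in> N"
      using FN.coset_eq_zero_iff[of "b \<odot>\<^bsub>F\<^esub> ?d x", folded Q_def] q(3)[OF b d[OF x]] b d[OF x] by (simp add: \<delta>_def)
    then show "b \<in> PIdl g"
      using N_Phi[of "b \<odot>\<^bsub>F\<^esub> ?d x"] b d[OF x] by (simp add: Phi_smult Phi_d x D_x)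
  next
    assume "b \<in> PIdl g"
    then obtain r where "r \<in> carrier R" "b = r \<otimes> g"
      unfolding cgenideal_def by blast
    then show "b \<odot>\<^bsub>Q\<^esub> \<delta> x = \<zero>\<^bsub>Q\<^esub>"
      using g_cl \<delta>x g\<delta> by (simp add: Q.smult_assoc1)
  qed
  have reg: "carrier (regular_module R) = carrier R" "a \<oplus>\<^bsub>regular_module R\<^esub> b = a \<oplus> b" "r \<odot>\<^bsub>regular_module R\<^esub> a = r \<otimes> a" for a b r
    by (simp_all add: regular_module_def)
  have "module_isomorphic R (quotient_module (regular_module R) (PIdl g)) Q"
  proof (rule module_isomorphic_quotientI[where \<phi> = "\<lambda>b. b \<odot>\<^bsub>Q\<^esub> \<delta> x", OF regular_is_module _ ideal_is_submodule[OF id]])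
    show "module R Q"
      unfolding Q_def by (rule FN.quotient_is_module)
  qed (use \<delta>x surj ker in \<open>simp_all add: reg Q.smult_l_distr Q.smult_assoc1\<close>)
  moreover have "kaehler_module R A = Q"
    by (simp add: kaehler_module_def Let_def Q_def N_def F_def)
  moreover have "module R (quotient_module (regular_module R) (PIdl g))"
    by (intro module_with_submodule.quotient_is_module module_with_submodule.intro regular_is_module
        module_with_submodule_axioms.intro ideal_is_submodule id)
  ultimately show ?thesis
    using module_isomorphic_sym[of R "quotient_module (regular_module R) (PIdl g)" Q] by simp
qed

section \<open>Separability in degree \<open>p\<close>\<close>

lemma (in ring) normalize_eq_Nil_iff: "normalize l = [] \<longleftrightarrow> set l \<subseteq> {\<zero>}"
  by (induction l) (auto split: if_splits)

context prime_degree_extension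
begin

lemma coeff_in_K: "f \<in> carrier (K[X]) \<Longrightarrow> coeff f i \<in> K"
proof -
  assume "f \<in> carrier (K[X])"
  then have "set f \<subseteq> K"
    using polynomial_incl by (simp add: univ_poly_carrier[symmetric])
  moreover have "coeff f i \<in> set f \<union> {\<zero>}"
    using coeff_img(3)[of f] by blast
  ultimately show ?thesis
    using subringE(2)[OF subfieldE(1)[OF subfield_K]] by auto
qed

lemma eval_eq_psum:
  assumes "f \<in> carrier (K[X])" "y \<in> carrier F"
  shows "eval f y = psum F (length f) (coeff f) y"
proof -
  have "coeff f i \<in> carrier F" for i
    using coeff_in_K[OF assms(1)] K_subset by blast
  then show ?thesis
    using combine_exp_base_eq_psum[of "coeff f" y "length f"] combine_eq_eval[of f y] assms(2) by (simp add: coeff_list)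
qed

lemma poly_deriv_eq_Nil_iff:
  "poly_deriv F f = [] \<longleftrightarrow> (\<forall>i. 0 < i \<and> i < length f \<longrightarrow> [i] \<cdot> coeff f i = \<zero>)"
  unfolding poly_deriv_def normalize_eq_Nil_iff by (auto simp: image_subset_iff Suc_le_eq)

lemma poly_deriv_closed:
  assumes "f \<in> carrier (K[X])"
  shows "poly_deriv F f \<in> carrier (K[X])"
proof -
  note K = subringE[OF subfieldE(1)[OF subfield_K]]
  have mult: "[n] \<cdot> k \<in> K" if "k \<in> K" for n :: nat and k
    using that K by (induction n) auto
  have "set (map (\<lambda>i. [i] \<cdot> coeff f i) (rev [1..<length f])) \<subseteq> K"
    using mult coeff_in_K[OF assms] by auto
  then show ?thesis
    using normalize_gives_polynomial unfolding poly_deriv_def univ_poly_carrier[symmetric] by blast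
qed

lemma length_poly_deriv: "length (poly_deriv F f) \<le> length f - 1"
  using normalize_length_le[of "map (\<lambda>i. [i] \<cdot> coeff f i) (rev [1..<length f])"] by (simp add: poly_deriv_def)

lemma Irr_props:
  assumes "y \<in> carrier F"
  shows "Irr K y \<in> carrier (K[X])" "pirreducible K (Irr K y)" "Irr K y \<noteq> []" "coeff (Irr K y) (length (Irr K y) - 1) = \<one>"
    "eval (Irr K y) y = \<zero>"
proof -
  note I = IrrE[OF subfield_K assms algebraic_over_K[OF assms]]
  show "Irr K y \<in> carrier (K[X])" "pirreducible K (Irr K y)" "eval (Irr K y) y = \<zero>"
    using I by auto
  show "Irr K y \<noteq> []"
    using pirreducibleE(1)[OF subfieldE(1)[OF subfield_K] I(1,2)] .
  then show "coeff (Irr K y) (length (Irr K y) - 1) = \<one>"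
    using I(3) lead_coeff_simp by simp
qed

lemma psum_Irr:
  assumes "y \<in> carrier F" "y \<notin> K"
  shows "length (Irr K y) = Suc p" "psum F p (coeff (Irr K y)) y \<oplus> y [^] p = \<zero>"
proof -
  note I = Irr_props[OF assms(1)]
  show len: "length (Irr K y) = Suc p"
    using degree_Irr[OF assms] I(3) by (cases "Irr K y") auto
  have c: "coeff (Irr K y) i \<in> carrier F" for i
    using coeff_in_K[OF I(1)] K_subset by blast
  show "psum F p (coeff (Irr K y)) y \<oplus> y [^] p = \<zero>"
    using eval_eq_psum[OF I(1) assms(1)] I(4,5) psum_Suc[OF c assms(1), of p] assms(1) unfolding len by simp
qed

text \<open>The minimal polynomial must be X^p - y^p, whose derivative vanishes in characteristic p;
  it is then a common divisor of itself and its derivative that is not a unit.\<close>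

lemma not_separable_if_pow_in_K:
  assumes char: "[p] \<cdot> \<one> = \<zero>" and y: "y \<in> carrier F" "y \<notin> K" "y [^] p \<in> K"
  shows "\<not> separable_extension F K"
proof
  assume sep: "separable_extension F K"
  let ?f = "Irr K y"
  note I = Irr_props[OF y(1)] and P = psum_Irr[OF y(1,2)]
  have c: "coeff ?f i \<in> K" "coeff ?f i \<in> carrier F" for i
    using coeff_in_K[OF I(1)] K_subset by blast+
  note K = subringE[OF subfieldE(1)[OF subfield_K]]
  \<comment> \<open>Replacing the leading term by its value y^p, an element of K, turns f(y) = 0
    into a relation among 1, ..., y^(p-1). Hence all middle coefficients are 0.\<close>
  let ?a = "\<lambda>i. coeff ?f i \<oplus> (if i = 0 then y [^] p else \<zero>)"
  have aK: "?a i \<in> K" for i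
    using c y(3) K by auto
  have "psum F p ?a y = psum F p (coeff ?f) y \<oplus> psum F p (\<lambda>i. if i = 0 then y [^] p else \<zero>) y"
    by (rule psum_add) (use c y in auto)
  also have "\<dots> = \<zero>"
    using P(2) y(1) p_ge_2 by (simp add: psum_single)
  finally have a0: "?a i = \<zero>" if "i < p" for i
    using psum_eq_zeroD[OF y(1,2), of ?a i] aK that by blast
  have "[i] \<cdot> coeff ?f i = \<zero>" if i: "0 < i" "i < length ?f" for i
  proof (cases "i < p")
    case True
    then have "coeff ?f i = \<zero>"
      using a0[OF True] i c by simp
    then show ?thesis
      by simp
  next
    case False
    then have "i = p"
      using i P(1) by simp
    then show ?thesis
      using I(4) P(1) char by simp
  qed
  then have d: "poly_deriv F ?f = []"
    by (simp add: poly_deriv_eq_Nil_iff)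
  interpret U: domain "K[X]"
    by (rule univ_poly_is_domain[OF subfieldE(1)[OF subfield_K]])
  have "?f divides\<^bsub>K[X]\<^esub> ?f" "?f divides\<^bsub>K[X]\<^esub> poly_deriv F ?f"
    using I(1) U.divides_refl U.divides_zero unfolding d univ_poly_zero[of F K, symmetric] by auto
  moreover have "separable_poly F K ?f"
    using sep y(1) by (simp add: separable_extension_def)
  ultimately have "?f \<in> Units (K[X])"
    using I(1) by (auto simp: separable_poly_def)
  then show False
    using pirreducibleE(2)[OF subfieldE(1)[OF subfield_K] I(1,2)] by blast
qed

text \<open>If an irreducible f has a nontrivial divisor in common with f', then f divides f', and
  degrees force f' = 0. For y outside K, f has degree p and only the terms X^p and 1 survive, so y^p
  lies in K.\<close>

lemma separable_if_pow_notin_K: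
  assumes char: "[p] \<cdot> \<one> = \<zero>" and pow: "\<And>y. y \<in> carrier F \<Longrightarrow> y [^] p \<in> K \<Longrightarrow> y \<in> K"
  shows "separable_extension F K"
proof -
  note sK = subfieldE(1)[OF subfield_K]
  note K = subringE[OF sK]
  have "separable_poly F K (Irr K y)" if y: "y \<in> carrier F" for y
    unfolding separable_poly_def
  proof (intro ballI impI)
    let ?f = "Irr K y"
    note I = Irr_props[OF y]
    have c: "coeff ?f i \<in> K" "coeff ?f i \<in> carrier F" for i
      using coeff_in_K[OF I(1)] K_subset by blast+
    fix g assume g: "g \<in> carrier (K[X])" and dvd: "g divides\<^bsub>K[X]\<^esub> ?f \<and> g divides\<^bsub>K[X]\<^esub> poly_deriv F ?f"
    interpret U: domain "K[X]"
      by (rule univ_poly_is_domain[OF sK])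
    show "g \<in> Units (K[X])"
    proof (rule ccontr)
      assume "g \<notin> Units (K[X])"
      then have "g \<sim>\<^bsub>K[X]\<^esub> ?f"
        using divides_pirreducible_condition[OF I(2) g] dvd by blast
      then have "?f divides\<^bsub>K[X]\<^esub> poly_deriv F ?f"
        using dvd U.divides_trans I(1) unfolding associated_def by blast
      then have "?f pdivides poly_deriv F ?f"
        using pdivides_iff_shell[OF subfield_K I(1) poly_deriv_closed[OF I(1)]] by simp
      then have "poly_deriv F ?f = [] \<or> degree ?f \<le> degree (poly_deriv F ?f)"
        using pdivides_imp_degree_le[OF sK I(1) poly_deriv_closed[OF I(1)]] by blast
      moreover have deg: "degree ?f \<ge> 1"
        by (rule pirreducible_degree[OF subfield_K I(1,2)])
      ultimately have "poly_deriv F ?f = []"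
        using length_poly_deriv[of ?f] by (cases "poly_deriv F ?f") auto
      then have zero: "[i] \<cdot> coeff ?f i = \<zero>" if "0 < i" "i < length ?f" for i
        using that by (simp add: poly_deriv_eq_Nil_iff)
      show False
      proof (cases "y \<in> K")
        case True
        have "[\<one>, \<ominus> y] \<in> carrier (K[X])"
          using True K by (simp add: univ_poly_carrier[symmetric] polynomial_def)
        moreover have "eval [\<one>, \<ominus> y] y = \<zero>"
          using y by (simp add: r_neg)
        ultimately have "?f pdivides [\<one>, \<ominus> y]"
          using Irr_minimal[OF subfield_K y algebraic_over_K[OF y]] by blast
        then have "degree ?f \<le> 1"
          using pdivides_imp_degree_le[OF sK I(1) \<open>[\<one>, \<ominus> y] \<in> carrier (K[X])\<close>] by simp
        then have "length ?f = 2"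
          using deg by simp
        then show False
          using zero[of 1] I(4) by simp
      next
        case False
        note P = psum_Irr[OF y False]
        have c0: "coeff ?f i = \<zero>" if i: "0 < i" "i < p" for i
        proof -
          have "coprime i p"
            using prime_p i by (metis coprime_commute nat_dvd_not_less prime_imp_coprime)
          \<comment> \<open>From i a = p b + 1, the vanishing of the i-fold and of the p-fold
            multiple of a coefficient implies that of the coefficient.\<close>
          then obtain a b where ab: "i * a = p * b + 1"
            using bezout_nat[of i p] i by auto
          have "[(i * a)] \<cdot> coeff ?f i = \<zero>"
            using zero[of i] i P(1) add.nat_pow_pow[OF c(2)[of i], of a i, symmetric] by simp
          moreover have "[p] \<cdot> coeff ?f i = \<zero>"
            using char c(2)[of i] add_pow_ldistr[of \<one> "coeff ?f i" p] by simp
          then have "[(p * b)] \<cdot> coeff ?f i = \<zero>"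
            using add.nat_pow_pow[OF c(2)[of i], of b p, symmetric] by simp
          then have "[(p * b + 1)] \<cdot> coeff ?f i = coeff ?f i"
            using c(2)[of i] by (simp add: add.nat_pow_mult[symmetric])
          ultimately show ?thesis
            using ab by simp
        qed
        have "psum F p (coeff ?f) y = psum F p (\<lambda>i. if i = 0 then coeff ?f 0 else \<zero>) y"
          by (rule psum_cong) (use c c0 y in auto)
        also have "\<dots> = coeff ?f 0"
          using psum_single[of "coeff ?f 0" y p 0] c y p_ge_2 by simp
        finally have "y [^] p = \<ominus> coeff ?f 0"
          using P(2) c(2)[of 0] y minus_equality[of "y [^] p" "coeff ?f 0"] by (simp add: a_comm)
        then show False
          using pow[OF y] False c(1) K(5) by simp
      qed
    qed
  qed
  then show ?thesis
    using algebraic_over_K by (simp add: separable_extension_def algebraic_extension_def over_def)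
qed

end

section \<open>The theorem\<close>

context kummer_monogenic
begin

lemma residue_char: "add_pow (residue_field L v) p \<one>\<^bsub>residue_field L v\<^esub> = \<zero>\<^bsub>residue_field L v\<^esub>"
proof -
  interpret h: ring_hom_cring "val_Ring L v" "residue_field L v" "residue L v" by (rule residue_hom)
  have "add_pow (residue_field L v) p \<one>\<^bsub>residue_field L v\<^esub> = residue L v ([p] \<cdot> \<one>)"
    using h.hom_add_pow[of "\<one>" p] by (simp add: residue_field_one add_pow_def nat_pow_def)
  then show ?thesis
    using p_in_M M_subset_O residue_eq_zero_iff by blast
qed

lemma residue_pow: "b \<in> \<O> \<Longrightarrow> residue L v b [^]\<^bsub>residue_field L v\<^esub> (n::nat) = residue L v (b [^] n)"
proof -
  assume b: "b \<in> \<O>"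
  interpret h: ring_hom_cring "val_Ring L v" "residue_field L v" "residue L v" by (rule residue_hom)
  show ?thesis
    using h.hom_pow[of b n] b by (simp add: nat_pow_def)
qed

text \<open>A factor k from K with the same value as t is fixed by \<sigma>; the cofactor stays
  integral by \<open>Gal_O\<close>.\<close>

lemma Gal_M:
  assumes s: "\<sigma> \<in> Gal L K" and t: "t \<in> \<M>"
  shows "\<sigma> t \<in> \<M>"
proof (cases "t = \<zero>")
  case True
  interpret h: ring_hom_cring L L \<sigma>
    by (rule Gal_hom[OF field_axioms s])
  show ?thesis
    using True by simp
next
  case False
  interpret h: ring_hom_cring L L \<sigma>
    by (rule Gal_hom[OF field_axioms s])
  have tL: "t \<in> carrier L"
    using t by (simp add: M_mem)
  obtain k where k: "k \<in> K" "k \<noteq> \<zero>" "v k = v t"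
    using ex_same_value[OF tL False] by blast
  have kL: "k \<in> carrier L"
    using k K_closed by blast
  define w where "w = inv k \<otimes> t"
  have w: "w \<in> \<O>" "t = k \<otimes> w" "w \<in> carrier L"
    using k kL tL False by (auto simp: w_def O_mem v_mult v_inv m_assoc[symmetric])
  have "\<sigma> t = \<sigma> w \<otimes> k"
    unfolding w(2) using h.hom_mult[OF kL w(3)] Gal_fix[OF s k(1)] kL w(3) h.hom_closed[OF w(3)] by (simp add: m_comm)
  moreover have "k \<in> \<M>"
    using k t tL kL False by (simp add: M_mem)
  ultimately show ?thesis
    using Gal_O[OF s w(1)] by simp
qed

text \<open>By \<open>Gal_diff_O\<close>, \<sigma> acts trivially on the residue field, so all
  conjugates of x have the residue of x.\<close>

lemma not_separable_if_diff_in_M: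
  assumes s: "\<sigma> \<in> Gal L K" and moved: "\<sigma> \<theta> \<noteq> \<theta>" and M: "\<sigma> x \<ominus> x \<in> \<M>"
  shows "\<not> separable_extension (residue_field L v) (residue_subfield L v K)"
proof -
  interpret k: prime_degree_extension "residue_field L v" "residue_subfield L v K" p
    by (rule residue_extension)
  let ?l = "map (\<lambda>i. (\<sigma> ^^ i) x) [0..<p]"
  \<comment> \<open>The constant coefficient of the orbit polynomial, the product of the negatives
    of the p conjugates. Working with -x throughout avoids the sign (-1)^p.\<close>
  let ?n = "root_coeffs L ?l 0"
  have moved_x: "\<sigma> x \<noteq> x"
    using fixed_by_Gal[OF s theta(1) moved xL] xK by blast
  have nK: "?n \<in> K"
    by (rule root_coeffs_orbit_in_K[OF s theta(1) moved xL Gal_order[OF s xL moved_x]])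
  have sub: "\<P> (\<sigma> x \<ominus> x) \<subseteq> \<M>"
    using M by (auto simp: PIdl_mem)
  have orb: "(\<sigma> ^^ i) x \<in> \<O> \<and> (\<sigma> ^^ i) x \<ominus> x \<in> \<M>" for i
  proof (induction i)
    case 0
    then show ?case
      using xO by (simp add: minus_eq r_neg)
  next
    case (Suc i)
    let ?y = "(\<sigma> ^^ i) x"
    have yO: "?y \<in> \<O>"
      using Suc by blast
    have L: "?y \<in> carrier L" "\<sigma> ?y \<in> carrier L"
      using O_closed[OF yO] O_closed[OF Gal_O[OF s yO]] by auto
    have "\<sigma> ?y \<ominus> ?y \<in> \<M>"
      using Gal_diff_O[OF s yO resgen_x] sub by blast
    then have "(\<sigma> ?y \<ominus> ?y) \<oplus> (?y \<ominus> x) \<in> \<M>"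
      using Suc by simp
    also have "(\<sigma> ?y \<ominus> ?y) \<oplus> (?y \<ominus> x) = \<sigma> ?y \<ominus> x"
    proof -
      have "(e \<ominus> f) \<oplus> (f \<ominus> g) = e \<ominus> g" if "e \<in> carrier L" "f \<in> carrier L" "g \<in> carrier L" for e f g
        using that by (simp add: ring_cancel)
      then show ?thesis
        using L by simp
    qed
    finally show ?case
      using Gal_O[OF s yO] by simp
  qed
  have prod: "root_coeffs L rs 0 \<in> \<O> \<and> root_coeffs L rs 0 \<ominus> (\<ominus> x) [^] length rs \<in> \<M>"
    if "\<forall>r\<in>set rs. r \<in> \<O> \<and> r \<ominus> x \<in> \<M>" for rs
    using that
  proof (induction rs)
    case Nil
    then show ?case
      by (simp add: minus_eq r_neg)
  next
    case (Cons r rs)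
    let ?q = "root_coeffs L rs 0" and ?y = "(\<ominus> x) [^] length rs"
    have q: "?q \<in> \<O>" "?q \<ominus> ?y \<in> \<M>" "r \<in> \<O>" "r \<ominus> x \<in> \<M>"
      using Cons by auto
    have L: "?q \<in> carrier L" "?y \<in> carrier L" "r \<in> carrier L"
      using q O_closed by auto
    have yO: "?y \<in> \<O>"
      using xO by simp
    have "\<ominus> r \<otimes> (?q \<ominus> ?y) \<oplus> \<ominus> ?y \<otimes> (r \<ominus> x) \<in> \<M>"
      using q yO by (intro M_add M_mult) auto
    also have "\<ominus> r \<otimes> (?q \<ominus> ?y) \<oplus> \<ominus> ?y \<otimes> (r \<ominus> x) = (\<zero> \<ominus> r \<otimes> ?q) \<ominus> (?y \<otimes> \<ominus> x)"
    proof -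
      have "\<ominus> r \<otimes> (q \<ominus> y) \<oplus> \<ominus> y \<otimes> (r \<ominus> z) = (\<zero> \<ominus> r \<otimes> q) \<ominus> (y \<otimes> \<ominus> z)"
        if "q \<in> carrier L" "y \<in> carrier L" "z \<in> carrier L" for q y z
        using that L(3) by (simp add: ring_cancel)
      then show ?thesis
        using L by simp
    qed
    finally show ?case
      using q by simp
  qed
  have "?n \<in> \<O>" "?n \<ominus> (\<ominus> x) [^] p \<in> \<M>"
    using prod[of ?l] orb by auto
  then have res: "residue L v (\<ominus> x) [^]\<^bsub>residue_field L v\<^esub> p = residue L v ?n"
    using residue_pow[of "\<ominus> x" p] residue_eq_iff[of ?n "(\<ominus> x) [^] p"] xO by simp
  have "\<ominus> x \<ominus> a \<notin> \<M>" if "a \<in> K" "a \<in> \<O>" for a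
  proof
    assume "\<ominus> x \<ominus> a \<in> \<M>"
    then have "\<ominus> (\<ominus> x \<ominus> a) \<in> \<M>"
      by simp
    moreover have "\<ominus> (\<ominus> x \<ominus> a) = x \<ominus> \<ominus> a"
      using K_closed[OF that(1)] by (simp add: minus_eq minus_add)
    ultimately show False
      using resgen_x that K_ring(5) unfolding resgen_iff by auto
  qed
  then have "resgen (\<ominus> x)"
    using xO by (simp add: resgen_iff)
  then show ?thesis
    using nK \<open>?n \<in> \<O>\<close> res xO
    by (intro k.not_separable_if_pow_in_K[OF residue_char, of "residue L v (\<ominus> x)"])
      (auto simp: resgen_def residue_field_carrier residue_subfield_def val_ring_K)
qed

text \<open>If b^p is congruent to an element a of K for a residual generator b, then \<sigma>,
  which fixes a, preserves b^p modulo \<open>\<M>\<close>. In residue characteristic p this forces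
  \<sigma> b and b to be congruent, and \<sigma> x - x is a multiple of \<sigma> b - b.\<close>

lemma separable_if_diff_notin_M:
  assumes s: "\<sigma> \<in> Gal L K" and M: "\<sigma> x \<ominus> x \<notin> \<M>"
  shows "separable_extension (residue_field L v) (residue_subfield L v K)"
proof -
  interpret k: prime_degree_extension "residue_field L v" "residue_subfield L v K" p
    by (rule residue_extension)
  interpret O: cring "val_Ring L v" by (rule cring_O)
  interpret h: ring_hom_cring L L \<sigma>
    by (rule Gal_hom[OF field_axioms s])
  show ?thesis
  proof (rule k.separable_if_pow_notin_K[OF residue_char], rule ccontr)
    fix y assume y: "y \<in> carrier (residue_field L v)" "y [^]\<^bsub>residue_field L v\<^esub> p \<in> residue_subfield L v K"
      "y \<notin> residue_subfield L v K"
    then obtain b where b: "b \<in> \<O>" "y = residue L v b"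
      by (auto simp: residue_field_carrier)
    then have rb: "resgen b"
      using y by (simp add: resgen_def)
    have bL: "b \<in> carrier L" and sbO: "\<sigma> b \<in> \<O>"
      using b O_closed Gal_O[OF s] by auto
    then have sbL: "\<sigma> b \<in> carrier L"
      using O_closed by blast
    have "residue L v (b [^] p) \<in> residue_subfield L v K"
      using y(2) residue_pow[OF b(1)] b(2) by simp
    then obtain a where a: "a \<in> K" "a \<in> \<O>" and "residue L v (b [^] p) = residue L v a"
      by (auto simp: residue_subfield_def val_ring_K)
    then have aM: "b [^] p \<ominus> a \<in> \<M>"
      using residue_eq_iff[of "b [^] p" a] b(1) by simp
    have aL: "a \<in> carrier L"
      using a K_closed by blast
    have "\<sigma> (b [^] p \<ominus> a) = \<sigma> b [^] p \<ominus> a"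
      using Gal_fix[OF s a(1)] aL bL by (simp add: minus_eq h.hom_add h.hom_a_inv)
    then have "\<sigma> b [^] p \<ominus> a \<in> \<M>"
      using Gal_M[OF s aM] by simp
    then have "(\<sigma> b [^] p \<ominus> a) \<ominus> (b [^] p \<ominus> a) \<in> \<M>"
      using aM by simp
    also have "(\<sigma> b [^] p \<ominus> a) \<ominus> (b [^] p \<ominus> a) = \<sigma> b [^] p \<ominus> b [^] p"
    proof -
      have "(e \<ominus> a) \<ominus> (f \<ominus> a) = e \<ominus> f" if "e \<in> carrier L" "f \<in> carrier L" for e f
        using that aL by (simp add: ring_cancel)
      then show ?thesis
        using bL sbL by simp
    qed
    finally have dM: "\<sigma> b [^] p \<ominus> b [^] p \<in> \<M>" .
    have b0: "b \<noteq> \<zero>" "inv b \<in> \<O>"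
      using resgen_unit[OF rb] unit_mem[OF b(1)] unit_inv[OF bL] by auto
    define t where "t = \<sigma> b \<otimes> inv b \<ominus> \<one>"
    have tO: "t \<in> \<O>"
      using sbO b0 by (simp add: t_def)
    have tL: "t \<in> carrier L"
      using tO O_closed by blast
    have ib: "inv b \<in> carrier L" "b \<otimes> inv b = \<one>"
      using bL b0 by auto
    have t1: "\<one> \<oplus> t = \<sigma> b \<otimes> inv b"
    proof -
      have "\<one> \<oplus> (e \<ominus> \<one>) = e" if "e \<in> carrier L" for e
        using that by algebra
      then show ?thesis
        using sbL ib by (simp add: t_def)
    qed
    have "(\<one> \<oplus> t) [^] p \<ominus> \<one> = inv b [^] p \<otimes> (\<sigma> b [^] p \<ominus> b [^] p)"
    proof -
      have "inv b [^] p \<otimes> b [^] p = \<one>"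
        using nat_pow_distrib[OF bL ib(1), of p] ib(2) bL ib(1) by (simp add: m_comm)
      moreover have "q \<otimes> (e \<ominus> f) = e \<otimes> q \<ominus> q \<otimes> f" if "q \<in> carrier L" "e \<in> carrier L" "f \<in> carrier L" for q e f
        using that by algebra
      ultimately show ?thesis
        unfolding t1 using sbL ib bL by (simp add: nat_pow_distrib)
    qed
    then have u: "(\<one> \<oplus> t) [^] p \<ominus> \<one> \<in> \<M>"
      using M_mult[OF O_pow[OF b0(2)] dM] by simp
    obtain q where q: "q \<in> \<O>"
      "(\<one> \<oplus> t) [^] p = \<one> \<oplus> [p] \<cdot> \<one> \<otimes> t \<oplus> t [^] p \<oplus> [p] \<cdot> \<one> \<otimes> (t \<otimes> t \<otimes> q)"
      using O.one_plus_pow_prime[of t p] tO prime_p unfolding pow_val_Ring add_pow_val_Ring by auto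
    have qL: "q \<in> carrier L"
      using q O_closed by blast
    \<comment> \<open>The terms of (1 + t)^p that carry the factor p. Removing them and 1 leaves
      t^p, which therefore lies in \<open>\<M>\<close>.\<close>
    let ?m = "(t \<oplus> t \<otimes> t \<otimes> q) \<otimes> [p] \<cdot> \<one>"
    have "?m \<in> \<M>"
      using tO q p_in_M by (intro M_mult) auto
    then have "((\<one> \<oplus> t) [^] p \<ominus> \<one>) \<ominus> ?m \<in> \<M>"
      using u by simp
    also have "((\<one> \<oplus> t) [^] p \<ominus> \<one>) \<ominus> ?m = t [^] p"
    proof -
      have "((\<one> \<oplus> k \<otimes> t \<oplus> e \<oplus> k \<otimes> (t \<otimes> t \<otimes> q)) \<ominus> \<one>) \<ominus> (t \<oplus> t \<otimes> t \<otimes> q) \<otimes> k = e"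
        if "k \<in> carrier L" "e \<in> carrier L" for k e
        using that tL qL by (simp add: ring_cancel)
      then show ?thesis
        unfolding q(2) using tL by simp
    qed
    finally have tM: "t \<in> \<M>"
      by (rule M_pow[OF tO])
    have "\<sigma> b \<ominus> b = b \<otimes> t"
    proof -
      have "b \<otimes> (\<sigma> b \<otimes> inv b \<ominus> \<one>) = \<sigma> b \<otimes> (b \<otimes> inv b) \<ominus> b"
        using bL sbL ib(1) by algebra
      then show ?thesis
        unfolding t_def ib(2) using sbL by simp
    qed
    then have "\<sigma> b \<ominus> b \<in> \<M>"
      using tM b(1) by simp
    then have "\<P> (\<sigma> b \<ominus> b) \<subseteq> \<M>"
      by (auto simp: PIdl_mem)
    then show False
      using Gal_diff_O[OF s xO rb] M by blast
  qed
qed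

lemma Omega_iso: "module_isomorphic (val_Ring L v) (Omega L K v) (val_ring_mod L v different)"
proof -
  interpret O: cring "val_Ring L v" by (rule cring_O)
  have psO: "psum (val_Ring L v) n a x = psum L n a x" if "\<And>i. a i \<in> \<O>" for n a
    by (induction n) (use that xO O_closed in \<open>auto simp: pow_val_Ring\<close>)
  have A: "val_ring L v K \<subseteq> \<O>" "\<zero> \<in> val_ring L v K" "\<one> \<in> val_ring L v K"
    using K_ring(2,3) by (auto simp: val_ring_K)
  have gen: "\<exists>a. (\<forall>i. a i \<in> val_ring L v K) \<and> b = psum (val_Ring L v) p a x" if "b \<in> \<O>" for b
  proof -
    obtain a where "\<And>i. a i \<in> K" "\<And>i. a i \<in> \<O>" "b = psum L p a x"
      using ex_O_psum[OF resgen_x \<open>b \<in> \<O>\<close>] by metis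
    then show ?thesis
      using psO[of a p] by (intro exI[of _ a]) (auto simp: val_ring_K)
  qed
  have monom: "D (a \<otimes> x [^] i) = a \<otimes> ([i] \<cdot> \<one> \<otimes> x [^] (i - 1))" if a: "a \<in> K" and i: "i < p" for a i
  proof (cases i)
    case 0
    then show ?thesis
      using D_K[OF a] K_closed[OF a] by simp
  next
    case (Suc m)
    have aL: "a \<in> carrier L"
      using a K_closed by blast
    have "D (a \<otimes> x [^] i) = psum L p (\<lambda>j. if j = m then [i] \<cdot> \<one> \<otimes> a else \<zero>) x"
      unfolding D_def coord_pow[OF i a]
      by (rule psum_cong) (use Suc aL in \<open>auto simp del: add.nat_pow_Suc\<close>)
    also have "\<dots> = [i] \<cdot> \<one> \<otimes> a \<otimes> x [^] m"
      using psum_single[of "[i] \<cdot> \<one> \<otimes> a" x p m] aL i Suc by (simp del: add.nat_pow_Suc)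
    finally show ?thesis
      using aL Suc by (simp add: m_ac del: add.nat_pow_Suc)
  qed
  show ?thesis
    unfolding Omega_def val_ring_mod_def
  proof (rule O.kaehler_monogenic[where D = D and x = x and n = p])
    show "different = add_pow (val_Ring L v) p \<one>\<^bsub>val_Ring L v\<^esub> \<otimes>\<^bsub>val_Ring L v\<^esub> x [^]\<^bsub>val_Ring L v\<^esub> (p - 1) \<ominus>\<^bsub>val_Ring L v\<^esub> D (x [^]\<^bsub>val_Ring L v\<^esub> p)"
      unfolding pow_val_Ring add_pow_val_Ring using xO D_O by (simp add: different_def)
    fix a b assume "a \<in> carrier (val_Ring L v)" "b \<in> carrier (val_Ring L v)"
    then show "D (a \<otimes>\<^bsub>val_Ring L v\<^esub> b) \<ominus>\<^bsub>val_Ring L v\<^esub> (a \<otimes>\<^bsub>val_Ring L v\<^esub> D b \<oplus>\<^bsub>val_Ring L v\<^esub> b \<otimes>\<^bsub>val_Ring L v\<^esub> D a) \<in> \<P> different"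
      using D_mult[of a b] D_O by simp
  next
    fix a i assume "a \<in> val_ring L v K" "i < p"
    then show "D (a \<otimes>\<^bsub>val_Ring L v\<^esub> x [^]\<^bsub>val_Ring L v\<^esub> i) = a \<otimes>\<^bsub>val_Ring L v\<^esub> (add_pow (val_Ring L v) i \<one>\<^bsub>val_Ring L v\<^esub> \<otimes>\<^bsub>val_Ring L v\<^esub> x [^]\<^bsub>val_Ring L v\<^esub> (i - 1))"
      unfolding pow_val_Ring add_pow_val_Ring using monom by (simp add: val_ring_K)
  qed (use A xO D_O D_add D_K D_x gen O_closed in \<open>auto simp: val_ring_K\<close>)
qed

text \<open>Inserting p = u (\<zeta> - 1)^(p-1) into p \<theta>^(p-1) produces the (p-1)-st power of
  (\<zeta> - 1) \<theta> = \<sigma> x - x.\<close>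

lemma ex_ramification_generator:
  obtains \<sigma> u where "\<sigma> \<in> Gal L K" "\<sigma> \<theta> \<noteq> \<theta>" "\<sigma> x \<ominus> x \<in> \<O>" "\<sigma> x \<ominus> x \<noteq> \<zero>"
    "ramification_ideal L K v = \<P> (\<sigma> x \<ominus> x)"
    "u \<in> carrier L" "u \<noteq> \<zero>" "v u = 0" "different = u \<otimes> (\<sigma> x \<ominus> x) [^] (p - 1)"
proof -
  obtain \<sigma> \<zeta> where s: "\<sigma> \<in> Gal L K" and z: "\<zeta> \<in> K" "\<zeta> [^] p = \<one>" "\<zeta> \<noteq> \<one>" "\<sigma> \<theta> = \<zeta> \<otimes> \<theta>"
    by (rule ex_generating_automorphism)
  have zL: "\<zeta> \<in> carrier L"
    using z K_closed by blast
  have g: "\<sigma> x \<ominus> x = (\<zeta> \<ominus> \<one>) \<otimes> \<theta>"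
    by (rule Gal_diff[OF s zL z(4)])
  obtain u where u: "u \<in> carrier L" "u \<noteq> \<zero>" "v u = 0" "[p] \<cdot> \<one> = u \<otimes> (\<zeta> \<ominus> \<one>) [^] (p - 1)"
    using root_of_unity_minus_one[OF zL z(2,3)] by blast
  have "\<sigma> \<theta> \<noteq> \<theta>"
    using z(3,4) m_rcancel[OF theta0 thetaL zL one_closed] by auto
  moreover have "\<sigma> x \<ominus> x \<noteq> \<zero>"
    unfolding g using zL z(3) theta0 r_right_minus_eq[of \<zeta> \<one>] by (simp add: integral_iff)
  moreover have "different = u \<otimes> (\<sigma> x \<ominus> x) [^] (p - 1)"
    unfolding g different_eq u(4) using u zL by (simp add: nat_pow_distrib m_assoc)
  moreover have "\<sigma> x \<ominus> x \<in> \<O>"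
    using Gal_O[OF s xO] xO by simp
  ultimately show ?thesis
    using that[OF s] ramification_ideal_eq[OF s z] u by blast
qed

text \<open>With I = (g) one has I^p = (g^p), and \<open>different\<close> generates (g^(p-1));
  multiplication by g gives the isomorphism.\<close>

lemma ramification_iso:
  "module_isomorphic (val_Ring L v) (val_ring_mod L v different) (ramification_quotient L K v p)"
proof -
  interpret O: cring "val_Ring L v" by (rule cring_O)
  obtain \<sigma> u where s: "\<sigma> x \<ominus> x \<in> \<O>" "\<sigma> x \<ominus> x \<noteq> \<zero>"
    "ramification_ideal L K v = \<P> (\<sigma> x \<ominus> x)"
    "u \<in> carrier L" "u \<noteq> \<zero>" "v u = 0" "different = u \<otimes> (\<sigma> x \<ominus> x) [^] (p - 1)"
    using ex_ramification_generator by metis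
  let ?g = "\<sigma> x \<ominus> x"
  have gL: "?g \<in> carrier L"
    using s(1) O_closed by blast
  have p: "Suc (p - 1) = p"
    using p_ge_2 by simp
  have "\<P> different = \<P> (?g [^] (p - 1))"
    unfolding s(7) using s(4-6) gL by (intro PIdl_unit_mult) auto
  moreover have "module_isomorphic (val_Ring L v)
      (quotient_module (regular_module (val_Ring L v)) (\<P> (?g [^]\<^bsub>val_Ring L v\<^esub> (p - 1))))
      (quotient_module (regular_module (val_Ring L v)\<lparr>carrier := \<P> ?g\<rparr>) (\<P> (?g [^]\<^bsub>val_Ring L v\<^esub> Suc (p - 1))))"
    by (rule O.module_isomorphic_principal_quotient) (use s gL O_closed in \<open>auto simp: integral_iff\<close>)
  ultimately show ?thesis
    using O.principal_ideal_pow[of ?g p] s(1)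
    unfolding val_ring_mod_def ramification_quotient_def Let_def s(3) p pow_val_Ring by simp
qed

lemma zero_Omega_iff: "zero_module (Omega L K v) \<longleftrightarrow> different \<notin> \<M>"
proof -
  interpret O: cring "val_Ring L v" by (rule cring_O)
  have id: "ideal (\<P> different) (val_Ring L v)"
    by (rule PIdl_ideal[OF different_O])
  have m1: "module (val_Ring L v) (val_ring_mod L v different)"
    unfolding val_ring_mod_def
    by (intro module_with_submodule.quotient_is_module module_with_submodule.intro O.regular_is_module
        module_with_submodule_axioms.intro O.ideal_is_submodule id)
  let ?F = "free_module (val_Ring L v) (carrier (val_Ring L v))"
  have "kaehler_relations (val_Ring L v) (val_ring L v K) \<subseteq> carrier ?F"
    by (rule O.kaehler_relations_subset) (auto simp: val_ring_K)
  then have m2: "module (val_Ring L v) (Omega L K v)"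
    unfolding Omega_def kaehler_module_def Let_def
    by (intro module_with_submodule.quotient_is_module module_with_submodule.intro O.free_is_module
        module_with_submodule_axioms.intro module.submodule_module_span(1))
  have "zero_module (Omega L K v) \<longleftrightarrow> zero_module (val_ring_mod L v different)"
    by (rule module_isomorphic_zero_module[OF m2 m1 Omega_iso])
  also have "\<dots> \<longleftrightarrow> \<P> different = \<O>"
    unfolding val_ring_mod_def using O.zero_module_quotient_iff[OF id] by simp
  also have "\<dots> \<longleftrightarrow> different \<notin> \<M>"
  proof
    assume "\<P> different = \<O>"
    then obtain r where "r \<in> \<O>" "\<one> = r \<otimes> different"
      using O_one PIdl_mem by blast
    then show "different \<notin> \<M>"
      using M_mult one_not_M by metis
  next
    assume "different \<notin> \<M>"
    then have "different \<noteq> \<zero>" "v different = 0"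
      using unit_mem[OF different_O] by auto
    then have "\<P> (different \<otimes> \<one>) = \<P> \<one>"
      by (intro PIdl_unit_mult) auto
    then show "\<P> different = \<O>"
      by (auto simp: PIdl_mem set_eq_iff O_closed)
  qed
  finally show ?thesis .
qed

lemma zero_Omega_iff_separable:
  "zero_module (Omega L K v) \<longleftrightarrow> separable_extension (residue_field L v) (residue_subfield L v K)"
proof -
  obtain \<sigma> u where s: "\<sigma> \<in> Gal L K" "\<sigma> \<theta> \<noteq> \<theta>" "\<sigma> x \<ominus> x \<in> \<O>" "\<sigma> x \<ominus> x \<noteq> \<zero>"
    "u \<in> carrier L" "u \<noteq> \<zero>" "v u = 0" "different = u \<otimes> (\<sigma> x \<ominus> x) [^] (p - 1)"
    using ex_ramification_generator by metis
  let ?g = "\<sigma> x \<ominus> x"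
  have uO: "u \<in> \<O>" "u \<notin> \<M>"
    using s(5-7) by (auto simp: O_mem M_mem)
  have "different \<in> \<M> \<longleftrightarrow> ?g \<in> \<M>"
  proof
    assume "different \<in> \<M>"
    then have "?g [^] (p - 1) \<in> \<M>"
      unfolding s(8) using M_prime[OF uO(1) O_pow[OF s(3), of "p - 1"]] uO(2) by blast
    then show "?g \<in> \<M>"
      by (rule M_pow[OF s(3)])
  next
    assume g: "?g \<in> \<M>"
    \<comment> \<open>The exponent is positive because p >= 2; only then does the power stay in
      \<open>\<M>\<close>.\<close>
    have "p - 1 = Suc (p - 2)"
      using p_ge_2 by simp
    then have "?g [^] (p - 1) \<in> \<M>"
      using g s(3) by simp
    then show "different \<in> \<M>"
      unfolding s(8) using uO by simp
  qed
  then show ?thesis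
    using zero_Omega_iff not_separable_if_diff_in_M[OF s(1,2)] separable_if_diff_notin_M[OF s(1)] by blast
qed

end

theorem theorem4p7:
  fixes L :: "('a, 'm) ring_scheme" (structure)
    and K :: "'a set"
    and v :: "'a \<Rightarrow> 'g :: linordered_ab_group_add"
    and p :: nat
  assumes "valued_field L v"
    and "kummer_extension L K p"
    and "ring.dimension (residue_field L v) p (residue_subfield L v K) (carrier (residue_field L v))"
    and "p = characteristic ((residue_field L v)\<lparr>carrier := residue_subfield L v K\<rparr>)"
  shows "(\<exists>\<eta>. kummer_generator L K p \<eta> \<and> (case_i L K v \<eta> \<or> (\<exists>c. case_ii L K v \<eta> c)))
    \<and> (\<forall>\<eta>. kummer_generator L K p \<eta> \<and> case_i L K v \<eta> \<longrightarrow>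
          module_isomorphic (val_Ring L v) (Omega L K v) (val_ring_mod L v ([p] \<cdot> \<one>))
        \<and> module_isomorphic (val_Ring L v) (val_ring_mod L v ([p] \<cdot> \<one>))
            (ramification_quotient L K v p)
        \<and> \<not> zero_module (Omega L K v))
    \<and> (\<forall>\<eta> c. kummer_generator L K p \<eta> \<and> case_ii L K v \<eta> c \<longrightarrow>
          module_isomorphic (val_Ring L v) (Omega L K v)
            (val_ring_mod L v ([p] \<cdot> \<one> \<otimes> c [^] (p - 1)))
        \<and> module_isomorphic (val_Ring L v) (val_ring_mod L v ([p] \<cdot> \<one> \<otimes> c [^] (p - 1)))
            (ramification_quotient L K v p)
        \<and> (zero_module (Omega L K v) \<longleftrightarrow>
             separable_extension (residue_field L v) (residue_subfield L v K)))"
proof -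
  interpret valued_field L v
    by (rule assms(1))
  have kummer: "galois_extension L K" "Factorial_Ring.prime p" "dimension p K (carrier L)"
    "p \<noteq> characteristic (L\<lparr>carrier := K\<rparr>)" "card {\<zeta> \<in> K. \<zeta> [^] p = \<one>} = p"
    using assms(2) by (auto simp: kummer_extension_def)
  have K: "subfield K L"
    using kummer(1) by (simp add: galois_extension_def)
  have add_pow: "add_pow (R\<lparr>carrier := H\<rparr>) n y = add_pow R n y" for R :: "('x, 'y) ring_scheme" and H y and n :: nat
    by (simp add: add_pow_def nat_pow_def)
  \<comment> \<open>Division with remainder shows that the least m with m 1 = 0 divides p, and m = 1
    would give 1 = 0.\<close>
  have char_dvd: "m = p"
    if m: "m = (LEAST n. n > 0 \<and> [n] \<cdot> \<one> = \<zero>)" and p0: "[p] \<cdot> \<one> = \<zero>" for m :: nat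
  proof -
    have p_pos: "p > 0"
      using kummer(2) prime_gt_0_nat by blast
    have m0: "m > 0" "[m] \<cdot> \<one> = \<zero>"
      using LeastI[of "\<lambda>n. n > 0 \<and> [n] \<cdot> \<one> = \<zero>" p] p_pos p0 unfolding m by auto
    have m_min: "m \<le> n" if "n > 0" "[n] \<cdot> \<one> = \<zero>" for n :: nat
      unfolding m by (rule Least_le) (use that in simp)
    have "[(m * (p div m))] \<cdot> \<one> = \<zero>"
      using add.nat_pow_pow[OF one_closed, of "p div m" m] m0(2) by simp
    moreover have "[(m * (p div m) + p mod m)] \<cdot> \<one> = \<zero>"
      using p0 by simp
    ultimately have "[(p mod m)] \<cdot> \<one> = \<zero>"
      using add.nat_pow_mult[OF one_closed, of "m * (p div m)" "p mod m"] by simp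
    then have "p mod m = 0"
      using m_min[of "p mod m"] m0(1) by (metis mod_less_divisor not_gr_zero not_le)
    then have "m dvd p"
      by auto
    moreover have "m \<noteq> 1"
      using m0(2) by auto
    ultimately show "m = p"
      using kummer(2) by (auto simp: prime_nat_iff)
  qed
  have p_nonzero: "[p] \<cdot> \<one> \<noteq> \<zero>"
  proof
    assume p0: "[p] \<cdot> \<one> = \<zero>"
    have "\<exists>n::nat. n > 0 \<and> [n] \<cdot> \<one> = \<zero>"
      using p0 kummer(2) prime_gt_0_nat by blast
    then have "characteristic (L\<lparr>carrier := K\<rparr>) = (LEAST n. n > 0 \<and> [n] \<cdot> \<one> = \<zero>)"
      by (simp add: characteristic_def add_pow)
    then show False
      using char_dvd p0 kummer(4) by simp
  qed
  have p_in_M: "[p] \<cdot> \<one> \<in> \<M>"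
  proof -
    interpret h: ring_hom_cring "val_Ring L v" "residue_field L v" "residue L v" by (rule residue_hom)
    let ?P = "\<lambda>n::nat. n > 0 \<and> add_pow (residue_field L v) n \<one>\<^bsub>residue_field L v\<^esub> = \<zero>\<^bsub>residue_field L v\<^esub>"
    have char: "p = (if \<exists>n. ?P n then LEAST n. ?P n else 0)"
      using assms(4) by (simp add: characteristic_def add_pow cong: if_cong)
    moreover have "p \<noteq> 0"
      using kummer(2) by auto
    ultimately have ex: "\<exists>n. ?P n"
      by presburger
    then have "p = (LEAST n. ?P n)"
      using char by simp
    then have "?P p"
      using LeastI_ex[OF ex] by simp
    moreover have "add_pow (residue_field L v) p \<one>\<^bsub>residue_field L v\<^esub> = residue L v ([p] \<cdot> \<one>)"
      using h.hom_add_pow[of "\<one>" p] by (simp add: residue_field_one add_pow)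
    ultimately show ?thesis
      using residue_eq_zero_iff[of "[p] \<cdot> \<one>"] by simp
  qed
  interpret kummer_inert_extension L v K p
    by (intro kummer_inert_extension.intro residually_inert_extension.intro residually_inert_extension_axioms.intro
        kummer_prime_extension.intro kummer_prime_extension_axioms.intro kummer_inert_extension_axioms.intro
        prime_degree_extension.intro prime_degree_extension_axioms.intro
        assms(1,3) field_axioms K kummer(1-3,5) p_in_M p_nonzero)
  have monogenic: "kummer_monogenic L v K p \<theta> c"
    if "kummer_generator L K p \<theta>" "c \<in> K" "resgen (\<theta> \<ominus> c)" for \<theta> c
    using that kummer_generator_iff by unfold_locales auto
  \<comment> \<open>Assumes only \<open>resgen\<close>, not inseparability: the latter is deduced
    from this fact in \<open>inseparable\<close>.\<close>
  have case1: "module_isomorphic (val_Ring L v) (Omega L K v) (val_ring_mod L v ([p] \<cdot> \<one>))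
        \<and> module_isomorphic (val_Ring L v) (val_ring_mod L v ([p] \<cdot> \<one>)) (ramification_quotient L K v p)
        \<and> \<not> zero_module (Omega L K v)"
    if gen: "kummer_generator L K p \<eta>" and res: "resgen \<eta>" for \<eta>
  proof -
    have L: "\<eta> \<in> carrier L" "\<eta> \<in> \<O>"
      using res resgen_closed resgen_O by auto
    then have "resgen (\<eta> \<ominus> \<zero>)"
      using res by (simp add: minus_eq)
    then interpret m: kummer_monogenic L v K p \<eta> \<zero> "\<eta> \<ominus> \<zero>"
      using monogenic gen K_ring(2) by blast
    have u: "\<eta> [^] (p - 1) \<in> carrier L" "\<eta> [^] (p - 1) \<noteq> \<zero>" "v (\<eta> [^] (p - 1)) = 0"
      using resgen_unit[OF res] unit_mem[OF L(2)] v_pow_zero L by (auto simp: nat_pow_eq_0_iff)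
    have d: "m.different = \<eta> [^] (p - 1) \<otimes> [p] \<cdot> \<one>"
      using m.different_eq L by (simp add: m_comm)
    have "val_ring_mod L v m.different = val_ring_mod L v ([p] \<cdot> \<one>)"
      unfolding val_ring_mod_def d using PIdl_unit_mult[OF u] by simp
    moreover have "m.different \<in> \<M>"
      unfolding d using p_in_M L(2) by simp
    ultimately show ?thesis
      using m.Omega_iso m.ramification_iso m.zero_Omega_iff by simp
  qed
  have case2: "module_isomorphic (val_Ring L v) (Omega L K v) (val_ring_mod L v ([p] \<cdot> \<one> \<otimes> c [^] (p - 1)))
        \<and> module_isomorphic (val_Ring L v) (val_ring_mod L v ([p] \<cdot> \<one> \<otimes> c [^] (p - 1)))
            (ramification_quotient L K v p)
        \<and> (zero_module (Omega L K v) \<longleftrightarrow>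
             separable_extension (residue_field L v) (residue_subfield L v K))"
    if gen: "kummer_generator L K p \<eta>" and c: "case_ii L K v \<eta> c" for \<eta> c
  proof -
    have eta: "\<eta> \<in> carrier L" "\<eta> \<notin> K" "\<eta> [^] p \<in> K"
      using gen kummer_generator_iff by auto
    have eO: "\<eta> \<in> \<O>" and eM: "\<eta> \<ominus> \<one> \<in> \<M>" and cK: "c \<in> K" "c \<noteq> \<zero>" and res: "resgen (c \<otimes> (\<eta> \<ominus> \<one>))"
      using c by (auto simp: case_ii_def one_unit_def unit_generator_iff)
    have cL: "c \<in> carrier L"
      using cK K_closed by blast
    have "\<eta> \<notin> \<M>"
    proof
      assume "\<eta> \<in> \<M>"
      then have "\<eta> \<ominus> (\<eta> \<ominus> \<one>) \<in> \<M>"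
        using eM by simp
      moreover have "\<eta> \<ominus> (\<eta> \<ominus> \<one>) = \<one>"
        using eta(1) by algebra
      ultimately show False
        by simp
    qed
    then have u: "\<eta> [^] (p - 1) \<in> carrier L" "\<eta> [^] (p - 1) \<noteq> \<zero>" "v (\<eta> [^] (p - 1)) = 0"
      using unit_mem[OF eO] v_pow_zero eta(1) by (auto simp: nat_pow_eq_0_iff)
    \<comment> \<open>The Kummer element to use is c \<eta>: subtracting c, an element of K, from it
      gives c (\<eta> - 1).\<close>
    have "c \<otimes> \<eta> \<notin> K"
    proof
      assume "c \<otimes> \<eta> \<in> K"
      then have "inv c \<otimes> (c \<otimes> \<eta>) \<in> K"
        using K_inv[OF cK] K_ring(6) by blast
      then show False
        using eta(1,2) cL cK(2) by (simp add: m_assoc[symmetric])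
    qed
    moreover have "c [^] n \<in> K" for n :: nat
      using cK(1) K_ring(3,6) by (induction n) auto
    then have "(c \<otimes> \<eta>) [^] p \<in> K"
      using eta cL K_ring(6) by (simp add: nat_pow_distrib)
    ultimately have "kummer_generator L K p (c \<otimes> \<eta>)"
      using eta(1) cL by (simp add: kummer_generator_iff)
    moreover have "c \<otimes> \<eta> \<ominus> c = c \<otimes> (\<eta> \<ominus> \<one>)"
      using cL eta(1) by algebra
    then have "resgen (c \<otimes> \<eta> \<ominus> c)"
      using res by simp
    ultimately interpret m: kummer_monogenic L v K p "c \<otimes> \<eta>" c "c \<otimes> \<eta> \<ominus> c"
      using monogenic cK(1) by blast
    \<comment> \<open>This is p (c \<eta>)^(p-1), and the power of \<eta> is a unit that does not
      affect the ideal.\<close>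
    have "m.different = \<eta> [^] (p - 1) \<otimes> ([p] \<cdot> \<one> \<otimes> c [^] (p - 1))"
      using m.different_eq eta(1) cL by (simp add: nat_pow_distrib m_ac)
    then have "val_ring_mod L v m.different = val_ring_mod L v ([p] \<cdot> \<one> \<otimes> c [^] (p - 1))"
      unfolding val_ring_mod_def using PIdl_unit_mult[OF u] cL by simp
    then show ?thesis
      using m.Omega_iso m.ramification_iso m.zero_Omega_iff_separable by simp
  qed
  \<comment> \<open>As p is not a unit, \<Omega> is nonzero by \<open>case1\<close>, which by the
    general criterion excludes separability.\<close>
  have inseparable: "\<not> separable_extension (residue_field L v) (residue_subfield L v K)"
    if gen: "kummer_generator L K p \<eta>" and res: "resgen \<eta>" for \<eta>
  proof -
    have "resgen (\<eta> \<ominus> \<zero>)"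
      using res resgen_closed by (simp add: minus_eq)
    then interpret m: kummer_monogenic L v K p \<eta> \<zero> "\<eta> \<ominus> \<zero>"
      using monogenic gen K_ring(2) by blast
    show ?thesis
      using m.zero_Omega_iff_separable case1[OF gen res] by blast
  qed
  have "\<exists>\<eta>. kummer_generator L K p \<eta> \<and> (case_i L K v \<eta> \<or> (\<exists>c. case_ii L K v \<eta> c))"
  proof -
    obtain \<eta> where eta: "\<eta> \<in> carrier L" "\<eta> \<notin> K" "\<eta> [^] p \<in> K"
      "resgen \<eta> \<or> (\<exists>c\<in>K - {\<zero>}. \<eta> \<in> \<O> \<and> \<eta> \<ominus> \<one> \<in> \<M> \<and> resgen (c \<otimes> (\<eta> \<ominus> \<one>)))"
      by (rule ex_standard_kummer_element)
    then have gen: "kummer_generator L K p \<eta>"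
      by (simp add: kummer_generator_iff)
    show ?thesis
      using eta(4)
    proof
      assume "resgen \<eta>"
      then have "case_i L K v \<eta>"
        using inseparable[OF gen] by (simp add: case_i_def unit_generator_iff)
      then show ?thesis
        using gen by blast
    next
      assume "\<exists>c\<in>K - {\<zero>}. \<eta> \<in> \<O> \<and> \<eta> \<ominus> \<one> \<in> \<M> \<and> resgen (c \<otimes> (\<eta> \<ominus> \<one>))"
      then have "\<exists>c. case_ii L K v \<eta> c"
        by (auto simp: case_ii_def one_unit_def unit_generator_iff)
      then show ?thesis
        using gen by blast
    qed
  qed
  moreover have "resgen \<eta>" if "case_i L K v \<eta>" for \<eta>
    using that by (simp add: case_i_def unit_generator_iff)
  ultimately show ?thesis
    using case1 case2 by blast
qed

end
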